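(* For each $N$ consider a GOE random matrix of size $N\times N$, normalized such that the variance of its diagonal elements is equal to $2N$. For $k=1,2,\ldots,N$ let $\lambda^{(k)}(N)$ be the largest eigenvalue of the $(N+1-k)\times(N+1-k)$ top-left submatrix of that matrix. Then, for any fixed $K\in\mathbb{N}$, the random vectors $$\big(\lambda^{(1)}(N)-\lambda^{(2)}(N),\,\lambda^{(2)}(N)-\lambda^{(3)}(N),\,\ldots,\,\lambda^{(K)}(N)-\lambda^{(K+1)}(N)\big)$$ converge in distribution as $N\to\infty$ to a random vector with i.i.d. entries, each having the Gamma distribution on $(0,\infty)$ with density $$\frac{1}{\Gamma(1/2)}\Big(\frac{1}{2}\Big)^{1/2}x^{-1/2}e^{-x/2}.$$
   Context: GOE (Gaussian Orthogonal Ensemble) with diagonal variance $\sigma^2$: the real symmetric random matrix $M$ with density proportional to $\exp(-\mathrm{tr}(M^2)/(2\sigma^2))$; equivalently, the entries on and above the diagonal are independent centered Gaussians, with variance $\sigma^2$ on the diagonal and $\sigma^2/2$ off the diagonal. Here $\sigma^2=2N$. *)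

theory Defs
  imports
    "HOL-Probability.Probability"
    "Jordan_Normal_Form.Char_Poly"
    "Jordan_Normal_Form.DL_Submatrix"
begin

text \<open>
  \<open>goe P n v A\<close>: on the probability space \<open>P\<close>, \<open>A\<close> is a Gaussian Orthogonal Ensemble matrix of size
  \<open>n \<times> n\<close> whose diagonal entries have variance \<open>v\<close>. Rows and columns are indexed from \<open>0\<close>.
  The second argument of \<open>normal_density\<close> is a standard deviation.
\<close>

definition goe :: "'a measure \<Rightarrow> nat \<Rightarrow> real \<Rightarrow> ('a \<Rightarrow> real mat) \<Rightarrow> bool" where
  "goe P n v A \<longleftrightarrow>
     prob_space P \<and>
     (\<forall>\<omega>\<in>space P. A \<omega> \<in> carrier_mat n n \<and> transpose_mat (A \<omega>) = A \<omega>) \<and>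
     prob_space.indep_vars P (\<lambda>_. borel) (\<lambda>(i, j) \<omega>. A \<omega> $$ (i, j)) {(i, j). i \<le> j \<and> j < n} \<and>
     (\<forall>i<n. distributed P lborel (\<lambda>\<omega>. A \<omega> $$ (i, i)) (normal_density 0 (sqrt v))) \<and>
     (\<forall>i j. i < j \<and> j < n \<longrightarrow>
        distributed P lborel (\<lambda>\<omega>. A \<omega> $$ (i, j)) (normal_density 0 (sqrt (v / 2))))"

text \<open>An unspecified constant if \<open>A\<close> has no eigenvalue, in particular if \<open>A\<close> has size \<open>0\<close>.\<close>

definition max_eigenvalue :: "real mat \<Rightarrow> real" where
  "max_eigenvalue A = Max {x. eigenvalue A x}"

definition top_left :: "nat \<Rightarrow> 'a mat \<Rightarrow> 'a mat" where
  "top_left m A = submatrix A {..<m} {..<m}"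

text \<open>
  For an \<open>N \<times> N\<close> matrix this is meaningful only for \<open>1 \<le> k \<le> N\<close>.
\<close>

definition minor_eigenvalue :: "nat \<Rightarrow> nat \<Rightarrow> real mat \<Rightarrow> real" where
  "minor_eigenvalue N k A = max_eigenvalue (top_left (N + 1 - k) A)"

text \<open>
  The topology is passed explicitly so that \<open>\<real>\<^sup>K\<close> can be taken as the product topology over
  \<open>{1..K}\<close>, whose points are exactly those of the product measure space over \<open>{1..K}\<close>.
\<close>

definition weakly_converges :: "'a topology \<Rightarrow> (nat \<Rightarrow> 'a measure) \<Rightarrow> 'a measure \<Rightarrow> bool" where
  "weakly_converges T \<mu> \<nu> \<longleftrightarrow>
     (\<forall>f::'a \<Rightarrow> real. continuous_map T euclideanreal f \<and> bounded (f ` topspace T) \<longrightarrow>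
        (\<lambda>n. \<integral>x. f x \<partial>\<mu> n) \<longlonglongrightarrow> (\<integral>x. f x \<partial>\<nu>))"

definition gamma_density :: "real \<Rightarrow> real \<Rightarrow> real \<Rightarrow> real" where
  "gamma_density a b x =
     (if x > 0 then 1 / Gamma a * b powr a * x powr (a - 1) * exp (- b * x) else 0)"

end

theory Submission
  imports Defs "HOL-Real_Asymp.Real_Asymp"
begin

text \<open>
  Write the \<open>(n + 1) \<times> (n + 1)\<close> corner as a bordered matrix with \<open>n \<times> n\<close> corner \<open>C\<close>, last column \<open>b\<close>
  and last diagonal entry \<open>a\<close>, normalized to off-diagonal variance \<open>1\<close>, and let \<open>x\<close> be the difference of the
  two top eigenvalues. With \<open>u\<close> the top eigenvector of \<open>C\<close>, the secular equation says
  \<open>\<lambda> - a = (u \<bullet> b)\<^sup>2 / x + W\<close>, where \<open>W\<close> is the contribution of the other eigenvectors. Since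
  \<open>\<lambda> \<approx> 2 \<surd>n\<close>, and \<open>W \<approx> \<surd>n\<close> by the semicircle law at the edge, \<open>\<surd>n x \<approx> (u \<bullet> b)\<^sup>2\<close>. As \<open>b\<close> is independent of
  \<open>C\<close>, the numbers \<open>u \<bullet> b\<close> belonging to different \<open>n\<close> are independent standard normal variables, and
  their squares have the required Gamma distribution.

  Only the lower bound \<open>W \<ge> (1 - o(1)) \<surd>n\<close> is proved directly: replacing \<open>W\<close> by
  \<open>b\<^sup>T (z \<surd>n - C)\<^sup>-\<^sup>1 b\<close> with \<open>z\<close> slightly larger than \<open>2\<close> decreases it, and by orthogonal invariance this
  quantity satisfies, up to small errors, the recursion \<open>r \<mapsto> 1 / (z - r)\<close> in \<open>n\<close>. The same recursion, applied to the
  matrix inequality \<open>z \<surd>n - C \<ge> \<surd>n e e\<^sup>T\<close>, bounds the top eigenvalue. The lower bound gives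
  \<open>(u \<bullet> b)\<^sup>2 \<le> (1 + o(1)) \<surd>n x\<close> and \<open>\<surd>n x \<le> (1 + o(1)) n v\<^sup>2\<close>, where \<open>v\<close> is the last entry of the unit top
  eigenvector of the bordered matrix. By exchangeability \<open>n v\<^sup>2\<close> has mean at most \<open>1\<close>, the mean of
  \<open>(u \<bullet> b)\<^sup>2\<close>, so the three quantities are asymptotically equal.
\<close>

section \<open>Quadratic forms and Rayleigh quotients\<close>

text \<open>An upper bound for \<open>W\<close> would require control of the eigenvalues next to the
  top one, where the denominators of its summands degenerate. A lower bound can be read off at a
  spectral parameter at distance of order \<kappa> \<surd>n from the spectrum, where a crude
  one-column-at-a-time argument is stable; the missing direction then has to come from comparing
  means. At z = 2 the recursion started from 0 yields j / (j + 1), which tends to the fixed point 1.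
  Hence a number L of steps depending only on the desired accuracy suffices for the resolvent, and
  \<kappa> is chosen after L. The bound for the top eigenvalue does use all n columns, which is
  harmless because each step fails with exponentially small probability. Inverses and spectral
  decompositions are avoided by the formula b^T (Z - C)^(-1) b = sup over y of 2 b \<bullet> y - y^T
  (Z - C) y, valid for positive definite Z - C: a lower bound is certified by one vector y, and an
  upper bound is an inequality for all y. Both forms are also convenient for measurability.\<close>

text \<open>
  Since the dimension varies inside the statements, vectors and matrices are functions on \<open>nat\<close> of which
  only the indices below \<open>n\<close> matter.
\<close>

definition ip :: "nat \<Rightarrow> (nat \<Rightarrow> real) \<Rightarrow> (nat \<Rightarrow> real) \<Rightarrow> real" where
  "ip n x y = (\<Sum>i<n. x i * y i)"

definition bil :: "nat \<Rightarrow> (nat \<Rightarrow> nat \<Rightarrow> real) \<Rightarrow> (nat \<Rightarrow> real) \<Rightarrow> (nat \<Rightarrow> real) \<Rightarrow> real" where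
  "bil n C x y = (\<Sum>i<n. \<Sum>j<n. C i j * x i * y j)"

definition quad :: "nat \<Rightarrow> (nat \<Rightarrow> nat \<Rightarrow> real) \<Rightarrow> (nat \<Rightarrow> real) \<Rightarrow> real" where
  "quad n C y = bil n C y y"

definition mv :: "nat \<Rightarrow> (nat \<Rightarrow> nat \<Rightarrow> real) \<Rightarrow> (nat \<Rightarrow> real) \<Rightarrow> nat \<Rightarrow> real" where
  "mv n C y i = (\<Sum>j<n. C i j * y j)"

text \<open>The argument is the quadratic form and not its coefficients, so that conjugating a
  matrix by a rotation becomes composing the form with that rotation.\<close>

definition rayleigh_max :: "nat \<Rightarrow> ((nat \<Rightarrow> real) \<Rightarrow> real) \<Rightarrow> real" where
  "rayleigh_max n q = Sup (q ` {y. ip n y y = 1})"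

lemma ip_nonneg [simp]: "0 \<le> ip n y y"
  by (simp add: ip_def sum_nonneg)

lemma ip_commute: "ip n x y = ip n y x"
  by (simp add: ip_def mult.commute)

lemma ip_add_left: "ip n (\<lambda>i. x i + y i) z = ip n x z + ip n y z"
  and ip_scale_left: "ip n (\<lambda>i. c * x i) z = c * ip n x z"
  and ip_diff_left: "ip n (\<lambda>i. x i - y i) z = ip n x z - ip n y z"
  by (simp_all add: ip_def algebra_simps sum.distrib sum_distrib_left sum_subtractf)

lemma ip_add_right: "ip n z (\<lambda>i. x i + y i) = ip n z x + ip n z y"
  and ip_scale_right: "ip n z (\<lambda>i. c * x i) = c * ip n z x"
  and ip_diff_right: "ip n z (\<lambda>i. x i - y i) = ip n z x - ip n z y"
  by (simp_all add: ip_def algebra_simps sum.distrib sum_distrib_left sum_subtractf)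

lemmas ip_linear = ip_add_left ip_scale_left ip_diff_left ip_add_right ip_scale_right ip_diff_right

lemma ip_self_eq_0_iff: "ip n y y = 0 \<longleftrightarrow> (\<forall>i<n. y i = 0)"
  by (auto simp: ip_def sum_nonneg_eq_0_iff)

lemma ip_cong: "(\<And>i. i < n \<Longrightarrow> x i = x' i) \<Longrightarrow> (\<And>i. i < n \<Longrightarrow> y i = y' i) \<Longrightarrow> ip n x y = ip n x' y'"
  by (simp add: ip_def)

lemma ip_Suc: "ip (Suc n) x y = ip n x y + x n * y n"
  by (simp add: ip_def)

lemma ip_cauchy_schwarz: "(ip n x y)\<^sup>2 \<le> ip n x x * ip n y y"
  using Cauchy_Schwarz_ineq_sum[of x y "{..<n}"] by (simp add: ip_def power2_eq_square)

lemma coordinate_le_ip: "i < n \<Longrightarrow> (y i)\<^sup>2 \<le> ip n y y"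
  unfolding ip_def power2_eq_square by (rule member_le_sum) auto

lemma ip_normalized:
  assumes "ip n y y \<noteq> 0"
  shows "ip n (\<lambda>i. 1 / sqrt (ip n y y) * y i) (\<lambda>i. 1 / sqrt (ip n y y) * y i) = 1"
proof -
  have "ip n y y > 0" using assms ip_nonneg[of n y] by linarith
  then show ?thesis unfolding ip_linear by (simp add: field_simps)
qed

lemma bil_add_left: "bil n C (\<lambda>i. x i + y i) z = bil n C x z + bil n C y z"
  and bil_scale_left: "bil n C (\<lambda>i. c * x i) z = c * bil n C x z"
  and bil_diff_left: "bil n C (\<lambda>i. x i - y i) z = bil n C x z - bil n C y z"
  by (simp_all add: bil_def ring_distribs sum.distrib sum_subtractf sum_distrib_left mult_ac)

lemma bil_add_right: "bil n C z (\<lambda>i. x i + y i) = bil n C z x + bil n C z y"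
  and bil_scale_right: "bil n C z (\<lambda>i. c * x i) = c * bil n C z x"
  and bil_diff_right: "bil n C z (\<lambda>i. x i - y i) = bil n C z x - bil n C z y"
  by (simp_all add: bil_def ring_distribs sum.distrib sum_subtractf sum_distrib_left mult_ac)

lemmas bil_linear = bil_add_left bil_scale_left bil_diff_left bil_add_right bil_scale_right bil_diff_right

lemma bil_commute:
  assumes "\<And>i j. i < n \<Longrightarrow> j < n \<Longrightarrow> C i j = C j i"
  shows "bil n C x y = bil n C y x"
  unfolding bil_def by (subst sum.swap) (auto intro!: sum.cong simp: assms)

lemma bil_eq_ip_mv: "bil n C x y = ip n x (mv n C y)"
  by (simp add: bil_def ip_def mv_def sum_distrib_left mult_ac)

lemma quad_scale: "quad n C (\<lambda>i. c * y i) = c\<^sup>2 * quad n C y"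
  by (simp add: quad_def bil_linear power2_eq_square)

lemma quad_cong: "(\<And>i. i < n \<Longrightarrow> y i = y' i) \<Longrightarrow> quad n C y = quad n C y'"
  by (simp add: quad_def bil_def)

lemma quad_cong_coeff:
  "(\<And>i j. i < n \<Longrightarrow> j < n \<Longrightarrow> C i j = C' i j) \<Longrightarrow> quad n C = quad n C'"
  by (simp add: quad_def bil_def fun_eq_iff)

lemma quad_scale_coeff: "quad n (\<lambda>i j. c * C i j) y = c * quad n C y"
  by (simp add: quad_def bil_def sum_distrib_left mult_ac)

lemma quad_rank_one: "quad n (\<lambda>i j. C i j - h * e i * e j) y = quad n C y - h * (ip n e y)\<^sup>2"
proof -
  have "(ip n e y)\<^sup>2 = (\<Sum>i<n. \<Sum>j<n. e i * y i * (e j * y j))"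
    by (simp add: ip_def power2_eq_square sum_product)
  then show ?thesis
    by (simp add: quad_def bil_def sum_distrib_left algebra_simps sum_subtractf)
qed

lemma bil_Suc:
  "bil (Suc n) C x y = bil n C x y + y n * (\<Sum>i<n. C i n * x i) + x n * (\<Sum>j<n. C n j * y j) + C n n * x n * y n"
  by (simp add: bil_def sum.distrib sum_distrib_left algebra_simps)

lemma quad_Suc:
  assumes "\<And>i. i < n \<Longrightarrow> C n i = C i n"
  shows "quad (Suc n) C y = quad n C y + 2 * y n * ip n (\<lambda>i. C i n) y + C n n * (y n)\<^sup>2"
proof -
  have "(\<Sum>j<n. C n j * y j) = ip n (\<lambda>i. C i n) y"
    using assms by (simp add: ip_def)
  then show ?thesis
    by (simp add: quad_def bil_Suc ip_def power2_eq_square)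
qed

lemma continuous_on_ip_self [continuous_intros]: "continuous_on S (\<lambda>y. ip n y y)"
  and continuous_on_ip [continuous_intros]: "continuous_on S (ip n x)"
  and continuous_on_quad [continuous_intros]: "continuous_on S (quad n C)"
  and continuous_on_mv [continuous_intros]: "continuous_on S (\<lambda>y. mv n C y i)"
  unfolding ip_def quad_def bil_def mv_def
     by (intro continuous_on_sum continuous_on_mult continuous_on_const
           continuous_on_subset[OF continuous_on_product_coordinates subset_UNIV])+

text \<open>Vectors are functions on all of \<open>nat\<close>, so compactness holds only once the
  coordinates from \<open>n\<close> on are fixed to 0. The set is then closed in a product of
  compact intervals.\<close>

lemma compact_unit_sphere:
  "compact {y :: nat \<Rightarrow> real. (\<forall>i\<ge>n. y i = 0) \<and> ip n y y = 1}" (is "compact ?S")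
proof -
  let ?K = "PiE UNIV (\<lambda>i::nat. {-1..1::real})"
  have "compact ?K"
    unfolding compactin_euclidean_iff[symmetric] euclidean_product_topology[symmetric] compactin_PiE
    by auto
  moreover have "closed ?S"
  proof -
    have "?S = (\<Inter>i\<in>{n..}. {y. y i = 0}) \<inter> {y. ip n y y = 1}" by auto
    moreover have "closed {y :: nat \<Rightarrow> real. y i = 0}" for i
      by (intro closed_Collect_eq continuous_on_const continuous_on_product_coordinates)
    moreover have "closed {y. ip n y y = 1}"
      by (intro closed_Collect_eq continuous_on_const continuous_on_ip_self)
    ultimately show ?thesis by (auto intro!: closed_Int closed_INT)
  qed
  moreover have "?S \<subseteq> ?K"
  proof
    fix y assume y: "y \<in> ?S"
    have "\<bar>y i\<bar> \<le> 1" for i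
    proof (cases "i < n")
      case True
      then have "(y i)\<^sup>2 \<le> 1" using coordinate_le_ip[of i n y] y by auto
      then show ?thesis by (simp add: abs_square_le_1)
    next
      case False
      then show ?thesis using y by simp
    qed
    then show "y \<in> ?K" by (auto simp: abs_le_iff minus_le_iff)
  qed
  ultimately show ?thesis using compact_Int_closed[of ?K ?S] by (simp only: inf.absorb2)
qed

lemma rayleigh_max_attained:
  assumes "n \<ge> 1"
  obtains v where "ip n v v = 1" "quad n C v = rayleigh_max n (quad n C)"
    "\<And>y. quad n C y \<le> rayleigh_max n (quad n C) * ip n y y"
proof -
  let ?S = "{y :: nat \<Rightarrow> real. (\<forall>i\<ge>n. y i = 0) \<and> ip n y y = 1}"
  have ne: "(\<lambda>i. if i = 0 then 1 else 0) \<in> ?S"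
    using assms by (auto simp: ip_def if_distrib sum.delta cong: if_cong)
  have c: "continuous_on ?S (quad n C)" by (rule continuous_on_quad)
  then obtain v where v: "v \<in> ?S" "\<And>y. y \<in> ?S \<Longrightarrow> quad n C y \<le> quad n C v"
    using continuous_attains_sup[OF compact_unit_sphere _ c] ne by (metis (no_types, lifting) empty_iff)
  have le: "quad n C y \<le> quad n C v" if "ip n y y = 1" for y
  proof -
    let ?y = "\<lambda>i. if i < n then y i else 0"
    have "ip n ?y ?y = 1" using that by (simp add: ip_def)
    then have "quad n C ?y \<le> quad n C v" by (intro v) auto
    moreover have "quad n C ?y = quad n C y" by (rule quad_cong) auto
    ultimately show ?thesis by simp
  qed
  have eq: "rayleigh_max n (quad n C) = quad n C v"
    unfolding rayleigh_max_def using v(1) le by (intro cSup_eq_maximum) auto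
  have "quad n C y \<le> quad n C v * ip n y y" for y
  proof (cases "ip n y y = 0")
    case True
    then have "quad n C y = quad n C (\<lambda>i. 0)"
      by (intro quad_cong) (auto simp: ip_self_eq_0_iff)
    then show ?thesis using True by (simp add: quad_def bil_def)
  next
    case False
    then have pos: "ip n y y > 0" using ip_nonneg[of n y] by linarith
    have "quad n C (\<lambda>i. 1 / sqrt (ip n y y) * y i) \<le> quad n C v"
      by (rule le[OF ip_normalized[OF False]])
    then have "quad n C y / ip n y y \<le> quad n C v"
      using pos unfolding quad_scale by (simp add: power_divide)
    then show ?thesis using pos by (simp add: pos_divide_le_eq)
  qed
  then show ?thesis using v(1) eq by (intro that[of v]) auto
qed

lemma quad_le_rayleigh_max: "n \<ge> 1 \<Longrightarrow> quad n C y \<le> rayleigh_max n (quad n C) * ip n y y"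
  using rayleigh_max_attained by metis

lemma rayleigh_max_le_iff:
  assumes "n \<ge> 1"
  shows "rayleigh_max n (quad n C) \<le> c \<longleftrightarrow> (\<forall>y. quad n C y \<le> c * ip n y y)"
proof
  assume "rayleigh_max n (quad n C) \<le> c"
  then show "\<forall>y. quad n C y \<le> c * ip n y y"
    by (meson assms ip_nonneg mult_right_mono order_trans quad_le_rayleigh_max)
next
  obtain v where "ip n v v = 1" "quad n C v = rayleigh_max n (quad n C)"
    using rayleigh_max_attained[OF assms] by metis
  moreover assume "\<forall>y. quad n C y \<le> c * ip n y y"
  ultimately show "rayleigh_max n (quad n C) \<le> c" by (metis mult.right_neutral)
qed

lemma rayleigh_max_scale:
  assumes "n \<ge> 1" "c > 0"
  shows "rayleigh_max n (quad n (\<lambda>i j. c * C i j)) = c * rayleigh_max n (quad n C)"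
proof (rule antisym)
  show "rayleigh_max n (quad n (\<lambda>i j. c * C i j)) \<le> c * rayleigh_max n (quad n C)"
    using assms quad_le_rayleigh_max[OF assms(1)]
    by (simp add: rayleigh_max_le_iff quad_scale_coeff mult.assoc)
  obtain v where v: "ip n v v = 1" "quad n C v = rayleigh_max n (quad n C)"
    using rayleigh_max_attained[OF assms(1)] by metis
  show "c * rayleigh_max n (quad n C) \<le> rayleigh_max n (quad n (\<lambda>i j. c * C i j))"
    using quad_le_rayleigh_max[OF assms(1), of "\<lambda>i j. c * C i j" v] v
    by (simp add: quad_scale_coeff)
qed

text \<open>The nonnegative form \<open>\<lambda>\<parallel>y\<parallel>\<^sup>2 - y\<^sup>T C y\<close> vanishes at the maximizer \<open>v\<close>, so \<open>v\<close> lies in its kernel.\<close>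

lemma maximizer_eigenvector:
  assumes sym: "\<And>i j. i < n \<Longrightarrow> j < n \<Longrightarrow> C i j = C j i"
    and max: "\<And>y. quad n C y \<le> l * ip n y y"
    and v: "quad n C v = l * ip n v v"
  shows "bil n C y v = l * ip n y v" and "i < n \<Longrightarrow> mv n C v i = l * v i"
proof -
  show *: "bil n C y v = l * ip n y v" for y
  proof -
    define A where "A = l * ip n y y - quad n C y"
    define B where "B = l * ip n y v - bil n C y v"
    have nonneg: "0 \<le> A * t\<^sup>2 + 2 * B * t" for t
    proof -
      have "0 \<le> l * ip n (\<lambda>i. v i + t * y i) (\<lambda>i. v i + t * y i) - quad n C (\<lambda>i. v i + t * y i)"
        using max[of "\<lambda>i. v i + t * y i"] by simp
      also have "\<dots> = A * t\<^sup>2 + 2 * B * t"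
        using v bil_commute[where C=C and n=n and x=v and y=y, OF sym] ip_commute[of n v y]
        unfolding A_def B_def quad_def ip_linear bil_linear by (simp add: algebra_simps power2_eq_square)
      finally show ?thesis .
    qed
    have "B = 0"
    proof (rule ccontr)
      assume "B \<noteq> 0"
      have A: "A \<ge> 0" using max[of y] by (simp add: A_def)
      \<comment> \<open>The minimizer of the parabola would be - B / A; the 1 added to the
        denominator covers A = 0.\<close>
      have "0 \<le> A * (- B / (A + 1))\<^sup>2 + 2 * B * (- B / (A + 1))" by (rule nonneg)
      also have "\<dots> = (B / (A + 1))\<^sup>2 * (A - 2 * (A + 1))"
        using A by (simp add: power2_eq_square divide_simps) (simp add: algebra_simps)
      also have "\<dots> < 0" using A \<open>B \<noteq> 0\<close> by (intro mult_pos_neg) auto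
      finally show False by simp
    qed
    then show ?thesis by (simp add: B_def)
  qed
  assume i: "i < n"
  have "(\<Sum>k<n. (if k = i then 1 else 0) * f k) = (\<Sum>k<n. if k = i then f k else 0)" for f :: "nat \<Rightarrow> real"
    by (rule sum.cong) auto
  then have "(\<Sum>k<n. (if k = i then 1 else 0) * f k) = f i" for f :: "nat \<Rightarrow> real"
    using i by simp
  then show "mv n C v i = l * v i"
    using *[of "\<lambda>k. if k = i then 1 else 0"] unfolding bil_eq_ip_mv ip_def by metis
qed

lemma rayleigh_max_mono_size:
  assumes "n \<ge> 1" "\<And>i. i < n \<Longrightarrow> C n i = C i n"
  shows "rayleigh_max n (quad n C) \<le> rayleigh_max (Suc n) (quad (Suc n) C)"
  unfolding rayleigh_max_le_iff[OF assms(1)]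
proof
  fix y :: "nat \<Rightarrow> real"
  define z where "z = y(n := 0)"
  have "quad (Suc n) C z = quad n C y" "ip (Suc n) z z = ip n y y"
    using quad_Suc[where C=C and y=z and n=n] assms(2) by (auto simp: z_def ip_Suc intro: quad_cong ip_cong)
  then show "quad n C y \<le> rayleigh_max (Suc n) (quad (Suc n) C) * ip n y y"
    using quad_le_rayleigh_max[of "Suc n" C z] by simp
qed

text \<open>Cauchy-Schwarz in the form |p + r|^2 \<le> (1/x + 1/\<eta>) (x |p|^2 + \<eta> |r|^2),
  with the denominators cleared because \<open>x\<close> will be an eigenvalue difference that may
  vanish.\<close>

lemma sum_weighted_squares_ge:
  fixes p r :: "nat \<Rightarrow> real"
  assumes "x \<ge> 0" "\<eta> \<ge> 0"
  shows "x * \<eta> * ip n (\<lambda>i. p i + r i) (\<lambda>i. p i + r i) \<le> (x + \<eta>) * (x * ip n p p + \<eta> * ip n r r)"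
proof -
  have "0 \<le> ip n (\<lambda>i. x * p i - \<eta> * r i) (\<lambda>i. x * p i - \<eta> * r i)" by simp
  then show ?thesis
    unfolding ip_linear ip_commute[of n r p] by (simp add: algebra_simps)
qed

section \<open>Bordered symmetric matrices\<close>

text \<open>
  Writing \<open>w\<close> for the first \<open>n\<close> entries of the top eigenvector, \<open>p\<close> is a lower bound for
  \<open>b\<^sup>T (Z - C)\<^sup>-\<^sup>1 b\<close>, certified by \<open>y\<close>. In spectral terms the estimate is
  \<open>1/t\<^sup>2 \<le> (1/x + 1/\<eta>) (1/t - 1/(t + \<eta>))\<close> for \<open>t \<ge> x\<close>.
\<close>

lemma top_eigenvector_last_entry:
  fixes C :: "nat \<Rightarrow> nat \<Rightarrow> real" and n :: nat
  defines "l \<equiv> rayleigh_max (Suc n) (quad (Suc n) C)" and "m \<equiv> rayleigh_max n (quad n C)"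
  assumes n: "n \<ge> 1" and sym: "\<And>i j. C i j = C j i"
    and v: "ip (Suc n) v v = 1" "quad (Suc n) C v = l"
    and y: "p \<le> 2 * ip n (\<lambda>i. C i n) y - (Z * ip n y y - quad n C y)"
    and Z: "l + \<eta> \<le> Z" "\<eta> \<ge> 0"
  shows "(1 - (v n)\<^sup>2) * ((l - m) * \<eta>) \<le> (l - m + \<eta>) * ((v n)\<^sup>2 * (l - C n n - p))"
proof -
  define \<tau> where "\<tau> = v n"
  define b where "b = (\<lambda>i. C i n)"
  define Y where "Y = (\<lambda>i. \<tau> * y i)"
  have max: "quad (Suc n) C y \<le> l * ip (Suc n) y y" for y
    unfolding l_def by (rule quad_le_rayleigh_max) simp
  have ev: "mv (Suc n) C v i = l * v i" if "i < Suc n" for i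
    using maximizer_eigenvector(2)[of "Suc n" C l v i] sym max v that by auto
  have ev1: "mv n C v i + b i * \<tau> = l * v i" if "i < n" for i
    using ev[of i] that by (simp add: mv_def b_def \<tau>_def)
  have ev2: "ip n b v + C n n * \<tau> = l * \<tau>"
  proof -
    have "(\<Sum>j<n. C n j * v j) = ip n b v"
      unfolding ip_def b_def by (rule sum.cong) (simp_all add: sym)
    then show ?thesis using ev[of n] by (simp add: mv_def \<tau>_def)
  qed
  \<comment> \<open>The first \<open>n\<close> rows of the eigenvalue equation, (l - C) v = \<tau>
    b, paired with \<open>z\<close>.\<close>
  have tb: "\<tau> * ip n b z = l * ip n v z - bil n C v z" for z
  proof -
    have "bil n C v z + \<tau> * ip n b z = ip n z (\<lambda>i. mv n C v i + b i * \<tau>)"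
      using bil_commute[where C=C and n=n and x=z and y=v, OF sym] ip_scale_right[of n z \<tau> b] ip_commute[of n b z]
      by (simp add: ip_add_right bil_eq_ip_mv mult.commute[of _ \<tau>])
    also have "\<dots> = l * ip n v z"
      using ip_cong[of n z z "\<lambda>i. mv n C v i + b i * \<tau>" "\<lambda>i. l * v i"] ev1
      by (simp add: ip_scale_right ip_commute[of n z v])
    finally show ?thesis by simp
  qed
  have xle: "m \<le> l" unfolding m_def l_def by (rule rayleigh_max_mono_size[OF n]) (rule sym)
  have "\<tau>\<^sup>2 * p \<le> \<tau>\<^sup>2 * (2 * ip n b y - ((l + \<eta>) * ip n y y - quad n C y))"
  proof (rule mult_left_mono)
    have "(l + \<eta>) * ip n y y \<le> Z * ip n y y" using Z by (intro mult_right_mono) auto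
    then show "p \<le> 2 * ip n b y - ((l + \<eta>) * ip n y y - quad n C y)" using y by (simp add: b_def)
  qed simp
  also have "\<dots> = 2 * (\<tau> * ip n b Y) - (l + \<eta>) * ip n Y Y + quad n C Y"
    by (simp add: Y_def ip_linear quad_scale power2_eq_square algebra_simps)
  finally have 1: "\<tau>\<^sup>2 * p \<le> 2 * (l * ip n v Y - bil n C v Y) - (l + \<eta>) * ip n Y Y + quad n C Y"
    by (simp add: tb)
  have 2: "\<tau>\<^sup>2 * (l - C n n) = l * ip n v v - quad n C v"
  proof -
    have "ip n b v = (l - C n n) * \<tau>" using ev2 by (simp add: algebra_simps)
    then show ?thesis using tb[of v] by (simp add: power2_eq_square quad_def mult_ac)
  qed
  define d where "d = (\<lambda>i. v i - Y i)"
  \<comment> \<open>By \<open>tb\<close> the linear term of the certificate is the mixed term of the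
    form l - C at \<open>v\<close> and \<open>Y\<close>. Subtracting the certificate from fact 2
    therefore completes the square at \<open>d\<close>. The splitting of \<open>v\<close> into
    \<open>d\<close> and \<open>Y\<close> is what \<open>sum_weighted_squares_ge\<close> is applied
    to below.\<close>
  have 3: "l * ip n d d - quad n C d + \<eta> * ip n Y Y \<le> \<tau>\<^sup>2 * (l - C n n - p)"
  proof -
    have "\<tau>\<^sup>2 * (l - C n n - p) = l * ip n v v - quad n C v - \<tau>\<^sup>2 * p"
      using 2 by (simp add: algebra_simps)
    moreover have "l * ip n d d - quad n C d =
      l * ip n v v - quad n C v - 2 * (l * ip n v Y - bil n C v Y) + l * ip n Y Y - quad n C Y"
      unfolding d_def quad_def ip_linear bil_linear
      using bil_commute[where C=C and n=n and x=Y and y=v, OF sym] ip_commute[of n Y v] by (simp add: algebra_simps)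
    ultimately show ?thesis using 1 by (simp add: algebra_simps)
  qed
  have 4: "(l - m) * ip n d d + \<eta> * ip n Y Y \<le> \<tau>\<^sup>2 * (l - C n n - p)"
    using 3 quad_le_rayleigh_max[OF n, of C d] by (simp add: m_def algebra_simps)
  have "ip n v v = 1 - \<tau>\<^sup>2" using v(1) by (simp add: ip_Suc \<tau>_def power2_eq_square)
  moreover have "ip n v v = ip n (\<lambda>i. d i + Y i) (\<lambda>i. d i + Y i)" by (simp add: d_def)
  ultimately have "(l - m) * \<eta> * (1 - \<tau>\<^sup>2) \<le> (l - m + \<eta>) * ((l - m) * ip n d d + \<eta> * ip n Y Y)"
    using sum_weighted_squares_ge[of "l - m" \<eta> n d Y] xle Z(2) by simp
  also have "\<dots> \<le> (l - m + \<eta>) * (\<tau>\<^sup>2 * (l - C n n - p))"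
    using 4 xle Z(2) by (intro mult_left_mono) auto
  finally show ?thesis by (simp add: \<tau>_def mult_ac)
qed

text \<open>Nonnegativity of l - C in size n + 1 at the vectors (y + \<alpha> u, 1) is a quadratic
  inequality in \<alpha>. Its discriminant gives, up to error terms, (u \<bullet> b)^2 \<le> (l - m)
  (l - a - p) with a the corner entry: the summand of \<open>u\<close> in the secular equation is at
  most what the certified part \<open>p\<close> leaves. The number \<open>\<kappa>\<close> allows
  \<open>u\<close> to be only an approximate eigenvector.\<close>

lemma column_projection_le:
  fixes C :: "nat \<Rightarrow> nat \<Rightarrow> real" and n :: nat
  defines "l \<equiv> rayleigh_max (Suc n) (quad (Suc n) C)" and "m \<equiv> rayleigh_max n (quad n C)"
  assumes n: "n \<ge> 1" and sym: "\<And>i j. C i j = C j i"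
    and u: "ip n u u = 1" "(\<Sum>i<n. (mv n C u i - m * u i)\<^sup>2) \<le> \<kappa>\<^sup>2" "\<kappa> \<ge> 0"
    and y: "p \<le> 2 * ip n (\<lambda>i. C i n) y - (Z * ip n y y - quad n C y)"
    and Z: "l + \<eta> \<le> Z" "\<eta> > 0"
  shows "\<bar>ip n (\<lambda>i. C i n) u\<bar> \<le>
    sqrt ((l - m + \<kappa>) * (l - C n n - p)) + (l - m + \<kappa>) * sqrt ((l - C n n - p) / \<eta>)"
proof -
  define b where "b = (\<lambda>i. C i n)"
  define T where "T = l - C n n - p"
  define r where "r = (\<lambda>i. mv n C u i - m * u i)"
  have xle: "m \<le> l" unfolding m_def l_def by (rule rayleigh_max_mono_size[OF n]) (rule sym)
  have r: "ip n r r \<le> \<kappa>\<^sup>2" using u(2) by (simp add: ip_def r_def power2_eq_square)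
  have rz: "\<bar>ip n r z\<bar> \<le> \<kappa> * sqrt (ip n z z)" for z
  proof -
    have "(ip n r z)\<^sup>2 \<le> \<kappa>\<^sup>2 * ip n z z"
      using ip_cauchy_schwarz[of n r z] mult_right_mono[OF r, of "ip n z z"] by simp
    then have "sqrt ((ip n r z)\<^sup>2) \<le> sqrt (\<kappa>\<^sup>2 * ip n z z)" by (rule real_sqrt_le_mono)
    then show ?thesis using u(3) by (simp add: real_sqrt_mult)
  qed
  have bu: "bil n C z u = m * ip n z u + ip n r z" for z
    unfolding bil_eq_ip_mv r_def ip_linear by (simp add: ip_commute ip_linear)
  define q where "q = l - quad n C u"
  define c where "c = l * ip n u y - bil n C y u"
  have q0: "q \<ge> 0"
    using quad_le_rayleigh_max[OF n, of C u] u(1) xle by (simp add: q_def m_def)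
  have q1: "q \<le> l - m + \<kappa>"
    using rz[of u] bu[of u] u(1) by (simp add: q_def quad_def)
  have nonneg: "0 \<le> \<alpha>\<^sup>2 * q + 2 * \<alpha> * (c - ip n b u) + (T - \<eta> * ip n y y)" for \<alpha>
  proof -
    define z where "z = (\<lambda>i. if i = n then 1 else y i + \<alpha> * u i)"
    define w where "w = (\<lambda>i. y i + \<alpha> * u i)"
    have "quad (Suc n) C z = quad n C w + 2 * ip n b w + C n n"
      unfolding quad_Suc[where C=C, OF sym] b_def by (auto simp: z_def w_def intro!: arg_cong2[where f="(+)"] quad_cong ip_cong)
    moreover have "ip (Suc n) z z = ip n w w + 1"
      by (auto simp: ip_Suc z_def w_def intro!: ip_cong)
    ultimately have "0 \<le> l * ip n w w + l - (quad n C w + 2 * ip n b w + C n n)"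
      using quad_le_rayleigh_max[of "Suc n" C z] by (simp add: l_def algebra_simps)
    also have "\<dots> = (l * ip n y y - quad n C y - 2 * ip n b y) + \<alpha>\<^sup>2 * q + 2 * \<alpha> * (c - ip n b u) + l - C n n"
      unfolding w_def quad_def ip_linear bil_linear q_def c_def
      using bil_commute[where C=C and n=n and x=y and y=u, OF sym] ip_commute[of n y u] u(1)
      by (simp add: algebra_simps power2_eq_square)
    also have "\<dots> \<le> (- p - \<eta> * ip n y y) + \<alpha>\<^sup>2 * q + 2 * \<alpha> * (c - ip n b u) + l - C n n"
    proof -
      have "(l + \<eta>) * ip n y y \<le> Z * ip n y y" using Z by (intro mult_right_mono) auto
      then show ?thesis using y by (simp add: b_def algebra_simps)
    qed
    finally show ?thesis by (simp add: T_def algebra_simps)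
  qed
  have T: "\<eta> * ip n y y \<le> T" using nonneg[of 0] by simp
  have T0: "T \<ge> 0" using T Z(2) by (smt (verit) ip_nonneg mult_nonneg_nonneg)
  \<comment> \<open>The discriminant of \<open>nonneg\<close> as a polynomial in \<alpha>. If q = 0
    the linear coefficient must vanish, since otherwise the witness below would give the polynomial
    the value -1.\<close>
  have disc: "(c - ip n b u)\<^sup>2 \<le> q * (T - \<eta> * ip n y y)"
  proof (cases "q = 0")
    case True
    have "c - ip n b u = 0"
    proof (rule ccontr)
      assume ne: "c - ip n b u \<noteq> 0"
      have "0 \<le> 2 * (- (T - \<eta> * ip n y y + 1) / (2 * (c - ip n b u))) * (c - ip n b u) + (T - \<eta> * ip n y y)"
        using nonneg[of "- (T - \<eta> * ip n y y + 1) / (2 * (c - ip n b u))"] True by simp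
      also have "\<dots> = - 1" using ne by (simp add: field_simps)
      finally show False by simp
    qed
    then show ?thesis using True by simp
  next
    case False
    then have qp: "q > 0" using q0 by simp
    have "0 \<le> q * ((- (c - ip n b u) / q)\<^sup>2 * q + 2 * (- (c - ip n b u) / q) * (c - ip n b u) + (T - \<eta> * ip n y y))"
      using nonneg[of "- (c - ip n b u) / q"] qp by simp
    also have "\<dots> = q * (T - \<eta> * ip n y y) - (c - ip n b u)\<^sup>2"
      using qp by (simp add: field_simps power2_eq_square)
    finally show ?thesis by simp
  qed
  have "(c - ip n b u)\<^sup>2 \<le> (l - m + \<kappa>) * T"
    using disc mult_mono[OF q1, of "T - \<eta> * ip n y y" T] T Z(2) q0 q1 by (simp add: ip_nonneg)
  then have A: "\<bar>c - ip n b u\<bar> \<le> sqrt ((l - m + \<kappa>) * T)" by (simp add: real_le_rsqrt)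
  \<comment> \<open>The price of \<open>y\<close> having a component along \<open>u\<close>:
    \<open>c\<close> is (l - m) (u \<bullet> y) up to the residual, and the norm of \<open>y\<close>
    is controlled by fact \<open>T\<close>.\<close>
  have "\<bar>c\<bar> \<le> (l - m + \<kappa>) * sqrt (ip n y y)"
  proof -
    have "c = (l - m) * ip n u y - ip n r y"
      by (simp add: c_def bu ip_commute[of n y u] algebra_simps)
    moreover have "\<bar>ip n u y\<bar> \<le> sqrt (ip n y y)"
      using ip_cauchy_schwarz[of n u y] u(1) by (simp add: real_le_rsqrt)
    then have "\<bar>(l - m) * ip n u y\<bar> \<le> (l - m) * sqrt (ip n y y)"
      using xle by (simp add: abs_mult mult_left_mono)
    ultimately show ?thesis using rz[of y] by (simp add: algebra_simps)
  qed
  also have "\<dots> \<le> (l - m + \<kappa>) * sqrt (T / \<eta>)"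
    using T Z(2) xle u(3) by (intro mult_left_mono real_sqrt_le_mono) (auto simp: pos_le_divide_eq mult.commute)
  finally have B: "\<bar>c\<bar> \<le> (l - m + \<kappa>) * sqrt (T / \<eta>)" .
  show ?thesis using A B unfolding T_def b_def by linarith
qed

section \<open>Gaussian product measures and orthogonal invariance\<close>

definition std_gauss :: "real measure" where
  "std_gauss = density lborel std_normal_density"

definition gauss :: "'i set \<Rightarrow> ('i \<Rightarrow> real) measure" where
  "gauss I = PiM I (\<lambda>_. std_gauss)"

lemma sets_std_gauss [simp, measurable_cong]: "sets std_gauss = sets borel"
  and space_std_gauss [simp]: "space std_gauss = UNIV"
  by (simp_all add: std_gauss_def)

lemma prob_space_std_gauss: "prob_space std_gauss"
  unfolding std_gauss_def by (rule prob_space_normal_density) simp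

interpretation std_gauss: prob_space std_gauss
  by (rule prob_space_std_gauss)

interpretation std_gauss_prod: product_prob_space "\<lambda>_. std_gauss" I for I
  by standard

lemma sets_gauss [simp, measurable_cong]: "sets (gauss I) = sets (PiM I (\<lambda>_. borel))"
  unfolding gauss_def by (rule sets_PiM_cong) auto

lemma space_gauss: "space (gauss I) = PiE I (\<lambda>_. UNIV)"
  by (simp add: gauss_def space_PiM)

lemma prob_space_gauss: "prob_space (gauss I)"
  unfolding gauss_def by (rule prob_space_PiM) (rule prob_space_std_gauss)

interpretation gauss: prob_space "gauss I" for I
  by (rule prob_space_gauss)

lemma measurable_gauss_component [measurable]: "p \<in> I \<Longrightarrow> (\<lambda>g. g p) \<in> borel_measurable (gauss I)"
  by (simp add: measurable_cong_sets[OF sets_gauss refl] measurable_component_singleton)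

lemma distr_gauss_restrict:
  assumes "J \<subseteq> I" "finite I"
  shows "distr (gauss I) (gauss J) (\<lambda>g. restrict g J) = gauss J"
  using std_gauss_prod.distr_restrict[OF assms] unfolding gauss_def by simp

lemma nn_integral_shear:
  fixes f :: "real \<times> real \<Rightarrow> ennreal" and k :: real
  assumes [measurable]: "f \<in> borel_measurable (borel \<Otimes>\<^sub>M borel)"
  shows "(\<integral>\<^sup>+u. \<integral>\<^sup>+v. f (u, v + k * u) \<partial>lborel \<partial>lborel) = (\<integral>\<^sup>+u. \<integral>\<^sup>+v. f (u, v) \<partial>lborel \<partial>lborel)"
proof (rule nn_integral_cong)
  fix u :: real
  show "(\<integral>\<^sup>+v. f (u, v + k * u) \<partial>lborel) = (\<integral>\<^sup>+v. f (u, v) \<partial>lborel)"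
    using nn_integral_real_affine[of "\<lambda>v. f (u, v)" 1 "k * u"] by (simp add: add.commute)
qed

lemma nn_integral_shear':
  fixes f :: "real \<times> real \<Rightarrow> ennreal" and k :: real
  assumes [measurable]: "f \<in> borel_measurable (borel \<Otimes>\<^sub>M borel)"
  shows "(\<integral>\<^sup>+u. \<integral>\<^sup>+v. f (u + k * v, v) \<partial>lborel \<partial>lborel) = (\<integral>\<^sup>+u. \<integral>\<^sup>+v. f (u, v) \<partial>lborel \<partial>lborel)"
proof -
  have "(\<integral>\<^sup>+u. \<integral>\<^sup>+v. f (u + k * v, v) \<partial>lborel \<partial>lborel) = (\<integral>\<^sup>+v. \<integral>\<^sup>+u. f (u + k * v, v) \<partial>lborel \<partial>lborel)"
    by (rule lborel_pair.Fubini') measurable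
  also have "\<dots> = (\<integral>\<^sup>+v. \<integral>\<^sup>+u. f (u, v) \<partial>lborel \<partial>lborel)"
    using nn_integral_shear[of "\<lambda>(v, u). f (u, v)" k] by simp
  also have "\<dots> = (\<integral>\<^sup>+u. \<integral>\<^sup>+v. f (u, v) \<partial>lborel \<partial>lborel)"
    by (rule lborel_pair.Fubini') measurable
  finally show ?thesis .
qed

text \<open>A plane rotation is a product of three shears.\<close>

lemma nn_integral_rotation:
  fixes f :: "real \<times> real \<Rightarrow> ennreal" and c s :: real
  assumes [measurable]: "f \<in> borel_measurable (borel \<Otimes>\<^sub>M borel)" and cs: "c\<^sup>2 + s\<^sup>2 = 1" "s \<noteq> 0"
  shows "(\<integral>\<^sup>+u. \<integral>\<^sup>+v. f (c * u - s * v, s * u + c * v) \<partial>lborel \<partial>lborel) =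
    (\<integral>\<^sup>+u. \<integral>\<^sup>+v. f (u, v) \<partial>lborel \<partial>lborel)"
proof -
  \<comment> \<open>The tangent of half the rotation angle; the shears have the factors -t, s,
    -t.\<close>
  define t where "t = (1 - c) / s"
  have st: "s * t = 1 - c" using cs by (simp add: t_def)
  have "t * (1 + c) = (1 - c * c) / s" by (simp add: t_def algebra_simps)
  also have "\<dots> = s" using cs by (simp add: divide_simps power2_eq_square)
  finally have tc: "t * (1 + c) = s" .
  define A where "A = (\<lambda>(u, v). f (u + (- t) * v, v))"
  define B where "B = (\<lambda>(u, v). A (u, v + s * u))"
  have [measurable]: "A \<in> borel_measurable (borel \<Otimes>\<^sub>M borel)" unfolding A_def by measurable
  have [measurable]: "B \<in> borel_measurable (borel \<Otimes>\<^sub>M borel)" unfolding B_def by measurable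
  have "f (c * u - s * v, s * u + c * v) = B (u + (- t) * v, v)" for u v
  proof -
    have "v + s * (u + - t * v) = s * u + c * v"
      using st by (simp add: algebra_simps) (metis add_diff_cancel_left' diff_diff_eq2 mult.assoc mult.left_commute mult_1 ring_class.ring_distribs(2))
    moreover have "u + - t * v + - t * (s * u + c * v) = c * u - s * v"
    proof -
      have "u + - t * v + - t * (s * u + c * v) = (1 - s * t) * u - (t * (1 + c)) * v"
        by (simp add: algebra_simps)
      then show ?thesis by (simp add: st tc)
    qed
    ultimately show ?thesis by (simp add: A_def B_def)
  qed
  then have "(\<integral>\<^sup>+u. \<integral>\<^sup>+v. f (c * u - s * v, s * u + c * v) \<partial>lborel \<partial>lborel)
     = (\<integral>\<^sup>+u. \<integral>\<^sup>+v. B (u + (- t) * v, v) \<partial>lborel \<partial>lborel)" by simp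
  also have "\<dots> = (\<integral>\<^sup>+u. \<integral>\<^sup>+v. B (u, v) \<partial>lborel \<partial>lborel)" by (rule nn_integral_shear') measurable
  also have "\<dots> = (\<integral>\<^sup>+u. \<integral>\<^sup>+v. A (u, v + s * u) \<partial>lborel \<partial>lborel)" by (simp add: B_def)
  also have "\<dots> = (\<integral>\<^sup>+u. \<integral>\<^sup>+v. A (u, v) \<partial>lborel \<partial>lborel)" by (rule nn_integral_shear) measurable
  also have "\<dots> = (\<integral>\<^sup>+u. \<integral>\<^sup>+v. f (u + (- t) * v, v) \<partial>lborel \<partial>lborel)" by (simp add: A_def)
  also have "\<dots> = (\<integral>\<^sup>+u. \<integral>\<^sup>+v. f (u, v) \<partial>lborel \<partial>lborel)" by (rule nn_integral_shear') measurable
  finally show ?thesis .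
qed

lemma std_gauss_rotation:
  fixes f :: "real \<times> real \<Rightarrow> ennreal" and c s :: real
  assumes [measurable]: "f \<in> borel_measurable (borel \<Otimes>\<^sub>M borel)" and cs: "c\<^sup>2 + s\<^sup>2 = 1" "s \<noteq> 0"
  shows "(\<integral>\<^sup>+u. \<integral>\<^sup>+v. f (c * u - s * v, s * u + c * v) \<partial>std_gauss \<partial>std_gauss) =
    (\<integral>\<^sup>+u. \<integral>\<^sup>+v. f (u, v) \<partial>std_gauss \<partial>std_gauss)"
proof -
  define h where "h = (\<lambda>(u, v). ennreal (std_normal_density u * std_normal_density v))"
  have [measurable]: "h \<in> borel_measurable (borel \<Otimes>\<^sub>M borel)" unfolding h_def by measurable
  have dens: "(\<integral>\<^sup>+u. \<integral>\<^sup>+v. F (u, v) \<partial>std_gauss \<partial>std_gauss) = (\<integral>\<^sup>+u. \<integral>\<^sup>+v. h (u, v) * F (u, v) \<partial>lborel \<partial>lborel)"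
    if [measurable]: "F \<in> borel_measurable (borel \<Otimes>\<^sub>M borel)" for F
    unfolding std_gauss_def h_def
    by (simp add: nn_integral_density ennreal_mult mult.assoc nn_integral_cmult)
  have "h (c * u - s * v, s * u + c * v) = h (u, v)" for u v
  proof -
    have "(c * u - s * v)\<^sup>2 + (s * u + c * v)\<^sup>2 = (c\<^sup>2 + s\<^sup>2) * (u\<^sup>2 + v\<^sup>2)"
      by (simp add: power2_eq_square algebra_simps)
    then have *: "(c * u - s * v)\<^sup>2 + (s * u + c * v)\<^sup>2 = u\<^sup>2 + v\<^sup>2" using cs by simp
    have dd: "std_normal_density x * std_normal_density y = 1 / (2 * pi) * exp (- (x\<^sup>2 + y\<^sup>2) / 2)" for x y
      unfolding std_normal_density_def
      by (simp add: exp_add[symmetric] field_simps)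
    show ?thesis unfolding h_def by (simp only: prod.case dd *)
  qed
  then have "(\<integral>\<^sup>+u. \<integral>\<^sup>+v. h (u, v) * f (c * u - s * v, s * u + c * v) \<partial>lborel \<partial>lborel) =
    (\<integral>\<^sup>+u. \<integral>\<^sup>+v. (\<lambda>p. h p * f p) (c * u - s * v, s * u + c * v) \<partial>lborel \<partial>lborel)" by simp
  also have "\<dots> = (\<integral>\<^sup>+u. \<integral>\<^sup>+v. h (u, v) * f (u, v) \<partial>lborel \<partial>lborel)"
    by (rule nn_integral_rotation[OF _ cs]) measurable
  finally show ?thesis
    using dens[of f] dens[of "\<lambda>(u, v). f (c * u - s * v, s * u + c * v)"] by simp
qed

text \<open>Simultaneous rotation in the coordinate planes \<open>(x, \<sigma> x)\<close>, \<open>x \<in> P\<close>, where \<open>\<sigma>\<close> is an involution.\<close>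

definition rot :: "'i set \<Rightarrow> 'i set \<Rightarrow> ('i \<Rightarrow> 'i) \<Rightarrow> real \<Rightarrow> real \<Rightarrow> ('i \<Rightarrow> real) \<Rightarrow> 'i \<Rightarrow> real" where
  "rot I P \<sigma> c s f = (\<lambda>x\<in>I. if x \<in> P then c * f x + s * f (\<sigma> x)
     else if \<sigma> x \<in> P then c * f x - s * f (\<sigma> x) else f x)"

lemma measurable_rot:
  assumes "P \<subseteq> I" "\<sigma> ` P \<subseteq> I" "\<And>x. \<sigma> (\<sigma> x) = x"
  shows "rot I P \<sigma> c s \<in> gauss I \<rightarrow>\<^sub>M gauss I"
proof -
  have "(\<lambda>f. if x \<in> P then c * f x + s * f (\<sigma> x)
     else if \<sigma> x \<in> P then c * f x - s * f (\<sigma> x) else f x) \<in> borel_measurable (gauss I)"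
    if "x \<in> I" for x
  proof (cases "x \<in> P \<or> \<sigma> x \<in> P")
    case True
    then have [measurable]: "\<sigma> x \<in> I" using assms by auto
    show ?thesis using that by measurable
  qed (use that in auto)
  then show ?thesis
    unfolding rot_def measurable_cong_sets[OF refl sets_gauss] by (intro measurable_restrict) auto
qed

lemma distr_gauss_rot_single:
  assumes I: "finite I" "a \<in> I" "\<sigma> a \<in> I" "a \<noteq> \<sigma> a" and \<sigma>: "\<And>x. \<sigma> (\<sigma> x) = x"
    and cs: "c\<^sup>2 + s\<^sup>2 = 1" "s \<noteq> 0"
  shows "distr (gauss I) (gauss I) (rot I {a} \<sigma> c s) = gauss I"
proof (rule measure_eqI)
  fix A assume "A \<in> sets (distr (gauss I) (gauss I) (rot I {a} \<sigma> c s))"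
  then have A [measurable]: "A \<in> sets (gauss I)" by simp
  define b where "b = \<sigma> a"
  define J where "J = I - {a, b}"
  have IJ: "I = insert a (insert b J)" "finite J" "b \<notin> J" "a \<notin> insert b J" "a \<noteq> b"
    using I by (auto simp: J_def b_def)
  have rotm: "rot I {a} \<sigma> c s \<in> gauss I \<rightarrow>\<^sub>M gauss I"
    by (rule measurable_rot) (use I \<sigma> in auto)
  \<comment> \<open>The two rotated coordinates become inner integrals, so that
    \<open>std_gauss_rotation\<close> applies with all others fixed.\<close>
  have two: "(\<integral>\<^sup>+g. F g \<partial>gauss I) = (\<integral>\<^sup>+g. \<integral>\<^sup>+u. \<integral>\<^sup>+v. F (g(b := u, a := v)) \<partial>std_gauss \<partial>std_gauss \<partial>gauss J)"
    if F [measurable]: "F \<in> borel_measurable (gauss I)" for F :: "('a \<Rightarrow> real) \<Rightarrow> ennreal"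
  proof -
    have "(\<integral>\<^sup>+g. F g \<partial>gauss I) = (\<integral>\<^sup>+g. \<integral>\<^sup>+v. F (g(a := v)) \<partial>std_gauss \<partial>gauss (insert b J))"
      unfolding gauss_def IJ(1)
      by (rule std_gauss_prod.product_nn_integral_insert) (use F IJ in \<open>auto simp: gauss_def\<close>)
    also have "\<dots> = (\<integral>\<^sup>+g. \<integral>\<^sup>+u. \<integral>\<^sup>+v. F (g(b := u, a := v)) \<partial>std_gauss \<partial>std_gauss \<partial>gauss J)"
      unfolding gauss_def
    proof (rule std_gauss_prod.product_nn_integral_insert[OF IJ(2,3)])
      have "(\<lambda>(g, v). g(a := v)) \<in> PiM (insert b J) (\<lambda>_. std_gauss) \<Otimes>\<^sub>M std_gauss \<rightarrow>\<^sub>M gauss I"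
        unfolding gauss_def IJ(1) by (rule measurable_add_dim)
      then have "(\<lambda>(g, v). F (g(a := v))) \<in> borel_measurable (PiM (insert b J) (\<lambda>_. std_gauss) \<Otimes>\<^sub>M std_gauss)"
        using measurable_compose[OF _ F] by (simp add: case_prod_unfold)
      then show "(\<lambda>g. \<integral>\<^sup>+v. F (g(a := v)) \<partial>std_gauss) \<in> borel_measurable (PiM (insert b J) (\<lambda>_. std_gauss))"
        by (rule std_gauss.borel_measurable_nn_integral)
    qed
    finally show ?thesis .
  qed
  have "emeasure (distr (gauss I) (gauss I) (rot I {a} \<sigma> c s)) A = (\<integral>\<^sup>+g. indicator A (rot I {a} \<sigma> c s g) \<partial>gauss I)"
    using nn_integral_distr[OF rotm, of "indicator A"] nn_integral_indicator[of A "distr (gauss I) (gauss I) (rot I {a} \<sigma> c s)"] A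
    by simp
  also have "\<dots> = (\<integral>\<^sup>+g. \<integral>\<^sup>+u. \<integral>\<^sup>+v. indicator A (rot I {a} \<sigma> c s (g(b := u, a := v))) \<partial>std_gauss \<partial>std_gauss \<partial>gauss J)"
    by (rule two) (use rotm in measurable)
  also have "\<dots> = (\<integral>\<^sup>+g. \<integral>\<^sup>+u. \<integral>\<^sup>+v. indicator A (g(b := u, a := v)) \<partial>std_gauss \<partial>std_gauss \<partial>gauss J)"
  proof (rule nn_integral_cong)
    fix g assume g: "g \<in> space (gauss J)"
    define f where "f = (\<lambda>(u, v). indicator A (g(b := u, a := v)) :: ennreal)"
    have "(\<lambda>p. g(b := fst p, a := snd p)) \<in> borel \<Otimes>\<^sub>M borel \<rightarrow>\<^sub>M gauss I"
    proof -
      have "(\<lambda>p. \<lambda>x\<in>I. if x = a then snd p else if x = b then fst p else g x) \<in> borel \<Otimes>\<^sub>M borel \<rightarrow>\<^sub>M gauss I"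
        unfolding measurable_cong_sets[OF refl sets_gauss] by (intro measurable_restrict) auto
      moreover have "(\<lambda>p. \<lambda>x\<in>I. if x = a then snd p else if x = b then fst p else g x) = (\<lambda>p. g(b := fst p, a := snd p))"
        using g IJ by (auto simp: fun_eq_iff restrict_def space_gauss PiE_def extensional_def)
      ultimately show ?thesis by simp
    qed
    then have f: "f \<in> borel_measurable (borel \<Otimes>\<^sub>M borel)"
      unfolding f_def case_prod_unfold by measurable
    have "rot I {a} \<sigma> c s (g(b := u, a := v)) = g(b := c * u - s * v, a := s * u + c * v)" for u v
      using g IJ \<sigma> unfolding b_def
      by (auto simp: rot_def fun_eq_iff restrict_def space_gauss PiE_def extensional_def)
    then have "(\<integral>\<^sup>+u. \<integral>\<^sup>+v. indicator A (rot I {a} \<sigma> c s (g(b := u, a := v))) \<partial>std_gauss \<partial>std_gauss)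
      = (\<integral>\<^sup>+u. \<integral>\<^sup>+v. f (c * u - s * v, s * u + c * v) \<partial>std_gauss \<partial>std_gauss)"
      by (simp add: f_def)
    also have "\<dots> = (\<integral>\<^sup>+u. \<integral>\<^sup>+v. f (u, v) \<partial>std_gauss \<partial>std_gauss)"
      by (rule std_gauss_rotation[OF f cs])
    finally show "(\<integral>\<^sup>+u. \<integral>\<^sup>+v. indicator A (rot I {a} \<sigma> c s (g(b := u, a := v))) \<partial>std_gauss \<partial>std_gauss)
      = (\<integral>\<^sup>+u. \<integral>\<^sup>+v. indicator A (g(b := u, a := v)) \<partial>std_gauss \<partial>std_gauss)"
      by (simp add: f_def)
  qed
  also have "\<dots> = (\<integral>\<^sup>+g. indicator A g \<partial>gauss I)" by (rule two[symmetric]) measurable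
  also have "\<dots> = emeasure (gauss I) A" by (rule nn_integral_indicator[OF A])
  finally show "emeasure (distr (gauss I) (gauss I) (rot I {a} \<sigma> c s)) A = emeasure (gauss I) A" .
qed simp

text \<open>The planes are spanned by pairwise disjoint pairs of coordinates, so the simultaneous
  rotation is a composition of single ones.\<close>

lemma distr_gauss_rot:
  assumes I: "finite I" "P \<subseteq> I" "\<sigma> ` P \<subseteq> I" "P \<inter> \<sigma> ` P = {}" and \<sigma>: "\<And>x. \<sigma> (\<sigma> x) = x"
    and cs: "c\<^sup>2 + s\<^sup>2 = 1" "s \<noteq> 0"
  shows "distr (gauss I) (gauss I) (rot I P \<sigma> c s) = gauss I"
proof -
  have "finite P" using I finite_subset by blast
  then show ?thesis using I(2-4)
  proof (induction P)
    case empty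
    have "distr (gauss I) (gauss I) (rot I {} \<sigma> c s) = distr (gauss I) (gauss I) (\<lambda>x. x)"
      by (rule distr_cong) (auto simp: rot_def space_gauss fun_eq_iff restrict_def PiE_def extensional_def)
    then show ?case by simp
  next
    case (insert a P)
    have IH: "distr (gauss I) (gauss I) (rot I P \<sigma> c s) = gauss I" using insert by auto
    have m1: "rot I P \<sigma> c s \<in> gauss I \<rightarrow>\<^sub>M gauss I" by (rule measurable_rot) (use insert \<sigma> in auto)
    have m2: "rot I {a} \<sigma> c s \<in> gauss I \<rightarrow>\<^sub>M gauss I" by (rule measurable_rot) (use insert \<sigma> in auto)
    have "rot I (insert a P) \<sigma> c s g = rot I {a} \<sigma> c s (rot I P \<sigma> c s g)" for g
    proof -
      have a: "a \<notin> P" "\<sigma> a \<notin> P" "a \<in> I" "\<sigma> a \<in> I" "\<sigma> a \<noteq> a"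
        using insert.hyps insert.prems \<sigma> by (auto simp: image_iff)
      show ?thesis
      proof
        fix x
        show "rot I (insert a P) \<sigma> c s g x = rot I {a} \<sigma> c s (rot I P \<sigma> c s g) x"
        proof (cases "x = a \<or> \<sigma> x = a")
          case True
          then have "x = a \<or> x = \<sigma> a" using \<sigma> by metis
          then show ?thesis using a \<sigma> by (auto simp: rot_def)
        next
          case False
          then show ?thesis by (auto simp: rot_def)
        qed
      qed
    qed
    then have eq: "rot I (insert a P) \<sigma> c s = (\<lambda>g. rot I {a} \<sigma> c s (rot I P \<sigma> c s g))"
      by (rule ext)
    have "distr (gauss I) (gauss I) (rot I (insert a P) \<sigma> c s) =
        distr (distr (gauss I) (gauss I) (rot I P \<sigma> c s)) (gauss I) (rot I {a} \<sigma> c s)"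
      unfolding eq by (subst distr_distr[OF m2 m1]) (simp add: comp_def)
    also have "\<dots> = gauss I"
      unfolding IH by (rule distr_gauss_rot_single[OF I(1) _ _ _ \<sigma> cs]) (use insert.prems insert.hyps \<sigma> in auto)
    finally show ?case .
  qed
qed


section \<open>Gaussian coordinates for the GOE and conjugation by plane rotations\<close>

definition upper :: "nat \<Rightarrow> (nat \<times> nat) set" where
  "upper n = {(i, j). i \<le> j \<and> j < n}"

text \<open>For standard Gaussian \<open>g\<close> this is the GOE with variance 1 off the diagonal
  and 2 on it, that is, the matrix of the theorem divided by \<surd>N. With this scale the corners
  of all sizes are corners of a single array \<open>g\<close>.\<close>

definition sym_coeff :: "(nat \<times> nat \<Rightarrow> real) \<Rightarrow> nat \<Rightarrow> nat \<Rightarrow> real" where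
  "sym_coeff g i j = (if i = j then sqrt 2 * g (i, i) else if i < j then g (i, j) else g (j, i))"

abbreviation goe_quad :: "nat \<Rightarrow> (nat \<times> nat \<Rightarrow> real) \<Rightarrow> (nat \<Rightarrow> real) \<Rightarrow> real" where
  "goe_quad n g \<equiv> quad n (sym_coeff g)"

definition plane_rot :: "nat \<Rightarrow> nat \<Rightarrow> real \<Rightarrow> real \<Rightarrow> (nat \<Rightarrow> real) \<Rightarrow> nat \<Rightarrow> real" where
  "plane_rot i j c s e = (\<lambda>k. if k = i then c * e i + s * e j else if k = j then c * e j - s * e i else e k)"

lemma finite_upper [simp]: "finite (upper n)"
  by (rule finite_subset[of _ "{..<n} \<times> {..<n}"]) (auto simp: upper_def)

lemma sym_coeff_commute: "sym_coeff g i j = sym_coeff g j i"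
  by (simp add: sym_coeff_def)

lemma measurable_sym_coeff [measurable]:
  "i < n \<Longrightarrow> j < n \<Longrightarrow> (\<lambda>g. sym_coeff g i j) \<in> borel_measurable (gauss (upper n))"
proof -
  assume "i < n" "j < n"
  then have "i \<le> j \<Longrightarrow> (i, j) \<in> upper n" "j \<le> i \<Longrightarrow> (j, i) \<in> upper n" by (auto simp: upper_def)
  then show ?thesis unfolding sym_coeff_def by (cases i j rule: linorder_cases) auto
qed

lemma measurable_goe_quad: "m \<le> n \<Longrightarrow> (\<lambda>g. goe_quad m g y) \<in> borel_measurable (gauss (upper n))"
  unfolding quad_def bil_def
  by (intro borel_measurable_sum borel_measurable_times borel_measurable_const measurable_sym_coeff) auto

lemma ip_plane_rot:
  assumes "i < n" "j < n" "i \<noteq> j"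
  shows "ip n (plane_rot i j c s x) y = ip n x (plane_rot i j c (- s) y)"
proof -
  have "ip n (plane_rot i j c s x) y - ip n x (plane_rot i j c (- s) y) =
    (\<Sum>k<n. plane_rot i j c s x k * y k - x k * plane_rot i j c (- s) y k)"
    by (simp add: ip_def sum_subtractf)
  also have "\<dots> = (\<Sum>k\<in>{i, j}. plane_rot i j c s x k * y k - x k * plane_rot i j c (- s) y k)"
    by (rule sum.mono_neutral_right) (use assms in \<open>auto simp: plane_rot_def\<close>)
  also have "\<dots> = 0" using assms by (simp add: plane_rot_def algebra_simps)
  finally show ?thesis by simp
qed

lemma plane_rot_inverse:
  assumes "i \<noteq> j" "c\<^sup>2 + s\<^sup>2 = 1"
  shows "plane_rot i j c s (plane_rot i j c (- s) y) = y"
proof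
  fix k
  have *: "c * (c * a) + s * (s * a) = a" for a
  proof -
    have "c * (c * a) + s * (s * a) = (c\<^sup>2 + s\<^sup>2) * a" by (simp add: power2_eq_square algebra_simps)
    then show ?thesis using assms by simp
  qed
  show "plane_rot i j c s (plane_rot i j c (- s) y) k = y k"
    using assms(1) *[of "y i"] *[of "y j"] by (auto simp: plane_rot_def algebra_simps)
qed

lemma bij_plane_rot:
  assumes "i \<noteq> j" "c\<^sup>2 + s\<^sup>2 = 1"
  shows "bij (plane_rot i j c s)"
  by (rule o_bij[where g = "plane_rot i j c (- s)"])
     (use plane_rot_inverse[of i j c s] plane_rot_inverse[of i j c "- s"] assms in \<open>auto simp: fun_eq_iff\<close>)

lemma ip_plane_rot_self:
  assumes "i < n" "j < n" "i \<noteq> j" "c\<^sup>2 + s\<^sup>2 = 1"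
  shows "ip n (plane_rot i j c s y) (plane_rot i j c s y) = ip n y y"
  using plane_rot_inverse[of i j c "- s" y] assms by (subst ip_plane_rot) auto

text \<open>
  Conjugation by a plane rotation acts on a full matrix of independent entries by row and column
  rotations, hence the detour through the symmetrization of such a matrix.
\<close>

definition symmetrize :: "nat \<Rightarrow> (nat \<times> nat \<Rightarrow> real) \<Rightarrow> nat \<times> nat \<Rightarrow> real" where
  "symmetrize n G = (\<lambda>(k, l)\<in>upper n. if k = l then G (k, k) else (G (k, l) + G (l, k)) / sqrt 2)"

lemma goe_quad_symmetrize:
  "goe_quad n (symmetrize n G) y = sqrt 2 * bil n (\<lambda>k l. G (k, l)) y y"
proof -
  have "goe_quad n (symmetrize n G) y = quad n (\<lambda>k l. 1 / sqrt 2 * (G (k, l) + G (l, k))) y"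
  proof (rule fun_cong[OF quad_cong_coeff])
    have "sqrt 2 * a = (a + a) / sqrt 2" for a :: real
      by (simp add: field_simps)
    then show "i < n \<Longrightarrow> j < n \<Longrightarrow> sym_coeff (symmetrize n G) i j = 1 / sqrt 2 * (G (i, j) + G (j, i))" for i j
      by (auto simp: sym_coeff_def symmetrize_def upper_def add.commute)
  qed
  also have "\<dots> = 1 / sqrt 2 * quad n (\<lambda>k l. G (k, l) + G (l, k)) y"
    by (rule quad_scale_coeff)
  also have "quad n (\<lambda>k l. G (k, l) + G (l, k)) y = bil n (\<lambda>k l. G (k, l)) y y + bil n (\<lambda>k l. G (l, k)) y y"
    by (simp add: quad_def bil_def algebra_simps sum.distrib)
  also have "bil n (\<lambda>k l. G (l, k)) y y = bil n (\<lambda>k l. G (k, l)) y y"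
    unfolding bil_def by (subst sum.swap) (simp add: mult_ac)
  also have "1 / sqrt 2 * (bil n (\<lambda>k l. G (k, l)) y y + bil n (\<lambda>k l. G (k, l)) y y) = sqrt 2 * bil n (\<lambda>k l. G (k, l)) y y"
    by (simp add: field_simps)
  finally show ?thesis .
qed

lemma measurable_symmetrize: "symmetrize n \<in> gauss ({..<n} \<times> {..<n}) \<rightarrow>\<^sub>M gauss (upper n)"
proof -
  have "(\<lambda>G. case p of (k, l) \<Rightarrow> if k = l then G (k, k) else (G (k, l) + G (l, k)) / sqrt 2)
      \<in> borel_measurable (gauss ({..<n} \<times> {..<n}))" if "p \<in> upper n" for p
  proof -
    obtain k l where p: "p = (k, l)" by (cases p)
    then have [measurable]: "(k, l) \<in> {..<n} \<times> {..<n}" "(l, k) \<in> {..<n} \<times> {..<n}" "(k, k) \<in> {..<n} \<times> {..<n}"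
      using that by (auto simp: upper_def)
    show ?thesis unfolding p by simp
  qed
  then show ?thesis
    unfolding symmetrize_def measurable_cong_sets[OF refl sets_gauss] by (intro measurable_restrict) auto
qed

text \<open>Rotating each pair of entries (k, l), (l, k) by 45 degrees puts the normalized sum into
  the upper slot; the lower slots are then forgotten.\<close>

lemma distr_symmetrize: "distr (gauss ({..<n} \<times> {..<n})) (gauss (upper n)) (symmetrize n) = gauss (upper n)"
proof -
  let ?I = "{..<n} \<times> {..<n}"
  define P where "P = {(k, l). k < l \<and> l < n}"
  let ?r = "rot ?I P prod.swap (1 / sqrt 2) (1 / sqrt 2)"
  have P: "P \<subseteq> ?I" "prod.swap ` P \<subseteq> ?I" "P \<inter> prod.swap ` P = {}" by (auto simp: P_def)
  have r: "distr (gauss ?I) (gauss ?I) ?r = gauss ?I"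
    by (rule distr_gauss_rot) (use P in \<open>auto simp: power_divide\<close>)
  have m: "?r \<in> gauss ?I \<rightarrow>\<^sub>M gauss ?I" by (rule measurable_rot) (use P in auto)
  have U: "upper n \<subseteq> ?I" by (auto simp: upper_def)
  have mr: "(\<lambda>g. restrict g (upper n)) \<in> gauss ?I \<rightarrow>\<^sub>M gauss (upper n)"
    unfolding gauss_def using U by (intro measurable_restrict_subset)
  have "symmetrize n = (\<lambda>G. restrict (?r G) (upper n))"
    by (auto simp: symmetrize_def rot_def upper_def P_def fun_eq_iff restrict_def add_divide_distrib)
  then have "distr (gauss ?I) (gauss (upper n)) (symmetrize n) =
      distr (distr (gauss ?I) (gauss ?I) ?r) (gauss (upper n)) (\<lambda>g. restrict g (upper n))"
    by (subst distr_distr[OF mr m]) (simp add: comp_def)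
  then show ?thesis using distr_gauss_restrict[OF U] by (simp add: r)
qed

definition row_rot :: "nat \<Rightarrow> nat \<Rightarrow> nat \<Rightarrow> real \<Rightarrow> real \<Rightarrow> (nat \<times> nat \<Rightarrow> real) \<Rightarrow> nat \<times> nat \<Rightarrow> real" where
  "row_rot n i j = rot ({..<n} \<times> {..<n}) ({i} \<times> {..<n}) (\<lambda>(k, l). (if k = i then j else if k = j then i else k, l))"

definition col_rot :: "nat \<Rightarrow> nat \<Rightarrow> nat \<Rightarrow> real \<Rightarrow> real \<Rightarrow> (nat \<times> nat \<Rightarrow> real) \<Rightarrow> nat \<times> nat \<Rightarrow> real" where
  "col_rot n i j = rot ({..<n} \<times> {..<n}) ({..<n} \<times> {i}) (\<lambda>(k, l). (k, if l = i then j else if l = j then i else l))"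

lemma row_rot_distr:
  assumes "i < n" "j < n" "i \<noteq> j"
  shows "row_rot n i j c s \<in> gauss ({..<n} \<times> {..<n}) \<rightarrow>\<^sub>M gauss ({..<n} \<times> {..<n})" (is ?m)
    and "c\<^sup>2 + s\<^sup>2 = 1 \<Longrightarrow> s \<noteq> 0 \<Longrightarrow>
      distr (gauss ({..<n} \<times> {..<n})) (gauss ({..<n} \<times> {..<n})) (row_rot n i j c s) = gauss ({..<n} \<times> {..<n})"
proof -
  show ?m unfolding row_rot_def by (rule measurable_rot) (use assms in auto)
  show "distr (gauss ({..<n} \<times> {..<n})) (gauss ({..<n} \<times> {..<n})) (row_rot n i j c s) = gauss ({..<n} \<times> {..<n})"
    if "c\<^sup>2 + s\<^sup>2 = 1" "s \<noteq> 0"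
    unfolding row_rot_def by (rule distr_gauss_rot) (use assms that in auto)
qed

lemma col_rot_distr:
  assumes "i < n" "j < n" "i \<noteq> j"
  shows "col_rot n i j c s \<in> gauss ({..<n} \<times> {..<n}) \<rightarrow>\<^sub>M gauss ({..<n} \<times> {..<n})" (is ?m)
    and "c\<^sup>2 + s\<^sup>2 = 1 \<Longrightarrow> s \<noteq> 0 \<Longrightarrow>
      distr (gauss ({..<n} \<times> {..<n})) (gauss ({..<n} \<times> {..<n})) (col_rot n i j c s) = gauss ({..<n} \<times> {..<n})"
proof -
  show ?m unfolding col_rot_def by (rule measurable_rot) (use assms in auto)
  show "distr (gauss ({..<n} \<times> {..<n})) (gauss ({..<n} \<times> {..<n})) (col_rot n i j c s) = gauss ({..<n} \<times> {..<n})"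
    if "c\<^sup>2 + s\<^sup>2 = 1" "s \<noteq> 0"
    unfolding col_rot_def by (rule distr_gauss_rot) (use assms that in auto)
qed

lemma bil_row_rot:
  assumes "i < n" "j < n" "i \<noteq> j"
  shows "bil n (\<lambda>k l. row_rot n i j c s G (k, l)) x y = bil n (\<lambda>k l. G (k, l)) (plane_rot i j c (- s) x) y"
proof -
  have "bil n (\<lambda>k l. row_rot n i j c s G (k, l)) x y = (\<Sum>l<n. y l * ip n (\<lambda>k. row_rot n i j c s G (k, l)) x)"
    unfolding bil_def ip_def by (subst sum.swap) (simp add: sum_distrib_left mult_ac)
  also have "\<dots> = (\<Sum>l<n. y l * ip n (plane_rot i j c s (\<lambda>k. G (k, l))) x)"
    by (intro sum.cong refl arg_cong2[where f="(*)"] ip_cong)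
       (use assms in \<open>auto simp: row_rot_def rot_def plane_rot_def\<close>)
  also have "\<dots> = (\<Sum>l<n. y l * ip n (\<lambda>k. G (k, l)) (plane_rot i j c (- s) x))"
    by (simp add: ip_plane_rot[OF assms])
  also have "\<dots> = bil n (\<lambda>k l. G (k, l)) (plane_rot i j c (- s) x) y"
    unfolding bil_def ip_def sum_distrib_left by (rule trans[OF sum.swap]) (simp add: mult_ac)
  finally show ?thesis .
qed

lemma bil_col_rot:
  assumes "i < n" "j < n" "i \<noteq> j"
  shows "bil n (\<lambda>k l. col_rot n i j c s G (k, l)) x y = bil n (\<lambda>k l. G (k, l)) x (plane_rot i j c (- s) y)"
proof -
  have "bil n (\<lambda>k l. col_rot n i j c s G (k, l)) x y = (\<Sum>k<n. x k * ip n (\<lambda>l. col_rot n i j c s G (k, l)) y)"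
    unfolding bil_def ip_def by (simp add: sum_distrib_left mult_ac)
  also have "\<dots> = (\<Sum>k<n. x k * ip n (plane_rot i j c s (\<lambda>l. G (k, l))) y)"
    by (intro sum.cong refl arg_cong2[where f="(*)"] ip_cong)
       (use assms in \<open>auto simp: col_rot_def rot_def plane_rot_def\<close>)
  also have "\<dots> = (\<Sum>k<n. x k * ip n (\<lambda>l. G (k, l)) (plane_rot i j c (- s) y))"
    by (simp add: ip_plane_rot[OF assms])
  also have "\<dots> = bil n (\<lambda>k l. G (k, l)) x (plane_rot i j c (- s) y)"
    unfolding bil_def ip_def by (simp add: sum_distrib_left mult_ac)
  finally show ?thesis .
qed

text \<open>\<open>e'\<close> plays the role of \<open>R\<^sup>T e\<close>.\<close>

definition orthogonal_invariant :: "nat \<Rightarrow> (((nat \<Rightarrow> real) \<Rightarrow> real) \<Rightarrow> (nat \<Rightarrow> real) \<Rightarrow> real) \<Rightarrow> bool" where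
  "orthogonal_invariant n \<Phi> \<longleftrightarrow> (\<forall>q e e' R. bij R \<longrightarrow> (\<forall>y. ip n (R y) (R y) = ip n y y) \<longrightarrow>
     (\<forall>y. ip n e' y = ip n e (R y)) \<longrightarrow> \<Phi> (\<lambda>y. q (R y)) e' = \<Phi> q e)"

context
  fixes n :: nat and \<Phi> :: "((nat \<Rightarrow> real) \<Rightarrow> real) \<Rightarrow> (nat \<Rightarrow> real) \<Rightarrow> real"
  assumes inv: "orthogonal_invariant n \<Phi>"
    and meas: "\<And>e. (\<lambda>g. \<Phi> (goe_quad n g) e) \<in> borel_measurable (gauss (upper n))"
begin

text \<open>Rotating rows and columns of the full matrix preserves its law and conjugates the
  symmetrized matrix. By invariance of \<open>\<Phi>\<close> the conjugation can be moved to the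
  vector argument.\<close>

lemma integral_plane_rot:
  assumes ij: "i < n" "j < n" "i \<noteq> j" and cs: "c\<^sup>2 + s\<^sup>2 = 1" "s \<noteq> 0"
  shows "(\<integral>g. \<Phi> (goe_quad n g) (plane_rot i j c s e) \<partial>gauss (upper n)) = (\<integral>g. \<Phi> (goe_quad n g) e \<partial>gauss (upper n))"
proof -
  let ?I = "{..<n} \<times> {..<n}"
  let ?T = "\<lambda>G. col_rot n i j c s (row_rot n i j c s G)"
  have mT: "?T \<in> gauss ?I \<rightarrow>\<^sub>M gauss ?I"
    using row_rot_distr(1)[OF ij] col_rot_distr(1)[OF ij] by (rule measurable_compose)
  have dT: "distr (gauss ?I) (gauss ?I) ?T = gauss ?I"
    using distr_distr[OF col_rot_distr(1)[OF ij, of c s] row_rot_distr(1)[OF ij, of c s]]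
    by (simp add: comp_def row_rot_distr(2)[OF ij cs] col_rot_distr(2)[OF ij cs])
  have full: "(\<integral>g. \<Phi> (goe_quad n g) f \<partial>gauss (upper n)) = (\<integral>G. \<Phi> (goe_quad n (symmetrize n G)) f \<partial>gauss ?I)" for f
    by (subst distr_symmetrize[symmetric], rule integral_distr[OF measurable_symmetrize]) (rule meas)
  have meas': "(\<lambda>G. \<Phi> (goe_quad n (symmetrize n G)) f) \<in> borel_measurable (gauss ?I)" for f
    using measurable_compose[OF measurable_symmetrize meas] .
  let ?R = "plane_rot i j c (- s)"
  have R: "goe_quad n (symmetrize n (?T G)) = (\<lambda>y. goe_quad n (symmetrize n G) (?R y))" for G
    by (simp add: fun_eq_iff goe_quad_symmetrize bil_col_rot[OF ij] bil_row_rot[OF ij])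
  have R': "\<Phi> (\<lambda>y. q (?R y)) (plane_rot i j c s e) = \<Phi> q e" for q
  proof -
    have "bij ?R" "\<forall>y. ip n (?R y) (?R y) = ip n y y" "\<forall>y. ip n (plane_rot i j c s e) y = ip n e (?R y)"
      using ij cs by (auto intro!: bij_plane_rot ip_plane_rot_self ip_plane_rot)
    then show ?thesis using inv unfolding orthogonal_invariant_def by blast
  qed
  have "(\<integral>g. \<Phi> (goe_quad n g) (plane_rot i j c s e) \<partial>gauss (upper n)) =
    (\<integral>G. \<Phi> (goe_quad n (symmetrize n G)) (plane_rot i j c s e) \<partial>distr (gauss ?I) (gauss ?I) ?T)"
    by (simp add: full dT)
  also have "\<dots> = (\<integral>G. \<Phi> (goe_quad n (symmetrize n (?T G))) (plane_rot i j c s e) \<partial>gauss ?I)"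
    by (rule integral_distr[OF mT meas'])
  also have "\<dots> = (\<integral>g. \<Phi> (goe_quad n g) e \<partial>gauss (upper n))"
    by (simp add: R R' full)
  finally show ?thesis .
qed

text \<open>Plane rotations suffice: each rotation in a plane (m, j) annihilates coordinate
  \<open>j\<close> of \<open>e\<close>, so induction on the number of nonzero coordinates other than
  \<open>m\<close> reaches plus or minus a unit vector.\<close>

theorem integral_orthogonal_invariant:
  assumes m: "m < n" and e: "ip n e e = 1"
  shows "(\<integral>g. \<Phi> (goe_quad n g) e \<partial>gauss (upper n)) =
    (\<integral>g. \<Phi> (goe_quad n g) (\<lambda>k. if k = m then 1 else 0) \<partial>gauss (upper n))"
  using e
proof (induction "card {k. k < n \<and> k \<noteq> m \<and> e k \<noteq> 0}" arbitrary: e rule: less_induct)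
  case less
  show ?case
  proof (cases "\<exists>j<n. j \<noteq> m \<and> e j \<noteq> 0")
    case True
    then obtain j where j: "j < n" "j \<noteq> m" "e j \<noteq> 0" by auto
    define r where "r = sqrt ((e m)\<^sup>2 + (e j)\<^sup>2)"
    define c where "c = e m / r"
    define s where "s = e j / r"
    have r: "r > 0" "r\<^sup>2 = (e m)\<^sup>2 + (e j)\<^sup>2" using j by (auto simp: r_def add_nonneg_pos)
    have cs: "c\<^sup>2 + s\<^sup>2 = 1" "s \<noteq> 0"
      using r j by (auto simp: c_def s_def power_divide add_divide_distrib[symmetric])
    define e' where "e' = plane_rot m j c s e"
    have "e' j = 0" using j by (simp add: e'_def plane_rot_def c_def s_def mult.commute)
    moreover have "e' k = e k" if "k \<noteq> m" "k \<noteq> j" for k using that by (simp add: e'_def plane_rot_def)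
    ultimately have "{k. k < n \<and> k \<noteq> m \<and> e' k \<noteq> 0} \<subseteq> {k. k < n \<and> k \<noteq> m \<and> e k \<noteq> 0} - {j}"
      by auto metis
    then have "{k. k < n \<and> k \<noteq> m \<and> e' k \<noteq> 0} \<subset> {k. k < n \<and> k \<noteq> m \<and> e k \<noteq> 0}"
      using j by blast
    then have "card {k. k < n \<and> k \<noteq> m \<and> e' k \<noteq> 0} < card {k. k < n \<and> k \<noteq> m \<and> e k \<noteq> 0}"
      by (intro psubset_card_mono) auto
    moreover have "ip n e' e' = 1"
      using ip_plane_rot_self[of m n j c s e] m j cs less.prems by (simp add: e'_def)
    ultimately have "(\<integral>g. \<Phi> (goe_quad n g) e' \<partial>gauss (upper n)) =
      (\<integral>g. \<Phi> (goe_quad n g) (\<lambda>k. if k = m then 1 else 0) \<partial>gauss (upper n))"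
      by (rule less.hyps)
    then show ?thesis
      using integral_plane_rot[of m j c s e] m j cs by (simp add: e'_def)
  next
    case False
    define d where "d = (\<lambda>k. if k = m then 1 else 0 :: real)"
    have ipd: "ip n e y = e m * y m" for y
      using False m sum.mono_neutral_right[of "{..<n}" "{m}" "\<lambda>k. e k * y k"] by (auto simp: ip_def)
    have ipd': "ip n d y = y m" for y
      using m sum.mono_neutral_right[of "{..<n}" "{m}" "\<lambda>k. d k * y k"] by (auto simp: ip_def d_def)
    have "e m * e m = 1" using less.prems ipd[of e] by simp
    then have em: "e m = 1 \<or> e m = - 1" by (simp add: square_eq_1_iff)
    \<comment> \<open>Only the sign of \<open>e m\<close> is left. The map \<open>R\<close>
      multiplies by that sign, which no quadratic form notices.\<close>
    define R where "R = (\<lambda>(y :: nat \<Rightarrow> real) (k :: nat). e m * y k)"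
    have "bij R" unfolding R_def
      by (rule o_bij[where g=R]) (use \<open>e m * e m = 1\<close> in \<open>auto simp: R_def fun_eq_iff mult.assoc[symmetric]\<close>)
    moreover have "ip n (R y) (R y) = ip n y y" for y
      using \<open>e m * e m = 1\<close> unfolding R_def ip_linear by (simp add: mult.assoc[symmetric])
    moreover have "ip n d y = ip n e (R y)" for y
      using \<open>e m * e m = 1\<close> unfolding ipd ipd' R_def by (simp add: mult.assoc[symmetric])
    ultimately have "\<Phi> (\<lambda>y. goe_quad n g (R y)) d = \<Phi> (goe_quad n g) e" for g
      using inv unfolding orthogonal_invariant_def by blast
    moreover have "goe_quad n g (R y) = goe_quad n g y" for g y
      using \<open>e m * e m = 1\<close> unfolding R_def quad_scale by (simp add: power2_eq_square)
    ultimately show ?thesis by (simp add: d_def)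
  qed
qed

end

section \<open>Measurability and concentration\<close>

declare measurable_gauss_component [measurable del]

text \<open>By continuity the condition is open in \<open>y\<close>, so the quantifier may be
  restricted to a countable dense set.\<close>

lemma sets_Collect_ex_greater:
  fixes F :: "'a \<Rightarrow> (nat \<Rightarrow> real) \<Rightarrow> real"
  assumes cont: "\<And>g. continuous_on UNIV (F g)" and meas: "\<And>y. (\<lambda>g. F g y) \<in> borel_measurable M"
  shows "{g \<in> space M. \<exists>y. c < F g y} \<in> sets M"
proof -
  obtain D :: "(nat \<Rightarrow> real) set" where D: "countable D" "\<And>X. open X \<Longrightarrow> X \<noteq> {} \<Longrightarrow> \<exists>d\<in>D. d \<in> X"
    using countable_dense_exists by metis
  have "(\<exists>y. c < F g y) \<longleftrightarrow> (\<exists>y\<in>D. c < F g y)" for g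
  proof
    assume "\<exists>y. c < F g y"
    moreover have "open {y. c < F g y}"
      using open_Collect_less[OF continuous_on_const cont] .
    ultimately show "\<exists>y\<in>D. c < F g y" using D(2)[of "{y. c < F g y}"] by blast
  qed auto
  then have "{g \<in> space M. \<exists>y. c < F g y} = (\<Union>y\<in>D. {g \<in> space M. c < F g y})" by auto
  also have "\<dots> \<in> sets M"
    by (rule sets.countable_UN''[OF D(1)]) (rule borel_measurable_less[OF borel_measurable_const meas])
  finally show ?thesis .
qed

lemma sets_Collect_all_le:
  fixes F :: "'a \<Rightarrow> (nat \<Rightarrow> real) \<Rightarrow> real"
  assumes "\<And>g. continuous_on UNIV (F g)" "\<And>y. (\<lambda>g. F g y) \<in> borel_measurable M"
  shows "{g \<in> space M. \<forall>y. F g y \<le> c} \<in> sets M"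
proof -
  have "{g \<in> space M. \<forall>y. F g y \<le> c} = space M - {g \<in> space M. \<exists>y. c < F g y}"
    by (auto simp: not_less) (meson not_less)
  then show ?thesis using sets_Collect_ex_greater[of F M c, OF assms] by auto
qed

lemma borel_measurable_quad:
  assumes "\<And>i j. i < n \<Longrightarrow> j < n \<Longrightarrow> (\<lambda>g. C g i j) \<in> borel_measurable M"
  shows "(\<lambda>g. quad n (C g) y) \<in> borel_measurable M"
  unfolding quad_def bil_def
  by (intro borel_measurable_sum borel_measurable_times borel_measurable_const) (simp add: assms)

lemma borel_measurable_rayleigh_max:
  assumes "n \<ge> 1" "\<And>i j. i < n \<Longrightarrow> j < n \<Longrightarrow> (\<lambda>g. C g i j) \<in> borel_measurable M"
  shows "(\<lambda>g. rayleigh_max n (quad n (C g))) \<in> borel_measurable M"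
proof (rule borel_measurable_iff_le[THEN iffD2], intro allI)
  fix a
  have "{g \<in> space M. rayleigh_max n (quad n (C g)) \<le> a} = {g \<in> space M. \<forall>y. quad n (C g) y - a * ip n y y \<le> 0}"
    using assms(1) by (simp add: rayleigh_max_le_iff)
  also have "\<dots> \<in> sets M"
  proof (rule sets_Collect_all_le)
    show "(\<lambda>g. quad n (C g) y - a * ip n y y) \<in> borel_measurable M" for y
      using borel_measurable_quad[of n C M y, OF assms(2)] by (intro borel_measurable_diff borel_measurable_const)
    show "continuous_on UNIV (\<lambda>y. quad n (C g) y - a * ip n y y)" for g
      by (intro continuous_on_diff continuous_on_mult_left continuous_on_quad continuous_on_ip_self)
  qed
  finally show "{g \<in> space M. rayleigh_max n (quad n (C g)) \<le> a} \<in> sets M" .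
qed

section \<open>Splitting off the last column\<close>

definition last_column :: "nat \<Rightarrow> (nat \<times> nat) set" where
  "last_column n = (\<lambda>i. (i, n)) ` {..n}"

definition glue :: "nat \<Rightarrow> (nat \<times> nat \<Rightarrow> real) \<Rightarrow> (nat \<times> nat \<Rightarrow> real) \<Rightarrow> nat \<times> nat \<Rightarrow> real" where
  "glue n c B = merge (last_column n) (upper n) (c, B)"

lemma finite_last_column [simp]: "finite (last_column n)"
  by (simp add: last_column_def)

lemma in_last_column [simp]: "(i, j) \<in> last_column n \<longleftrightarrow> j = n \<and> i \<le> n"
  by (auto simp: last_column_def)

lemma last_column_Int_upper: "last_column n \<inter> upper n = {}"
  by (auto simp: last_column_def upper_def)

lemma upper_Suc: "upper (Suc n) = last_column n \<union> upper n"
  by (auto simp: last_column_def upper_def)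

lemma sym_coeff_glue:
  "i < n \<Longrightarrow> j < n \<Longrightarrow> sym_coeff (glue n c B) i j = sym_coeff B i j"
  "i < n \<Longrightarrow> sym_coeff (glue n c B) i n = c (i, n)"
  "sym_coeff (glue n c B) n n = sqrt 2 * c (n, n)"
  by (auto simp: sym_coeff_def glue_def merge_def upper_def)

lemma goe_quad_glue: "goe_quad n (glue n c B) = goe_quad n B"
  by (rule quad_cong_coeff) (simp add: sym_coeff_glue)

lemma measurable_glue: "(\<lambda>(c, B). glue n c B) \<in> gauss (last_column n) \<Otimes>\<^sub>M gauss (upper n) \<rightarrow>\<^sub>M gauss (upper (Suc n))"
  using measurable_merge[of "last_column n" "upper n" "\<lambda>_. std_gauss"]
  by (simp add: glue_def case_prod_unfold gauss_def upper_Suc)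

lemma nn_integral_upper_Suc:
  assumes "f \<in> borel_measurable (gauss (upper (Suc n)))"
  shows "(\<integral>\<^sup>+g. f g \<partial>gauss (upper (Suc n))) = (\<integral>\<^sup>+c. \<integral>\<^sup>+B. f (glue n c B) \<partial>gauss (upper n) \<partial>gauss (last_column n))"
  using assms std_gauss_prod.product_nn_integral_fold[OF last_column_Int_upper finite_last_column finite_upper, of f n]
  unfolding gauss_def upper_Suc glue_def by simp

text \<open>Conditioning on the last column. For a fixed column its direction is a deterministic
  vector, so events of the corner in that direction can be treated by orthogonal invariance; columns
  outside \<open>G\<close> are charged with conditional probability 1.\<close>

lemma prob_upper_Suc_le:
  assumes A: "A \<in> sets (gauss (upper (Suc n)))" and G: "G \<in> sets (gauss (last_column n))" and \<beta>: "\<beta> \<ge> 0"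
    and le: "\<And>c. c \<in> G \<Longrightarrow> \<P>(B in gauss (upper n). glue n c B \<in> A) \<le> \<beta>"
  shows "measure (gauss (upper (Suc n))) A \<le> measure (gauss (last_column n)) (space (gauss (last_column n)) - G) + \<beta>"
proof -
  have [measurable]: "A \<in> sets (gauss (upper (Suc n)))" "G \<in> sets (gauss (last_column n))" by fact+
  have sec: "{B \<in> space (gauss (upper n)). glue n c B \<in> A} \<in> sets (gauss (upper n))"
    if "c \<in> space (gauss (last_column n))" for c
    using measurable_sets[OF measurable_compose[OF measurable_Pair1'[OF that] measurable_glue] A]
    by (simp add: vimage_def Int_def conj_commute)
  have "emeasure (gauss (upper (Suc n))) A = (\<integral>\<^sup>+c. \<integral>\<^sup>+B. indicator A (glue n c B) \<partial>gauss (upper n) \<partial>gauss (last_column n))"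
    using A nn_integral_upper_Suc[of "indicator A" n] by simp
  also have "\<dots> \<le> (\<integral>\<^sup>+c. indicator (space (gauss (last_column n)) - G) c + ennreal \<beta> \<partial>gauss (last_column n))"
  proof (rule nn_integral_mono)
    fix c assume c: "c \<in> space (gauss (last_column n))"
    have "(\<integral>\<^sup>+B. indicator A (glue n c B) \<partial>gauss (upper n)) =
      (\<integral>\<^sup>+B. indicator {B \<in> space (gauss (upper n)). glue n c B \<in> A} B \<partial>gauss (upper n))"
      by (rule nn_integral_cong) (auto simp: indicator_def)
    also have "\<dots> = emeasure (gauss (upper n)) {B \<in> space (gauss (upper n)). glue n c B \<in> A}"
      by (rule nn_integral_indicator[OF sec[OF c]])
    also have "\<dots> \<le> indicator (space (gauss (last_column n)) - G) c + ennreal \<beta>"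
    proof (cases "c \<in> G")
      case True
      then show ?thesis using le[OF True] by (simp add: gauss.emeasure_eq_measure ennreal_leI)
    next
      case False
      have "emeasure (gauss (upper n)) {B \<in> space (gauss (upper n)). glue n c B \<in> A} \<le> 1"
        by (rule gauss.emeasure_le_1)
      also have "1 \<le> indicator (space (gauss (last_column n)) - G) c + ennreal \<beta>"
        using False c by (simp add: add_increasing2)
      finally show ?thesis .
    qed
    finally show "(\<integral>\<^sup>+B. indicator A (glue n c B) \<partial>gauss (upper n)) \<le> indicator (space (gauss (last_column n)) - G) c + ennreal \<beta>" .
  qed
  also have "\<dots> = emeasure (gauss (last_column n)) (space (gauss (last_column n)) - G) + ennreal \<beta>"
    using G by (subst nn_integral_add) (auto simp: gauss.emeasure_space_1 intro!: nn_integral_indicator)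
  finally show ?thesis
    using \<beta> by (simp add: gauss.emeasure_eq_measure ennreal_plus[symmetric] del: ennreal_plus)
qed

section \<open>Chi-square concentration\<close>

lemma nn_integral_exp_square:
  assumes "t < 1 / 2"
  shows "(\<integral>\<^sup>+x. ennreal (exp (t * x\<^sup>2)) \<partial>std_gauss) = ennreal (1 / sqrt (1 - 2 * t))"
proof -
  define r where "r = sqrt (1 - 2 * t)"
  have r: "r > 0" "r\<^sup>2 = 1 - 2 * t" using assms by (auto simp: r_def)
  have eq: "std_normal_density x * exp (t * x\<^sup>2) = 1 / r * normal_density 0 (1 / r) x" for x
  proof -
    have "- x\<^sup>2 / 2 + t * x\<^sup>2 = - (r\<^sup>2 * x\<^sup>2) / 2" unfolding r(2) by (simp add: algebra_simps)
    moreover have "sqrt (2 * pi * (1 / r)\<^sup>2) = sqrt (2 * pi) / r"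
      using r(1) by (simp add: real_sqrt_mult power_divide real_sqrt_divide)
    ultimately show ?thesis
      using r(1) unfolding normal_density_def by (simp add: exp_add[symmetric] power_divide field_simps)
  qed
  have "(\<integral>\<^sup>+x. ennreal (exp (t * x\<^sup>2)) \<partial>std_gauss) = (\<integral>\<^sup>+x. ennreal (std_normal_density x) * ennreal (exp (t * x\<^sup>2)) \<partial>lborel)"
    unfolding std_gauss_def by (rule nn_integral_density) auto
  also have "\<dots> = (\<integral>\<^sup>+x. ennreal (1 / r) * ennreal (normal_density 0 (1 / r) x) \<partial>lborel)"
    using r(1) by (simp add: ennreal_mult[symmetric] eq)
  also have "\<dots> = ennreal (1 / r) * (\<integral>\<^sup>+x. ennreal (normal_density 0 (1 / r) x) \<partial>lborel)"
    by (rule nn_integral_cmult) simp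
  also have "(\<integral>\<^sup>+x. ennreal (normal_density 0 (1 / r) x) \<partial>lborel) = 1"
    using prob_space.emeasure_space_1[OF prob_space_normal_density[of "1 / r" 0]] r(1)
    by (simp add: emeasure_density)
  finally show ?thesis by (simp add: r_def)
qed

text \<open>The hypothesis puts x = -2t into the range \<bar>x\<bar> \<le> 1/2 of the quadratic
  error bound for ln (1 + x). Half of that error, 2 (2t)^2, is the 4 t^2 in the exponent.\<close>

lemma inverse_sqrt_le_exp:
  fixes t :: real
  assumes "\<bar>t\<bar> \<le> 1 / 4"
  shows "1 / sqrt (1 - 2 * t) \<le> exp (t + 4 * t\<^sup>2)"
proof -
  have "\<bar>ln (1 + (- 2 * t)) - (- 2 * t)\<bar> \<le> 2 * (- 2 * t)\<^sup>2"
    by (rule abs_ln_one_plus_x_minus_x_bound) (use assms in auto)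
  then have ln: "- ln (1 - 2 * t) \<le> 2 * t + 8 * t\<^sup>2" by (simp add: power2_eq_square abs_le_iff)
  have pos: "1 - 2 * t > 0" using assms by (auto simp: abs_le_iff)
  have "1 / sqrt (1 - 2 * t) = exp (- ln (1 - 2 * t) / 2)"
    using pos by (simp add: ln_sqrt[symmetric] exp_minus inverse_eq_divide)
  also have "\<dots> \<le> exp (t + 4 * t\<^sup>2)" using ln by simp
  finally show ?thesis .
qed

text \<open>Both tails at once: for negative \<open>t\<close> the event is that the sum of squares
  is at most \<open>a\<close>.\<close>

lemma gauss_chernoff:
  assumes J: "finite J" "J' \<subseteq> J" and t: "\<bar>t\<bar> \<le> 1 / 4"
  shows "measure (gauss J) {g \<in> space (gauss J). t * a \<le> t * (\<Sum>p\<in>J'. (g p)\<^sup>2)} \<le>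
    exp ((t + 4 * t\<^sup>2) * card J' - t * a)"
proof -
  have [measurable]: "(\<lambda>g. \<Sum>p\<in>J'. (g p)\<^sup>2) \<in> borel_measurable (gauss J)"
    using J by (intro borel_measurable_sum borel_measurable_power measurable_gauss_component) auto
  let ?u = "\<lambda>g. ennreal (exp (t * (\<Sum>p\<in>J'. (g p)\<^sup>2)))"
  have um: "(\<lambda>g. ?u g * indicator (space (gauss J)) g) \<in> borel_measurable (gauss J)" by measurable
  have "(\<integral>\<^sup>+g. ?u g \<partial>gauss J) = (\<integral>\<^sup>+g. (\<Prod>p\<in>J. if p \<in> J' then ennreal (exp (t * (g p)\<^sup>2)) else 1) \<partial>gauss J)"
  proof (rule nn_integral_cong)
    fix g
    have "?u g = (\<Prod>p\<in>J'. ennreal (exp (t * (g p)\<^sup>2)))"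
      using J finite_subset[of J' J] by (simp add: sum_distrib_left exp_sum prod_ennreal)
    also have "\<dots> = (\<Prod>p\<in>J. if p \<in> J' then ennreal (exp (t * (g p)\<^sup>2)) else 1)"
      using J by (simp add: prod.inter_restrict[symmetric] Int_absorb1)
    finally show "?u g = (\<Prod>p\<in>J. if p \<in> J' then ennreal (exp (t * (g p)\<^sup>2)) else 1)" .
  qed
  also have "\<dots> = (\<Prod>p\<in>J. \<integral>\<^sup>+x. (if p \<in> J' then ennreal (exp (t * x\<^sup>2)) else 1) \<partial>std_gauss)"
    unfolding gauss_def 
  proof (rule std_gauss_prod.product_nn_integral_prod[OF J(1)])
    have "(\<lambda>x. ennreal (exp (t * x\<^sup>2))) \<in> borel_measurable std_gauss"
      unfolding measurable_cong_sets[OF sets_std_gauss refl] by measurable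
    then show "(\<lambda>x. if p \<in> J' then ennreal (exp (t * x\<^sup>2)) else 1) \<in> borel_measurable std_gauss" for p by simp
  qed
  also have "\<dots> = (\<Prod>p\<in>J. if p \<in> J' then ennreal (1 / sqrt (1 - 2 * t)) else 1)"
    using t nn_integral_exp_square[of t] by (intro prod.cong refl) (auto simp: std_gauss.emeasure_space_1[unfolded space_std_gauss] abs_le_iff)
  also have "\<dots> = (\<Prod>p\<in>J'. ennreal (1 / sqrt (1 - 2 * t)))"
    using J by (simp add: prod.inter_restrict[symmetric] Int_absorb1)
  also have "\<dots> = ennreal ((1 / sqrt (1 - 2 * t)) ^ card J')"
    using t by (simp add: ennreal_power abs_le_iff)
  also have "\<dots> \<le> ennreal (exp (t + 4 * t\<^sup>2) ^ card J')"
    using inverse_sqrt_le_exp[OF t] t by (intro ennreal_leI power_mono) (auto simp: abs_le_iff)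
  also have "\<dots> = ennreal (exp ((t + 4 * t\<^sup>2) * card J'))"
    by (simp add: exp_of_nat2_mult)
  finally have int: "(\<integral>\<^sup>+g. ?u g \<partial>gauss J) \<le> ennreal (exp ((t + 4 * t\<^sup>2) * card J'))" .
  have "{g \<in> space (gauss J). t * a \<le> t * (\<Sum>p\<in>J'. (g p)\<^sup>2)} = {g \<in> space (gauss J). 1 \<le> ennreal (exp (- t * a)) * ?u g}"
    by (auto simp: ennreal_mult[symmetric] exp_add[symmetric] ennreal_ge_1)
  then have "emeasure (gauss J) {g \<in> space (gauss J). t * a \<le> t * (\<Sum>p\<in>J'. (g p)\<^sup>2)} \<le>
    ennreal (exp (- t * a)) * (\<integral>\<^sup>+g. ?u g * indicator (space (gauss J)) g \<partial>gauss J)"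
    using nn_integral_Markov_inequality[where M="gauss J" and u="?u" and A="space (gauss J)" and c="ennreal (exp (- t * a))"]
    by (simp only: um sets.top simp_thms)
  also have "\<dots> = ennreal (exp (- t * a)) * (\<integral>\<^sup>+g. ?u g \<partial>gauss J)"
    by (intro arg_cong2[where f="(*)"] nn_integral_cong refl) auto
  also have "\<dots> \<le> ennreal (exp (- t * a)) * ennreal (exp ((t + 4 * t\<^sup>2) * card J'))"
    by (intro mult_left_mono int) auto
  also have "\<dots> = ennreal (exp ((t + 4 * t\<^sup>2) * card J' - t * a))"
    by (simp add: ennreal_mult[symmetric] exp_add[symmetric])
  finally show ?thesis by (simp add: gauss.emeasure_eq_measure)
qed

definition col_norm2 :: "nat \<Rightarrow> (nat \<times> nat \<Rightarrow> real) \<Rightarrow> real" where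
  "col_norm2 n c = (\<Sum>i<n. (c (i, n))\<^sup>2)"

lemma col_norm2_eq: "col_norm2 n c = (\<Sum>p\<in>(\<lambda>i. (i, n)) ` {..<n}. (c p)\<^sup>2)"
  by (simp add: col_norm2_def sum.reindex inj_on_def)

lemma measurable_col_norm2 [measurable]: "col_norm2 n \<in> borel_measurable (gauss (last_column n))"
  unfolding col_norm2_def by (intro borel_measurable_sum borel_measurable_power measurable_gauss_component) auto

lemma prob_col_norm2_greater:
  fixes n N :: nat and \<kappa> :: real
  assumes \<kappa>: "0 < \<kappa>" "\<kappa> \<le> 1" and n: "n \<le> N"
  shows "\<P>(c in gauss (last_column n). col_norm2 n c > (1 + \<kappa>) * N) \<le> exp (- \<kappa>\<^sup>2 * N / 64)"
proof -
  \<comment> \<open>With parameter t > 0 the exponent is at most (4 t^2 - \<kappa> t) N, which is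
    minimal at t = \<kappa>/8.\<close>
  have "\<P>(c in gauss (last_column n). col_norm2 n c > (1 + \<kappa>) * N) \<le>
    \<P>(c in gauss (last_column n). \<kappa> / 8 * ((1 + \<kappa>) * N) \<le> \<kappa> / 8 * (\<Sum>p\<in>(\<lambda>i. (i, n)) ` {..<n}. (c p)\<^sup>2))"
  proof (rule gauss.finite_measure_mono)
    have *: "(\<lambda>c. \<Sum>p\<in>(\<lambda>i. (i, n)) ` {..<n}. (c p)\<^sup>2) \<in> borel_measurable (gauss (last_column n))"
      by (intro borel_measurable_sum borel_measurable_power measurable_gauss_component) auto
    show "{c \<in> space (gauss (last_column n)). \<kappa> / 8 * ((1 + \<kappa>) * N) \<le> \<kappa> / 8 * (\<Sum>p\<in>(\<lambda>i. (i, n)) ` {..<n}. (c p)\<^sup>2)} \<in> gauss.events (last_column n)"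
      by (rule borel_measurable_le[OF borel_measurable_const borel_measurable_times[OF borel_measurable_const *]])
  qed (use \<kappa> in \<open>auto simp: col_norm2_eq\<close>)
  also have "\<dots> \<le> exp ((\<kappa> / 8 + 4 * (\<kappa> / 8)\<^sup>2) * card ((\<lambda>i. (i, n)) ` {..<n}) - \<kappa> / 8 * ((1 + \<kappa>) * N))"
    by (rule gauss_chernoff) (use \<kappa> in auto)
  also have "card ((\<lambda>i. (i, n)) ` {..<n}) = n" by (simp add: card_image inj_on_def)
  also have "exp ((\<kappa> / 8 + 4 * (\<kappa> / 8)\<^sup>2) * n - \<kappa> / 8 * ((1 + \<kappa>) * N)) \<le> exp (- \<kappa>\<^sup>2 * N / 64)"
  proof -
    have "(\<kappa> / 8 + 4 * (\<kappa> / 8)\<^sup>2) * n \<le> (\<kappa> / 8 + 4 * (\<kappa> / 8)\<^sup>2) * N"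
      using \<kappa> n by (intro mult_left_mono) auto
    moreover have "\<kappa>\<^sup>2 * N \<ge> 0" by simp
    ultimately show ?thesis by (simp add: power2_eq_square algebra_simps)
  qed
  finally show ?thesis .
qed

lemma prob_col_norm2_less:
  fixes n N :: nat and \<kappa> :: real
  assumes \<kappa>: "0 < \<kappa>" "\<kappa> \<le> 1" and n: "n \<le> N" "(1 - \<kappa> / 2) * N \<le> n"
  shows "\<P>(c in gauss (last_column n). col_norm2 n c < (1 - \<kappa>) * N) \<le> exp (- \<kappa>\<^sup>2 * N / 64)"
proof -
  \<comment> \<open>As \<open>n\<close> may be as small as (1 - \<kappa>/2) N, only half of the
    margin \<kappa> remains. With t < 0 the exponent is at most (\<kappa> t / 2 + 4 t^2) N, minimal
    at t = -\<kappa>/16 with value -\<kappa>^2 N / 64. This is the weakest of the three rates and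
    the origin of the common constant 64.\<close>
  have "\<P>(c in gauss (last_column n). col_norm2 n c < (1 - \<kappa>) * N) \<le>
    \<P>(c in gauss (last_column n). (- \<kappa> / 16) * ((1 - \<kappa>) * N) \<le> (- \<kappa> / 16) * (\<Sum>p\<in>(\<lambda>i. (i, n)) ` {..<n}. (c p)\<^sup>2))"
  proof (rule gauss.finite_measure_mono)
    have *: "(\<lambda>c. \<Sum>p\<in>(\<lambda>i. (i, n)) ` {..<n}. (c p)\<^sup>2) \<in> borel_measurable (gauss (last_column n))"
      by (intro borel_measurable_sum borel_measurable_power measurable_gauss_component) auto
    show "{c \<in> space (gauss (last_column n)). (- \<kappa> / 16) * ((1 - \<kappa>) * N) \<le> (- \<kappa> / 16) * (\<Sum>p\<in>(\<lambda>i. (i, n)) ` {..<n}. (c p)\<^sup>2)} \<in> gauss.events (last_column n)"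
      by (rule borel_measurable_le[OF borel_measurable_const borel_measurable_times[OF borel_measurable_const *]])
  qed (use \<kappa> in \<open>auto simp: col_norm2_eq\<close>)
  also have "\<dots> \<le> exp ((- \<kappa> / 16 + 4 * (- \<kappa> / 16)\<^sup>2) * card ((\<lambda>i. (i, n)) ` {..<n}) - (- \<kappa> / 16) * ((1 - \<kappa>) * N))"
    by (rule gauss_chernoff) (use \<kappa> in auto)
  also have "card ((\<lambda>i. (i, n)) ` {..<n}) = n" by (simp add: card_image inj_on_def)
  also have "exp ((- \<kappa> / 16 + 4 * (- \<kappa> / 16)\<^sup>2) * n - (- \<kappa> / 16) * ((1 - \<kappa>) * N)) \<le> exp (- \<kappa>\<^sup>2 * N / 64)"
  proof -
    have "\<kappa> / 16 * ((1 - \<kappa> / 2) * N) \<le> \<kappa> / 16 * n" using \<kappa> n by (intro mult_left_mono) auto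
    moreover have "\<kappa>\<^sup>2 / 64 * n \<le> \<kappa>\<^sup>2 / 64 * N" using n by (intro mult_left_mono) auto
    ultimately show ?thesis by (simp add: power2_eq_square field_simps)
  qed
  finally show ?thesis .
qed

lemma prob_corner_greater:
  fixes n N :: nat and \<kappa> :: real
  assumes "0 < \<kappa>" "\<kappa> \<le> 1"
  shows "\<P>(c in gauss (last_column n). \<bar>sqrt 2 * c (n, n)\<bar> > \<kappa> * sqrt N) \<le> 2 * exp (- \<kappa>\<^sup>2 * real N / 64)"
proof -
  have [measurable]: "(n, n) \<in> last_column n" by simp
  have corner: "\<kappa>\<^sup>2 * N / 2 \<le> (c (n, n))\<^sup>2" if "\<bar>sqrt 2 * c (n, n)\<bar> > \<kappa> * sqrt N" for c :: "nat \<times> nat \<Rightarrow> real"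
  proof -
    have "(\<kappa> * sqrt N)\<^sup>2 \<le> \<bar>sqrt 2 * c (n, n)\<bar>\<^sup>2" using that assms by (intro power_mono) auto
    then show ?thesis by (simp add: power_mult_distrib)
  qed
  have "\<P>(c in gauss (last_column n). \<bar>sqrt 2 * c (n, n)\<bar> > \<kappa> * sqrt N) \<le>
    \<P>(c in gauss (last_column n). 1 / 4 * (\<kappa>\<^sup>2 * N / 2) \<le> 1 / 4 * (\<Sum>p\<in>{(n, n)}. (c p)\<^sup>2))"
  proof (intro gauss.finite_measure_mono subsetI)
    have "(\<lambda>c. \<Sum>p\<in>{(n, n)}. (c p)\<^sup>2) \<in> borel_measurable (gauss (last_column n))"
      by (intro borel_measurable_sum borel_measurable_power measurable_gauss_component) simp
    then show "{c \<in> space (gauss (last_column n)). 1 / 4 * (\<kappa>\<^sup>2 * N / 2) \<le> 1 / 4 * (\<Sum>p\<in>{(n, n)}. (c p)\<^sup>2)} \<in> gauss.events (last_column n)"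
      by (rule borel_measurable_le[OF borel_measurable_const borel_measurable_times[OF borel_measurable_const]])
  next
    fix c assume c: "c \<in> {c \<in> space (gauss (last_column n)). \<bar>sqrt 2 * c (n, n)\<bar> > \<kappa> * sqrt N}"
    then have "\<kappa>\<^sup>2 * N / 2 \<le> (c (n, n))\<^sup>2" by (intro corner) simp
    then show "c \<in> {c \<in> space (gauss (last_column n)). 1 / 4 * (\<kappa>\<^sup>2 * N / 2) \<le> 1 / 4 * (\<Sum>p\<in>{(n, n)}. (c p)\<^sup>2)}"
      using c by (simp add: mult.commute)
  qed
  also have "\<dots> \<le> exp ((1 / 4 + 4 * (1 / 4)\<^sup>2) * card {(n, n)} - 1 / 4 * (\<kappa>\<^sup>2 * N / 2))"
    by (rule gauss_chernoff) auto
  also have "\<dots> = exp (1 / 2) * exp (- \<kappa>\<^sup>2 * N / 8)"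
    by (simp add: power2_eq_square exp_add[symmetric] exp_diff[symmetric] algebra_simps)
  also have "\<dots> \<le> 2 * exp (- \<kappa>\<^sup>2 * N / 64)"
    using exp_half_le2 by (intro mult_mono) auto
  finally show ?thesis .
qed

section \<open>The top eigenvalue and the resolvent outside the spectrum\<close>

declare sets_gauss [simp del]

text \<open>
  For positive definite \<open>z s - q\<close>, \<open>norm_event\<close> says \<open>e\<^sup>T (z s - q)\<^sup>-\<^sup>1 e \<le> 1/s\<close> and \<open>resolvent_event\<close>
  says \<open>e\<^sup>T (z s - q)\<^sup>-\<^sup>1 e > r/s\<close>.
\<close>

definition norm_event :: "nat \<Rightarrow> real \<Rightarrow> real \<Rightarrow> ((nat \<Rightarrow> real) \<Rightarrow> real) \<Rightarrow> (nat \<Rightarrow> real) \<Rightarrow> bool" where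
  "norm_event n s z q e \<longleftrightarrow> (\<forall>y. s * (ip n e y)\<^sup>2 \<le> z * s * ip n y y - q y)"

definition resolvent_event :: "nat \<Rightarrow> real \<Rightarrow> real \<Rightarrow> real \<Rightarrow> ((nat \<Rightarrow> real) \<Rightarrow> real) \<Rightarrow> (nat \<Rightarrow> real) \<Rightarrow> bool" where
  "resolvent_event n s z r q e \<longleftrightarrow> (\<exists>y. r / s < 2 * ip n e y - (z * s * ip n y y - q y))"

lemma bij_all_iff: "bij R \<Longrightarrow> (\<forall>y. P (R y)) \<longleftrightarrow> (\<forall>y. P y)"
  by (metis bij_pointE)

lemma bij_ex_iff: "bij R \<Longrightarrow> (\<exists>y. P (R y)) \<longleftrightarrow> (\<exists>y. P y)"
  by (metis bij_pointE)

lemma norm_event_invariant: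
  assumes "bij R" "\<forall>y. ip n (R y) (R y) = ip n y y" "\<forall>y. ip n e' y = ip n e (R y)"
  shows "norm_event n s z (\<lambda>y. q (R y)) e' = norm_event n s z q e"
  using bij_all_iff[OF assms(1), of "\<lambda>y. s * (ip n e y)\<^sup>2 \<le> z * s * ip n y y - q y"] assms(2,3)
  by (simp add: norm_event_def)

lemma resolvent_event_invariant:
  assumes "bij R" "\<forall>y. ip n (R y) (R y) = ip n y y" "\<forall>y. ip n e' y = ip n e (R y)"
  shows "resolvent_event n s z r (\<lambda>y. q (R y)) e' = resolvent_event n s z r q e"
  using bij_ex_iff[OF assms(1), of "\<lambda>y. r / s < 2 * ip n e y - (z * s * ip n y y - q y)"] assms(2,3)
  by (simp add: resolvent_event_def)

lemma sets_norm_event: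
  assumes "n \<le> m"
  shows "{g \<in> space (gauss (upper m)). norm_event n s z (goe_quad n g) e} \<in> sets (gauss (upper m))"
proof -
  have "{g \<in> space (gauss (upper m)). \<forall>y. s * (ip n e y)\<^sup>2 - (z * s * ip n y y - goe_quad n g y) \<le> 0} \<in> sets (gauss (upper m))"
  proof (rule sets_Collect_all_le)
    show "continuous_on UNIV (\<lambda>y. s * (ip n e y)\<^sup>2 - (z * s * ip n y y - goe_quad n g y))" for g
      by (intro continuous_on_diff continuous_on_mult_left continuous_on_power continuous_on_quad continuous_on_ip_self continuous_on_ip)
    show "(\<lambda>g. s * (ip n e y)\<^sup>2 - (z * s * ip n y y - goe_quad n g y)) \<in> borel_measurable (gauss (upper m))" for y
      by (intro borel_measurable_diff borel_measurable_const measurable_goe_quad assms)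
  qed
  then show ?thesis by (simp add: norm_event_def)
qed

lemma sets_resolvent_event:
  assumes "n \<le> m"
  shows "{g \<in> space (gauss (upper m)). resolvent_event n s z r (goe_quad n g) e} \<in> sets (gauss (upper m))"
  unfolding resolvent_event_def
proof (rule sets_Collect_ex_greater)
  show "continuous_on UNIV (\<lambda>y. 2 * ip n e y - (z * s * ip n y y - goe_quad n g y))" for g
    by (intro continuous_on_diff continuous_on_mult_left continuous_on_quad continuous_on_ip_self continuous_on_ip)
  show "(\<lambda>g. 2 * ip n e y - (z * s * ip n y y - goe_quad n g y)) \<in> borel_measurable (gauss (upper m))" for y
    by (intro borel_measurable_diff borel_measurable_const measurable_goe_quad assms)
qed

lemma sets_Collect_not: "{x \<in> space M. P x} \<in> sets M \<Longrightarrow> {x \<in> space M. \<not> P x} \<in> sets M"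
  by (rule sets.sets_Collect_neg)

lemma prob_event_rotate:
  assumes inv: "\<And>q e e' R. bij R \<Longrightarrow> \<forall>y. ip n (R y) (R y) = ip n y y \<Longrightarrow> \<forall>y. ip n e' y = ip n e (R y) \<Longrightarrow>
      P (\<lambda>y. q (R y)) e' = P q e"
    and sets: "\<And>e. {g \<in> space (gauss (upper n)). P (goe_quad n g) e} \<in> sets (gauss (upper n))"
    and m: "m < n" and e: "ip n e e = 1"
  shows "\<P>(g in gauss (upper n). P (goe_quad n g) e) =
    \<P>(g in gauss (upper n). P (goe_quad n g) (\<lambda>k. if k = m then 1 else 0))"
proof -
  define \<Phi> where "\<Phi> = (\<lambda>q e. of_bool (P q e) :: real)"
  have ind: "\<Phi> (goe_quad n g) e = indicator {g \<in> space (gauss (upper n)). P (goe_quad n g) e} g"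
    if "g \<in> space (gauss (upper n))" for g e
    using that by (simp add: \<Phi>_def)
  have "(\<lambda>g. \<Phi> (goe_quad n g) e) \<in> borel_measurable (gauss (upper n))" for e
    using borel_measurable_indicator[OF sets[of e]] by (subst measurable_cong[OF ind])
  moreover have "orthogonal_invariant n \<Phi>"
    unfolding orthogonal_invariant_def \<Phi>_def
  proof (intro allI impI)
    fix q e e' and R :: "(nat \<Rightarrow> real) \<Rightarrow> nat \<Rightarrow> real"
    assume "bij R" "\<forall>y. ip n (R y) (R y) = ip n y y" "\<forall>y. ip n e' y = ip n e (R y)"
    then show "of_bool (P (\<lambda>y. q (R y)) e') = of_bool (P q e)" using inv[of R e' e q] by simp
  qed
  ultimately have "(\<integral>g. \<Phi> (goe_quad n g) e \<partial>gauss (upper n)) =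
      (\<integral>g. \<Phi> (goe_quad n g) (\<lambda>k. if k = m then 1 else 0) \<partial>gauss (upper n))"
    using integral_orthogonal_invariant[of n \<Phi> m e] m e by blast
  moreover have "(\<integral>g. \<Phi> (goe_quad n g) e \<partial>gauss (upper n)) =
    \<P>(g in gauss (upper n). P (goe_quad n g) e)" for e
  proof -
    have "(\<integral>g. \<Phi> (goe_quad n g) e \<partial>gauss (upper n)) =
      (\<integral>g. indicator {g \<in> space (gauss (upper n)). P (goe_quad n g) e} g \<partial>gauss (upper n))"
      by (rule Bochner_Integration.integral_cong[OF refl ind])
    moreover have "{g \<in> space (gauss (upper n)). P (goe_quad n g) e} \<inter> space (gauss (upper n)) = {g \<in> space (gauss (upper n)). P (goe_quad n g) e}"
      by auto
    ultimately show ?thesis by simp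
  qed
  ultimately show ?thesis by simp
qed

lemma prob_norm_event_rotate:
  assumes "m < n" "ip n e e = 1"
  shows "\<P>(g in gauss (upper n). \<not> norm_event n s z (goe_quad n g) e) =
    \<P>(g in gauss (upper n). \<not> norm_event n s z (goe_quad n g) (\<lambda>k. if k = m then 1 else 0))"
  by (rule prob_event_rotate[OF _ _ assms]) (auto simp: norm_event_invariant intro!: sets_Collect_not sets_norm_event)

lemma prob_resolvent_event_rotate:
  assumes "m < n" "ip n e e = 1"
  shows "\<P>(g in gauss (upper n). \<not> resolvent_event n s z r (goe_quad n g) e) =
    \<P>(g in gauss (upper n). \<not> resolvent_event n s z r (goe_quad n g) (\<lambda>k. if k = m then 1 else 0))"
  by (rule prob_event_rotate[OF _ _ assms]) (auto simp: resolvent_event_invariant intro!: sets_Collect_not sets_resolvent_event)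

text \<open>The Schur complement: the last diagonal entry of the new resolvent is the inverse of z s
  - a - \<beta>^2 e^T (z s - C)^(-1) e. The subtracted terms are at most \<kappa> s and (1 +
  \<kappa>) s, so z = 2 + 2\<kappa> is exactly what makes the bound 1/s reproduce itself. The proof
  completes a square instead of inverting.\<close>

lemma norm_event_step:
  fixes C :: "nat \<Rightarrow> nat \<Rightarrow> real"
  assumes s: "s > 0" and sym: "\<And>i. i < n \<Longrightarrow> C n i = C i n"
    and b: "\<And>i. i < n \<Longrightarrow> C i n = \<beta> * e i" and \<beta>: "\<beta>\<^sup>2 \<le> (1 + \<kappa>) * s\<^sup>2" and a: "C n n \<le> \<kappa> * s"
    and ev: "norm_event n s (2 + 2 * \<kappa>) (quad n C) e"
  shows "norm_event (Suc n) s (2 + 2 * \<kappa>) (quad (Suc n) C) (\<lambda>k. if k = n then 1 else 0)"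
  unfolding norm_event_def
proof
  fix y :: "nat \<Rightarrow> real"
  define t where "t = y n"
  define w where "w = ip n e y"
  have 1: "ip (Suc n) (\<lambda>k. if k = n then 1 else 0) y = t"
    by (simp add: ip_Suc t_def) (simp add: ip_def)
  have "ip n (\<lambda>i. C i n) y = ip n (\<lambda>i. \<beta> * e i) y" by (rule ip_cong) (auto simp: b)
  also have "\<dots> = \<beta> * w" by (simp add: ip_linear w_def)
  finally have 2: "quad (Suc n) C y = quad n C y + 2 * t * (\<beta> * w) + C n n * t\<^sup>2"
    using quad_Suc[where C=C and n=n and y=y] sym by (simp add: t_def)
  have 3: "s * w\<^sup>2 \<le> (2 + 2 * \<kappa>) * s * ip n y y - quad n C y"
    using ev by (simp add: norm_event_def w_def)
  have "\<beta>\<^sup>2 * t\<^sup>2 \<le> ((1 + \<kappa>) * s\<^sup>2) * t\<^sup>2" using \<beta> by (rule mult_right_mono) simp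
  then have "(\<beta> * t)\<^sup>2 / s \<le> ((1 + \<kappa>) * s\<^sup>2) * t\<^sup>2 / s" using s by (simp add: power_mult_distrib divide_right_mono)
  then have 4: "(\<beta> * t)\<^sup>2 / s \<le> (1 + \<kappa>) * s * t\<^sup>2" using s by (simp add: power2_eq_square)
  have "0 \<le> (s * w - \<beta> * t)\<^sup>2 / s" using s by simp
  also have "\<dots> = s * w\<^sup>2 - 2 * t * (\<beta> * w) + (\<beta> * t)\<^sup>2 / s"
    using s by (simp add: power2_eq_square field_simps)
  finally have 5: "2 * t * (\<beta> * w) \<le> s * w\<^sup>2 + (1 + \<kappa>) * s * t\<^sup>2" using 4 by simp
  have 6: "C n n * t\<^sup>2 \<le> \<kappa> * s * t\<^sup>2" using a by (rule mult_right_mono) simp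
  have 7: "ip (Suc n) y y = ip n y y + t\<^sup>2" by (simp add: ip_Suc t_def power2_eq_square)
  show "s * (ip (Suc n) (\<lambda>k. if k = n then 1 else 0) y)\<^sup>2 \<le> (2 + 2 * \<kappa>) * s * ip (Suc n) y y - quad (Suc n) C y"
    using 3 5 6 unfolding 1 2 7 by (simp add: algebra_simps)
qed

text \<open>The same Schur complement estimated in the other direction: its denominator is at most
  (z + \<kappa> - r (1 - \<kappa>)) s. The second claim stops before that inversion and bounds the
  form in the column itself, which is what the secular equation needs at the last size.\<close>

lemma resolvent_event_step:
  fixes C :: "nat \<Rightarrow> nat \<Rightarrow> real"
  assumes s: "s > 0" and sym: "\<And>i. i < n \<Longrightarrow> C n i = C i n"
    and b: "\<And>i. i < n \<Longrightarrow> C i n = \<beta> * e i" and \<beta>: "(1 - \<kappa>) * s\<^sup>2 \<le> \<beta>\<^sup>2" and a: "- (\<kappa> * s) \<le> C n n"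
    and \<kappa>: "0 \<le> \<kappa>" "\<kappa> < 1" and r: "0 \<le> r" "r \<le> 1" and z: "z \<ge> 2"
    and ev: "resolvent_event n s z r (quad n C) e"
  shows "resolvent_event (Suc n) s z (1 / (z + \<kappa> - r * (1 - \<kappa>))) (quad (Suc n) C) (\<lambda>k. if k = n then 1 else 0)"
    and "\<exists>y. r * (1 - \<kappa>) * s < 2 * ip n (\<lambda>i. C i n) y - (z * s * ip n y y - quad n C y)"
proof -
  obtain y where y: "r / s < 2 * ip n e y - (z * s * ip n y y - quad n C y)"
    using ev by (auto simp: resolvent_event_def)
  have \<beta>0: "\<beta>\<^sup>2 > 0" using \<beta> s \<kappa> by (smt (verit) mult_pos_pos zero_less_power)
  define w where "w = (\<lambda>i. \<beta> * y i)"
  have bw: "ip n (\<lambda>i. C i n) w = \<beta>\<^sup>2 * ip n e y"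
  proof -
    have "ip n (\<lambda>i. C i n) w = ip n (\<lambda>i. \<beta> * e i) w" by (rule ip_cong) (auto simp: b)
    also have "\<dots> = \<beta>\<^sup>2 * ip n e y" by (simp add: w_def ip_linear power2_eq_square)
    finally show ?thesis .
  qed
  have "\<beta>\<^sup>2 * (r / s) < \<beta>\<^sup>2 * (2 * ip n e y - (z * s * ip n y y - quad n C y))"
    using y \<beta>0 by (rule mult_strict_left_mono)
  also have "\<dots> = 2 * ip n (\<lambda>i. C i n) w - (z * s * ip n w w - quad n C w)"
  proof -
    have "ip n w w = \<beta>\<^sup>2 * ip n y y" by (simp add: w_def ip_linear power2_eq_square)
    moreover have "quad n C w = \<beta>\<^sup>2 * quad n C y" by (simp add: w_def quad_scale)
    ultimately show ?thesis by (simp add: bw algebra_simps)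
  qed
  finally have w: "\<beta>\<^sup>2 * (r / s) < 2 * ip n (\<lambda>i. C i n) w - (z * s * ip n w w - quad n C w)" .
  have "((1 - \<kappa>) * s\<^sup>2) * (r / s) \<le> \<beta>\<^sup>2 * (r / s)" using \<beta> r s by (intro mult_right_mono) auto
  then have br: "r * (1 - \<kappa>) * s \<le> \<beta>\<^sup>2 * (r / s)" using s by (simp add: power2_eq_square mult_ac)
  show "\<exists>y. r * (1 - \<kappa>) * s < 2 * ip n (\<lambda>i. C i n) y - (z * s * ip n y y - quad n C y)"
    using w br by (intro exI[of _ w]) simp
  define D where "D = z + \<kappa> - r * (1 - \<kappa>)"
  have "r * (1 - \<kappa>) \<le> 1" using r \<kappa> by (intro mult_le_one) auto
  then have D: "D > 0" using z \<kappa> by (simp add: D_def)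
  \<comment> \<open>The maximizer of 2 t - t^2 s D. The vector \<open>v\<close>, which is t (w, 1),
    imitates the last column of the resolvent.\<close>
  define t where "t = 1 / (s * D)"
  have t: "t > 0" "s * D * t = 1" using s D by (auto simp: t_def)
  define v where "v = (\<lambda>i. if i = n then t else t * w i)"
  have v: "ip n v v = t\<^sup>2 * ip n w w" "quad n C v = t\<^sup>2 * quad n C w" "ip n (\<lambda>i. C i n) v = t * ip n (\<lambda>i. C i n) w"
  proof -
    have "ip n v v = ip n (\<lambda>i. t * w i) (\<lambda>i. t * w i)" by (rule ip_cong) (auto simp: v_def)
    then show "ip n v v = t\<^sup>2 * ip n w w" by (simp add: ip_linear power2_eq_square)
    have "quad n C v = quad n C (\<lambda>i. t * w i)" by (rule quad_cong) (auto simp: v_def)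
    then show "quad n C v = t\<^sup>2 * quad n C w" by (simp add: quad_scale)
    have "ip n (\<lambda>i. C i n) v = ip n (\<lambda>i. C i n) (\<lambda>i. t * w i)" by (rule ip_cong) (auto simp: v_def)
    then show "ip n (\<lambda>i. C i n) v = t * ip n (\<lambda>i. C i n) w" by (simp add: ip_linear)
  qed
  have vn: "v n = t" by (simp add: v_def)
  have 1: "ip (Suc n) (\<lambda>k. if k = n then 1 else 0) v = t"
    by (simp add: ip_Suc vn) (simp add: ip_def)
  have 2: "2 * ip (Suc n) (\<lambda>k. if k = n then 1 else 0) v - (z * s * ip (Suc n) v v - quad (Suc n) C v)
    = 2 * t - t\<^sup>2 * (z * s - C n n - (2 * ip n (\<lambda>i. C i n) w - (z * s * ip n w w - quad n C w)))"
    using quad_Suc[where C=C and n=n and y=v] sym unfolding 1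
    by (simp add: ip_Suc vn v power2_eq_square algebra_simps)
  have "t\<^sup>2 * (z * s - C n n - (2 * ip n (\<lambda>i. C i n) w - (z * s * ip n w w - quad n C w))) < t\<^sup>2 * (s * D)"
  proof (rule mult_strict_left_mono)
    show "z * s - C n n - (2 * ip n (\<lambda>i. C i n) w - (z * s * ip n w w - quad n C w)) < s * D"
      using w br a by (simp add: D_def algebra_simps)
  qed (use t in auto)
  also have "t\<^sup>2 * (s * D) = t" using t(2) by (simp add: power2_eq_square mult_ac)
  finally have "t < 2 * ip (Suc n) (\<lambda>k. if k = n then 1 else 0) v - (z * s * ip (Suc n) v v - quad (Suc n) C v)"
    unfolding 2 by simp
  then show "resolvent_event (Suc n) s z (1 / (z + \<kappa> - r * (1 - \<kappa>))) (quad (Suc n) C) (\<lambda>k. if k = n then 1 else 0)"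
    unfolding resolvent_event_def by (intro exI[of _ v]) (simp add: t_def D_def mult.commute)
qed

text \<open>Along a short multiple of \<open>e\<close> the linear term dominates. The lower
  recursion can thus start at any size without information on the corner.\<close>

lemma resolvent_event_zero:
  assumes "ip n e e = 1" "s > 0"
  shows "resolvent_event n s z 0 (quad n C) e"
proof -
  define k where "k = z * s - quad n C e"
  define t where "t = 1 / (\<bar>k\<bar> + 1)"
  have t: "t > 0" "t * \<bar>k\<bar> \<le> 1" by (auto simp: t_def field_simps)
  have "t * (t * k) \<le> t * 1" using t by (intro mult_left_mono) (auto simp: abs_le_iff intro: order_trans[OF mult_left_mono[OF abs_ge_self]])
  then have "0 < 2 * t - t * (t * k)" using t by simp
  also have "\<dots> = 2 * ip n e (\<lambda>i. t * e i) - (z * s * ip n (\<lambda>i. t * e i) (\<lambda>i. t * e i) - quad n C (\<lambda>i. t * e i))"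
    unfolding ip_linear quad_scale k_def using assms by (simp add: algebra_simps power2_eq_square)
  finally show ?thesis unfolding resolvent_event_def by auto
qed

lemma ip_unit: "ip n (\<lambda>k. if k = m then 1 else 0) y = (if m < n then y m else 0)"
proof -
  have "ip n (\<lambda>k. if k = m then 1 else 0) y = (\<Sum>k<n. if k = m then y k else 0)"
    unfolding ip_def by (rule sum.cong) auto
  then show ?thesis by simp
qed

lemma polar:
  assumes "n \<ge> 1"
  obtains e \<beta> where "ip n e e = 1" "\<And>i. i < n \<Longrightarrow> c i = \<beta> * e i" "\<beta>\<^sup>2 = ip n c c"
proof (cases "ip n c c = 0")
  case True
  have "ip n (\<lambda>k. if k = 0 then 1 else 0) (\<lambda>k. if k = 0 then 1 else 0) = 1"
    using assms by (simp add: ip_unit)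
  then show ?thesis using True by (intro that[of _ 0]) (auto simp: ip_self_eq_0_iff)
next
  case False
  then have pos: "ip n c c > 0" using ip_nonneg[of n c] by linarith
  show ?thesis
  proof (rule that[OF ip_normalized[OF False]])
    show "c i = sqrt (ip n c c) * (1 / sqrt (ip n c c) * c i)" for i using pos by simp
    show "(sqrt (ip n c c))\<^sup>2 = ip n c c" using pos by simp
  qed
qed

lemma col_norm2_eq_ip: "col_norm2 n c = ip n (\<lambda>i. c (i, n)) (\<lambda>i. c (i, n))"
  by (simp add: col_norm2_def ip_def power2_eq_square)

text \<open>The lower bound on the norm is requested only for sizes close to \<open>N\<close>, as
  columns of small corners are too short. The recursion for \<open>norm_event\<close> passes through
  all sizes but uses only the upper bounds.\<close>

definition good_column :: "nat \<Rightarrow> real \<Rightarrow> nat \<Rightarrow> (nat \<times> nat \<Rightarrow> real) set" where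
  "good_column N \<kappa> n = {c \<in> space (gauss (last_column n)).
     col_norm2 n c \<le> (1 + \<kappa>) * N \<and> \<bar>sqrt 2 * c (n, n)\<bar> \<le> \<kappa> * sqrt N \<and>
     ((1 - \<kappa> / 2) * N \<le> n \<longrightarrow> (1 - \<kappa>) * N \<le> col_norm2 n c)}"

lemma sets_good_column: "good_column N \<kappa> n \<in> sets (gauss (last_column n))"
proof -
  have [measurable]: "(\<lambda>c. c (n, n)) \<in> borel_measurable (gauss (last_column n))"
    by (rule measurable_gauss_component) simp
  show ?thesis unfolding good_column_def by measurable
qed

lemma prob_good_column:
  assumes \<kappa>: "0 < \<kappa>" "\<kappa> \<le> 1" and n: "n \<le> N"
  shows "measure (gauss (last_column n)) (space (gauss (last_column n)) - good_column N \<kappa> n) \<le> 4 * exp (- \<kappa>\<^sup>2 * N / 64)"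
proof -
  let ?M = "gauss (last_column n)"
  let ?A = "{c \<in> space ?M. col_norm2 n c > (1 + \<kappa>) * N}"
  let ?B = "{c \<in> space ?M. \<bar>sqrt 2 * c (n, n)\<bar> > \<kappa> * sqrt N}"
  let ?C = "if (1 - \<kappa> / 2) * N \<le> n then {c \<in> space ?M. col_norm2 n c < (1 - \<kappa>) * N} else {}"
  have m: "(\<lambda>c. c (n, n)) \<in> borel_measurable ?M" by (rule measurable_gauss_component) simp
  have A: "?A \<in> sets ?M"
    by (rule borel_measurable_less[OF borel_measurable_const measurable_col_norm2])
  have B: "?B \<in> sets ?M"
    by (rule borel_measurable_less[OF borel_measurable_const borel_measurable_abs[OF borel_measurable_times[OF borel_measurable_const m]]])
  have C: "?C \<in> sets ?M"
    by (split if_split, intro conjI impI, rule borel_measurable_less[OF measurable_col_norm2 borel_measurable_const], rule sets.empty_sets)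
  have "measure ?M (space ?M - good_column N \<kappa> n) \<le> measure ?M (?A \<union> ?B \<union> ?C)"
    using A B C by (intro gauss.finite_measure_mono sets.Un) (auto simp: good_column_def)
  also have "\<dots> \<le> measure ?M ?A + measure ?M ?B + measure ?M ?C"
    using measure_Un_le[of "?A \<union> ?B" ?M ?C] measure_Un_le[of ?A ?M ?B] A B C by auto
  also have "\<dots> \<le> exp (- \<kappa>\<^sup>2 * N / 64) + 2 * exp (- \<kappa>\<^sup>2 * N / 64) + exp (- \<kappa>\<^sup>2 * N / 64)"
    by (intro add_mono prob_col_norm2_greater prob_corner_greater) (use assms prob_col_norm2_less in auto)
  finally show ?thesis by simp
qed

lemma glue_decomposition:
  assumes "n \<ge> 1"
  obtains e \<beta> where "ip n e e = 1" "\<And>B i. i < n \<Longrightarrow> sym_coeff (glue n c B) i n = \<beta> * e i" "\<beta>\<^sup>2 = col_norm2 n c"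
proof -
  obtain e \<beta> where "ip n e e = 1" "\<And>i. i < n \<Longrightarrow> c (i, n) = \<beta> * e i" "\<beta>\<^sup>2 = ip n (\<lambda>i. c (i, n)) (\<lambda>i. c (i, n))"
    using polar[OF assms, of "\<lambda>i. c (i, n)"] by metis
  then show ?thesis by (intro that[of e \<beta>]) (auto simp: sym_coeff_glue col_norm2_eq_ip)
qed

text \<open>Induction on the size at the fixed scale \<surd>N. The direction of a new column is
  independent of the corner, so the induction hypothesis, stated for every unit vector, applies to
  it; \<open>norm_event_step\<close> yields the event for the last coordinate vector, and invariance
  transfers it to every \<open>e\<close>. Each size adds the failure probability of one
  column.\<close>

lemma prob_norm_event:
  fixes n N :: nat and \<kappa> :: real
  assumes \<kappa>: "0 < \<kappa>" "\<kappa> \<le> 1" and N: "N \<ge> 1" and n: "n \<le> N" and e: "ip (Suc n) e e = 1"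
  shows "\<P>(g in gauss (upper (Suc n)).
      \<not> norm_event (Suc n) (sqrt N) (2 + 2 * \<kappa>) (goe_quad (Suc n) g) e) \<le> Suc n * (4 * exp (- \<kappa>\<^sup>2 * N / 64))"
  using n e
proof (induction n arbitrary: e)
  case (0 e)
  let ?bad = "{g \<in> space (gauss (upper (Suc 0))). \<not> norm_event (Suc 0) (sqrt N) (2 + 2 * \<kappa>) (goe_quad (Suc 0) g) (\<lambda>k. if k = 0 then 1 else 0)}"
  have "measure (gauss (upper (Suc 0))) ?bad \<le>
    measure (gauss (last_column 0)) (space (gauss (last_column 0)) - good_column N \<kappa> 0) + 0"
  proof (rule prob_upper_Suc_le)
    fix c assume "c \<in> good_column N \<kappa> 0"
    then have "norm_event (Suc 0) (sqrt N) (2 + 2 * \<kappa>) (goe_quad (Suc 0) (glue 0 c B)) (\<lambda>k. if k = 0 then 1 else 0)" for B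
      using N \<kappa> by (intro norm_event_step[where \<beta> = 0])
        (auto simp: good_column_def sym_coeff_glue norm_event_def ip_def quad_def bil_def abs_le_iff)
    then show "\<P>(B in gauss (upper 0). glue 0 c B \<in> ?bad) \<le> 0"
      by simp
  qed (auto intro!: sets_Collect_not sets_norm_event sets_good_column)
  also have "\<dots> \<le> 4 * exp (- \<kappa>\<^sup>2 * N / 64)"
    using prob_good_column[OF \<kappa>, of 0 N] by simp
  finally show ?case using prob_norm_event_rotate[of 0 "Suc 0" e] 0 by simp
next
  case (Suc n e)
  define m where "m = Suc n"
  define p where "p = 4 * exp (- \<kappa>\<^sup>2 * N / 64)"
  let ?bad = "{g \<in> space (gauss (upper (Suc m))). \<not> norm_event (Suc m) (sqrt N) (2 + 2 * \<kappa>) (goe_quad (Suc m) g) (\<lambda>k. if k = m then 1 else 0)}"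
  have "measure (gauss (upper (Suc m))) ?bad \<le>
    measure (gauss (last_column m)) (space (gauss (last_column m)) - good_column N \<kappa> m) + m * p"
  proof (rule prob_upper_Suc_le)
    fix c assume c: "c \<in> good_column N \<kappa> m"
    obtain e' \<beta> where e': "ip m e' e' = 1" and b: "\<And>B i. i < m \<Longrightarrow> sym_coeff (glue m c B) i m = \<beta> * e' i" and \<beta>: "\<beta>\<^sup>2 = col_norm2 m c"
      using glue_decomposition[of m c] unfolding m_def by auto
    have step: "norm_event (Suc m) (sqrt N) (2 + 2 * \<kappa>) (goe_quad (Suc m) (glue m c B)) (\<lambda>k. if k = m then 1 else 0)"
      if "norm_event m (sqrt N) (2 + 2 * \<kappa>) (goe_quad m B) e'" for B
    proof (rule norm_event_step[where \<beta> = \<beta> and e = e'])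
      show "\<beta>\<^sup>2 \<le> (1 + \<kappa>) * (sqrt N)\<^sup>2" using c by (simp add: \<beta> good_column_def)
      show "sym_coeff (glue m c B) m m \<le> \<kappa> * sqrt N" using c by (simp add: sym_coeff_glue good_column_def abs_le_iff)
      show "norm_event m (sqrt N) (2 + 2 * \<kappa>) (goe_quad m (glue m c B)) e'" using that by (simp add: goe_quad_glue)
    qed (use N b in \<open>auto simp: sym_coeff_commute\<close>)
    have "\<P>(B in gauss (upper m). glue m c B \<in> ?bad) \<le>
        \<P>(B in gauss (upper m). \<not> norm_event m (sqrt N) (2 + 2 * \<kappa>) (goe_quad m B) e')"
      by (rule gauss.finite_measure_mono) (use step in \<open>auto intro!: sets_Collect_not sets_norm_event\<close>)
    also have "\<dots> \<le> m * p" using Suc.IH[of e'] Suc.prems e' by (simp add: m_def p_def)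
    finally show "\<P>(B in gauss (upper m). glue m c B \<in> ?bad) \<le> m * p" .
  qed (auto simp: p_def intro!: sets_Collect_not sets_norm_event sets_good_column)
  also have "\<dots> \<le> p + m * p"
    using prob_good_column[OF \<kappa>, of m N] Suc.prems by (simp add: m_def p_def)
  finally show ?case
    using prob_norm_event_rotate[of m "Suc m" e] Suc.prems by (simp add: m_def p_def algebra_simps)
qed

text \<open>The map r \<mapsto> 1 / (z - r) at z = 2 + 4\<kappa>, perturbed by the relative errors
  \<kappa> of the corner entry and of the squared column norm. For \<kappa> = 0 the values are j /
  (j + 1).\<close>

primrec res_seq :: "real \<Rightarrow> nat \<Rightarrow> real" where
  "res_seq \<kappa> 0 = 0"
| "res_seq \<kappa> (Suc j) = 1 / (2 + 4 * \<kappa> + \<kappa> - res_seq \<kappa> j * (1 - \<kappa>))"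

lemma res_seq_bounds: "0 < \<kappa> \<Longrightarrow> \<kappa> < 1 \<Longrightarrow> 0 \<le> res_seq \<kappa> j \<and> res_seq \<kappa> j \<le> 1"
proof (induction j)
  case (Suc j)
  then have "res_seq \<kappa> j * (1 - \<kappa>) \<le> 1" by (intro mult_le_one) auto
  then have "2 + 4 * \<kappa> + \<kappa> - res_seq \<kappa> j * (1 - \<kappa>) \<ge> 1" using Suc.prems by simp
  then show ?case by simp
qed simp

lemma tendsto_res_seq: "((\<lambda>\<kappa>. res_seq \<kappa> j) \<longlongrightarrow> real j / (real j + 1)) (at_right 0)"
proof (induction j)
  case (Suc j)
  have "((\<lambda>\<kappa>. 1 / (2 + 4 * \<kappa> + \<kappa> - res_seq \<kappa> j * (1 - \<kappa>))) \<longlongrightarrow> 1 / (2 + 4 * 0 + 0 - real j / (real j + 1) * (1 - 0))) (at_right 0)"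
    by (intro tendsto_intros Suc.IH) (auto simp: field_simps)
  moreover have "1 / (2 + 4 * 0 + 0 - real j / (real j + 1) * (1 - 0)) = real (Suc j) / (real (Suc j) + 1)"
    by (simp add: field_simps)
  ultimately show ?case by (simp only: res_seq.simps)
qed simp

text \<open>The recursion is run over the last \<open>j\<close> columns only. The hypothesis on m -
  j makes all of them long enough for the lower bound in \<open>good_column\<close>.\<close>

lemma prob_resolvent_event:
  fixes m N :: nat and \<kappa> :: real
  assumes \<kappa>: "0 < \<kappa>" "\<kappa> < 1" and N: "N \<ge> 1" and m: "m \<le> N" "1 \<le> m - j" "j \<le> m" "(1 - \<kappa> / 2) * N \<le> real (m - j)"
    and e: "ip m e e = 1"
  shows "\<P>(g in gauss (upper m).
      \<not> resolvent_event m (sqrt N) (2 + 4 * \<kappa>) (res_seq \<kappa> j) (goe_quad m g) e) \<le> j * (4 * exp (- \<kappa>\<^sup>2 * N / 64))"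
  using m e
proof (induction j arbitrary: m e)
  case 0
  have "resolvent_event m (sqrt N) (2 + 4 * \<kappa>) (res_seq \<kappa> 0) (goe_quad m g) e" for g
    using resolvent_event_zero[OF 0(5)] N by simp
  then show ?case by simp
next
  case (Suc j m' e)
  define p where "p = 4 * exp (- \<kappa>\<^sup>2 * N / 64)"
  obtain m where m': "m' = Suc m" using Suc.prems by (cases m') auto
  have m: "1 \<le> m" "m \<le> N" "1 \<le> m - j" "j \<le> m" "(1 - \<kappa> / 2) * N \<le> real (m - j)"
    using Suc.prems m' by auto
  have m5: "(1 - \<kappa> / 2) * N \<le> m" using m(5) by (rule order_trans) simp
  let ?r = "res_seq \<kappa> (Suc j)"
  let ?bad = "{g \<in> space (gauss (upper (Suc m))). \<not> resolvent_event (Suc m) (sqrt N) (2 + 4 * \<kappa>) ?r (goe_quad (Suc m) g) (\<lambda>k. if k = m then 1 else 0)}"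
  have "measure (gauss (upper (Suc m))) ?bad \<le>
    measure (gauss (last_column m)) (space (gauss (last_column m)) - good_column N \<kappa> m) + j * p"
  proof (rule prob_upper_Suc_le)
    fix c assume c: "c \<in> good_column N \<kappa> m"
    obtain e' \<beta> where e': "ip m e' e' = 1" and b: "\<And>B i. i < m \<Longrightarrow> sym_coeff (glue m c B) i m = \<beta> * e' i" and \<beta>: "\<beta>\<^sup>2 = col_norm2 m c"
      using glue_decomposition[of m c] m(1) by auto
    have step: "resolvent_event (Suc m) (sqrt N) (2 + 4 * \<kappa>) ?r (goe_quad (Suc m) (glue m c B)) (\<lambda>k. if k = m then 1 else 0)"
      if "resolvent_event m (sqrt N) (2 + 4 * \<kappa>) (res_seq \<kappa> j) (goe_quad m B) e'" for B
      unfolding res_seq.simps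
    proof (rule resolvent_event_step(1)[where \<beta> = \<beta> and e = e'])
      show "(1 - \<kappa>) * (sqrt N)\<^sup>2 \<le> \<beta>\<^sup>2" using c m5 by (simp add: \<beta> good_column_def)
      show "- (\<kappa> * sqrt N) \<le> sym_coeff (glue m c B) m m" using c by (simp add: sym_coeff_glue good_column_def abs_le_iff)
      show "resolvent_event m (sqrt N) (2 + 4 * \<kappa>) (res_seq \<kappa> j) (goe_quad m (glue m c B)) e'" using that by (simp add: goe_quad_glue)
    qed (use N b \<kappa> res_seq_bounds[OF \<kappa>, of j] in \<open>auto simp: sym_coeff_commute\<close>)
    have "\<P>(B in gauss (upper m). glue m c B \<in> ?bad) \<le>
        \<P>(B in gauss (upper m). \<not> resolvent_event m (sqrt N) (2 + 4 * \<kappa>) (res_seq \<kappa> j) (goe_quad m B) e')"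
      by (rule gauss.finite_measure_mono) (use step in \<open>auto intro!: sets_Collect_not sets_resolvent_event\<close>)
    also have "\<dots> \<le> j * p" unfolding p_def by (rule Suc.IH) (use m e' in auto)
    finally show "\<P>(B in gauss (upper m). glue m c B \<in> ?bad) \<le> j * p" .
  qed (auto simp: p_def intro!: sets_Collect_not sets_resolvent_event sets_good_column)
  also have "\<dots> \<le> p + j * p"
    using prob_good_column[of \<kappa> m N] m \<kappa> by (simp add: p_def)
  finally show ?case
    using prob_resolvent_event_rotate[of m "Suc m" e] Suc.prems unfolding m' by (simp add: p_def algebra_simps)
qed

text \<open>The spectral parameter (2 + 4\<kappa>) \<surd>n exceeds the bound for the top eigenvalue
  by 2\<kappa> \<surd>n; this margin is the \<eta> of the deterministic estimates. The last
  condition certifies b^T (Z - C)^(-1) b > \<rho> \<surd>n for Z = (2 + 4\<kappa>) \<surd>n.\<close>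

definition good_event :: "nat \<Rightarrow> real \<Rightarrow> real \<Rightarrow> (nat \<times> nat \<Rightarrow> real) \<Rightarrow> bool" where
  "good_event n \<kappa> \<rho> g \<longleftrightarrow>
     rayleigh_max (Suc n) (goe_quad (Suc n) g) \<le> (2 + 2 * \<kappa>) * sqrt n \<and>
     \<bar>sym_coeff g n n\<bar> \<le> \<kappa> * sqrt n \<and>
     (\<exists>y. \<rho> * sqrt n < 2 * ip n (\<lambda>i. sym_coeff g i n) y - ((2 + 4 * \<kappa>) * sqrt n * ip n y y - goe_quad n g y))"

lemma norm_event_imp_rayleigh_max_le:
  assumes "norm_event n s z (quad n C) e" "n \<ge> 1" "s \<ge> 0"
  shows "rayleigh_max n (quad n C) \<le> z * s"
  unfolding rayleigh_max_le_iff[OF assms(2)]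
proof
  fix y
  have "0 \<le> s * (ip n e y)\<^sup>2" using assms(3) by simp
  then show "quad n C y \<le> z * s * ip n y y" using assms(1) unfolding norm_event_def by (smt (verit))
qed

lemma sets_good_event: "{g \<in> space (gauss (upper (Suc n))). good_event n \<kappa> \<rho> g} \<in> sets (gauss (upper (Suc n)))"
proof -
  have [measurable]: "(\<lambda>g. rayleigh_max (Suc n) (goe_quad (Suc n) g)) \<in> borel_measurable (gauss (upper (Suc n)))"
    by (rule borel_measurable_rayleigh_max) (auto intro: measurable_sym_coeff)
  have [measurable]: "(\<lambda>g. sym_coeff g n n) \<in> borel_measurable (gauss (upper (Suc n)))"
    by (rule measurable_sym_coeff) auto
  have [measurable]: "{g \<in> space (gauss (upper (Suc n))). \<exists>y. \<rho> * sqrt n < 2 * ip n (\<lambda>i. sym_coeff g i n) y - ((2 + 4 * \<kappa>) * sqrt n * ip n y y - goe_quad n g y)} \<in> sets (gauss (upper (Suc n)))"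
  proof (rule sets_Collect_ex_greater)
    show "continuous_on UNIV (\<lambda>y. 2 * ip n (\<lambda>i. sym_coeff g i n) y - ((2 + 4 * \<kappa>) * sqrt n * ip n y y - goe_quad n g y))" for g
      by (intro continuous_on_diff continuous_on_mult_left continuous_on_quad continuous_on_ip_self continuous_on_ip)
    have "(\<lambda>g. ip n (\<lambda>i. sym_coeff g i n) y) \<in> borel_measurable (gauss (upper (Suc n)))" for y
      unfolding ip_def by (intro borel_measurable_sum borel_measurable_times borel_measurable_const measurable_sym_coeff) auto
    then show "(\<lambda>g. 2 * ip n (\<lambda>i. sym_coeff g i n) y - ((2 + 4 * \<kappa>) * sqrt n * ip n y y - goe_quad n g y)) \<in> borel_measurable (gauss (upper (Suc n)))" for y
      by (intro borel_measurable_diff borel_measurable_times borel_measurable_const measurable_goe_quad) auto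
  qed
  show ?thesis unfolding good_event_def by measurable
qed

text \<open>The eigenvalue bound is charged with n + 1 columns, the resolvent bound with
  \<open>L\<close> columns, and the last column is charged once more on its own.\<close>

lemma prob_not_good_event:
  fixes n L :: nat and \<kappa> :: real
  assumes \<kappa>: "0 < \<kappa>" "\<kappa> < 1" and n: "n \<ge> 1" "L < n" "(1 - \<kappa> / 2) * n \<le> real (n - L)"
  shows "\<P>(g in gauss (upper (Suc n)). \<not> good_event n \<kappa> (res_seq \<kappa> L * (1 - \<kappa>)) g)
    \<le> (n + L + 2) * (4 * exp (- \<kappa>\<^sup>2 * n / 64))"
proof -
  define p where "p = 4 * exp (- \<kappa>\<^sup>2 * n / 64)"
  define d where "d = (\<lambda>k. if k = n then 1 else 0 :: real)"
  let ?M = "gauss (upper (Suc n))"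
  have d: "ip (Suc n) d d = 1" by (simp add: d_def ip_unit)
  let ?A = "{g \<in> space ?M. \<not> norm_event (Suc n) (sqrt n) (2 + 2 * \<kappa>) (goe_quad (Suc n) g) d}"
  let ?P = "\<lambda>g. \<bar>sym_coeff g n n\<bar> \<le> \<kappa> * sqrt n \<and>
     (\<exists>y. res_seq \<kappa> L * (1 - \<kappa>) * sqrt n < 2 * ip n (\<lambda>i. sym_coeff g i n) y - ((2 + 4 * \<kappa>) * sqrt n * ip n y y - goe_quad n g y))"
  let ?G = "{g \<in> space ?M. \<not> good_event n \<kappa> (res_seq \<kappa> L * (1 - \<kappa>)) g}"
  have A: "?A \<in> sets ?M" and G: "?G \<in> sets ?M"
    by (auto intro!: sets_Collect_not sets_norm_event sets_good_event)
  \<comment> \<open>Off \<open>?A\<close> the bound for the top eigenvalue holds, so only the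
    conditions \<open>?P\<close> on the last column can fail.\<close>
  have "measure ?M (?G - ?A) \<le> measure (gauss (last_column n)) (space (gauss (last_column n)) - good_column n \<kappa> n) + L * p"
  proof (rule prob_upper_Suc_le)
    fix c assume c: "c \<in> good_column n \<kappa> n"
    obtain e' \<beta> where e': "ip n e' e' = 1" and b: "\<And>B i. i < n \<Longrightarrow> sym_coeff (glue n c B) i n = \<beta> * e' i" and \<beta>: "\<beta>\<^sup>2 = col_norm2 n c"
      using glue_decomposition[OF n(1), of c] by metis
    have step: "?P (glue n c B)"
      if "resolvent_event n (sqrt n) (2 + 4 * \<kappa>) (res_seq \<kappa> L) (goe_quad n B) e'" for B
    proof
      show "\<bar>sym_coeff (glue n c B) n n\<bar> \<le> \<kappa> * sqrt n" using c by (simp add: sym_coeff_glue good_column_def)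
      show "\<exists>y. res_seq \<kappa> L * (1 - \<kappa>) * sqrt n < 2 * ip n (\<lambda>i. sym_coeff (glue n c B) i n) y - ((2 + 4 * \<kappa>) * sqrt n * ip n y y - goe_quad n (glue n c B) y)"
      proof (rule resolvent_event_step(2)[where \<beta> = \<beta> and e = e'])
        show "(1 - \<kappa>) * (sqrt n)\<^sup>2 \<le> \<beta>\<^sup>2" using c \<kappa> by (simp add: \<beta> good_column_def mult_left_le_one_le)
        show "- (\<kappa> * sqrt n) \<le> sym_coeff (glue n c B) n n" using c by (simp add: sym_coeff_glue good_column_def abs_le_iff)
        show "resolvent_event n (sqrt n) (2 + 4 * \<kappa>) (res_seq \<kappa> L) (goe_quad n (glue n c B)) e'" using that by (simp add: goe_quad_glue)
      qed (use n b \<kappa> res_seq_bounds[OF \<kappa>, of L] in \<open>auto simp: sym_coeff_commute\<close>)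
    qed
    have imp: "\<not> resolvent_event n (sqrt n) (2 + 4 * \<kappa>) (res_seq \<kappa> L) (goe_quad n B) e'" if "glue n c B \<in> ?G - ?A" for B
    proof
      assume "resolvent_event n (sqrt n) (2 + 4 * \<kappa>) (res_seq \<kappa> L) (goe_quad n B) e'"
      from step[OF this] that norm_event_imp_rayleigh_max_le[of "Suc n" "sqrt n" "2 + 2 * \<kappa>" "sym_coeff (glue n c B)" d]
      show False by (auto simp: good_event_def)
    qed
    have "\<P>(B in gauss (upper n). glue n c B \<in> ?G - ?A) \<le>
        \<P>(B in gauss (upper n). \<not> resolvent_event n (sqrt n) (2 + 4 * \<kappa>) (res_seq \<kappa> L) (goe_quad n B) e')"
      by (rule gauss.finite_measure_mono) (use imp in \<open>auto intro!: sets_Collect_not sets_resolvent_event\<close>)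
    also have "\<dots> \<le> L * p" unfolding p_def by (rule prob_resolvent_event[OF \<kappa>]) (use n e' in auto)
    finally show "\<P>(B in gauss (upper n). glue n c B \<in> ?G - ?A) \<le> L * p" .
  qed (use A G in \<open>auto simp: p_def intro!: sets_good_column\<close>)
  also have "\<dots> \<le> p + L * p"
    using prob_good_column[of \<kappa> n n] \<kappa> by (simp add: p_def)
  finally have 1: "measure ?M (?G - ?A) \<le> p + L * p" .
  have 2: "measure ?M ?A \<le> Suc n * p"
    using prob_norm_event[of \<kappa> n n d] \<kappa> n d by (simp add: p_def)
  have "measure ?M ?G \<le> measure ?M ((?G - ?A) \<union> ?A)"
    by (rule gauss.finite_measure_mono) (use A G in auto)
  also have "\<dots> \<le> measure ?M (?G - ?A) + measure ?M ?A"
    by (rule measure_Un_le) (use A G in auto)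
  also have "\<dots> \<le> p + L * p + Suc n * p" using 1 2 by simp
  finally show ?thesis by (simp add: p_def algebra_simps)
qed

text \<open>The order of choices matters: first \<open>L\<close> with L / (L + 1) close to 1, then
  \<kappa> so small that the perturbed sequence is still close at index \<open>L\<close>, and only
  then n \<rightarrow> \<infinity>, where the exponential beats the number of columns.\<close>

theorem good_event_whp:
  fixes \<epsilon> :: real
  assumes "\<epsilon> > 0"
  obtains \<kappa> \<rho> where "0 < \<kappa>" "\<kappa> < \<epsilon>" "1 - \<epsilon> < \<rho>" "\<rho> \<le> 1"
    "(\<lambda>n. \<P>(g in gauss (upper (Suc n)). \<not> good_event n \<kappa> \<rho> g)) \<longlonglongrightarrow> 0"
proof -
  have "(\<lambda>L. real L / (real L + 1)) \<longlonglongrightarrow> 1" by real_asymp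
  then have "\<forall>\<^sub>F L in sequentially. 1 - \<epsilon> < real L / (real L + 1)"
    by (rule order_tendstoD) (use assms in simp)
  then obtain L where L: "1 - \<epsilon> < real L / (real L + 1)" by (auto simp: eventually_sequentially)
  have "((\<lambda>\<kappa>. res_seq \<kappa> L * (1 - \<kappa>)) \<longlongrightarrow> real L / (real L + 1) * (1 - 0)) (at_right 0)"
    by (intro tendsto_intros tendsto_res_seq)
  then have "\<forall>\<^sub>F \<kappa> in at_right 0. 1 - \<epsilon> < res_seq \<kappa> L * (1 - \<kappa>)"
    by (rule order_tendstoD) (use L in simp)
  moreover have "\<forall>\<^sub>F \<kappa> in at_right (0::real). \<kappa> < min \<epsilon> 1 \<and> 0 < \<kappa>"
    using assms by (intro eventually_conj eventually_at_right_less eventually_at_rightI[of 0 "min \<epsilon> 1"]) auto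
  ultimately have "\<forall>\<^sub>F \<kappa> in at_right 0. 1 - \<epsilon> < res_seq \<kappa> L * (1 - \<kappa>) \<and> \<kappa> < min \<epsilon> 1 \<and> 0 < \<kappa>"
    by (rule eventually_conj)
  then obtain \<kappa> where \<kappa>: "1 - \<epsilon> < res_seq \<kappa> L * (1 - \<kappa>)" "0 < \<kappa>" "\<kappa> < \<epsilon>" "\<kappa> < 1"
    using eventually_happens'[OF trivial_limit_at_right_real] by fastforce
  show ?thesis
  proof (rule that[OF \<kappa>(2,3,1)])
    show "res_seq \<kappa> L * (1 - \<kappa>) \<le> 1" using res_seq_bounds[OF \<kappa>(2,4), of L] \<kappa> by (intro mult_le_one) auto
    show "(\<lambda>n. \<P>(g in gauss (upper (Suc n)). \<not> good_event n \<kappa> (res_seq \<kappa> L * (1 - \<kappa>)) g)) \<longlonglongrightarrow> 0"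
    proof (rule tendsto_sandwich[OF _ _ tendsto_const])
      show "(\<lambda>n. (real n + real L + 2) * (4 * exp (- \<kappa>\<^sup>2 * real n / 64))) \<longlonglongrightarrow> 0"
        using \<kappa>(2) by real_asymp
      \<comment> \<open>This gives n - L \<ge> (1 - \<kappa>/2) n, the requirement that the last
        \<open>L\<close> columns be long.\<close>
      have "\<forall>\<^sub>F n in sequentially. real n * (\<kappa> / 2) \<ge> real L"
        using \<kappa>(2) by real_asymp
      then show "\<forall>\<^sub>F n in sequentially. \<P>(g in gauss (upper (Suc n)). \<not> good_event n \<kappa> (res_seq \<kappa> L * (1 - \<kappa>)) g)
          \<le> (real n + real L + 2) * (4 * exp (- \<kappa>\<^sup>2 * real n / 64))"
        using eventually_gt_at_top[of L]
      proof eventually_elim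
        case (elim n)
        have "\<P>(g in gauss (upper (Suc n)). \<not> good_event n \<kappa> (res_seq \<kappa> L * (1 - \<kappa>)) g)
          \<le> (n + L + 2) * (4 * exp (- \<kappa>\<^sup>2 * n / 64))"
          by (rule prob_not_good_event) (use elim \<kappa> in \<open>auto simp: algebra_simps of_nat_diff\<close>)
        then show ?case by (simp add: add_ac)
      qed
    qed simp
  qed
qed

section \<open>Projection of the last column on the top eigenvector\<close>

lemma distr_gauss_component:
  assumes "p \<in> I"
  shows "distr (gauss I) borel (\<lambda>g. g p) = std_gauss"
proof -
  have "distr (gauss I) std_gauss (\<lambda>g. g p) = std_gauss"
    unfolding gauss_def by (rule distr_PiM_component) (auto intro: prob_space_std_gauss assms)
  then show ?thesis by (simp cong: distr_cong)
qed

lemma indep_vars_gauss: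
  assumes "S \<subseteq> J" "finite J" "S \<noteq> {}"
  shows "prob_space.indep_vars (gauss J) (\<lambda>_. borel) (\<lambda>p g. g p) S"
proof -
  have rv: "(\<lambda>g. g p) \<in> borel_measurable (gauss J)" if "p \<in> S" for p
    using that assms by (auto intro: measurable_gauss_component)
  have "distr (gauss J) (\<Pi>\<^sub>M i\<in>S. borel) (\<lambda>g. \<lambda>i\<in>S. g i) = distr (gauss J) (gauss S) (\<lambda>g. restrict g S)"
    by (rule distr_cong) (auto simp: sets_gauss)
  also have "\<dots> = (\<Pi>\<^sub>M i\<in>S. distr (gauss J) borel (\<lambda>g. g i))"
    unfolding distr_gauss_restrict[OF assms(1,2)]
    unfolding gauss_def[of S] using assms by (intro PiM_cong) (auto simp: distr_gauss_component)
  finally show ?thesis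
    using gauss.indep_vars_iff_distr_eq_PiM'[OF assms(3), of "\<lambda>p g. g p" J "\<lambda>_. borel"] rv by simp
qed

lemma distr_gauss_linear:
  assumes S: "S \<subseteq> J" "finite J" and u: "(\<Sum>p\<in>S. (a p)\<^sup>2) = 1"
  shows "distr (gauss J) borel (\<lambda>g. \<Sum>p\<in>S. a p * g p) = std_gauss"
proof -
  \<comment> \<open>Vanishing coefficients are discarded because a normal density needs a positive
    standard deviation.\<close>
  define S' where "S' = {p \<in> S. a p \<noteq> 0}"
  have fin: "finite S" using S finite_subset by blast
  have u': "(\<Sum>p\<in>S'. (a p)\<^sup>2) = 1"
    unfolding u[symmetric] S'_def by (rule sum.mono_neutral_left) (use fin in auto)
  have "S' \<noteq> {}" using u' by auto
  then have S': "S' \<subseteq> J" "finite S'" "S' \<noteq> {}" using S fin by (auto simp: S'_def)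
  have "prob_space.indep_vars (gauss J) (\<lambda>_. borel) (\<lambda>p g. a p * g p) S'"
    by (rule gauss.indep_vars_compose2[OF indep_vars_gauss[OF S'(1) S(2) S'(3)]]) simp
  moreover have "distributed (gauss J) lborel (\<lambda>g. a p * g p) (normal_density 0 \<bar>a p\<bar>)" if "p \<in> S'" for p
  proof -
    have m: "(\<lambda>g. g p) \<in> borel_measurable (gauss J)" using that S' by (auto intro: measurable_gauss_component)
    have "distr (gauss J) lborel (\<lambda>g. g p) = std_gauss"
      using distr_gauss_component[of p J] that S' by (simp cong: distr_cong) (metis distr_cong sets_lborel subsetD)
    then have "distributed (gauss J) lborel (\<lambda>g. g p) std_normal_density"
      using m by (simp add: distributed_def std_gauss_def)
    from gauss.normal_density_affine[OF this, of "a p" 0] that show ?thesis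
      by (simp add: S'_def)
  qed
  ultimately have "distributed (gauss J) lborel (\<lambda>g. \<Sum>p\<in>S'. a p * g p) (normal_density (\<Sum>p\<in>S'. 0) (sqrt (\<Sum>p\<in>S'. \<bar>a p\<bar>\<^sup>2)))"
    using S' by (intro gauss.sum_indep_normal) (auto simp: S'_def)
  then have "distr (gauss J) lborel (\<lambda>g. \<Sum>p\<in>S'. a p * g p) = std_gauss"
    by (simp add: u' distributed_def std_gauss_def)
  moreover have "(\<Sum>p\<in>S'. a p * g p) = (\<Sum>p\<in>S. a p * g p)" for g
    unfolding S'_def by (rule sum.mono_neutral_left) (use fin in auto)
  ultimately show ?thesis by (simp cong: distr_cong)
qed

definition dense_seq :: "nat \<Rightarrow> nat \<Rightarrow> real" where
  "dense_seq = (SOME d. \<forall>X. open X \<longrightarrow> X \<noteq> {} \<longrightarrow> (\<exists>k. d k \<in> X))"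

lemma dense_seq: "open X \<Longrightarrow> X \<noteq> {} \<Longrightarrow> \<exists>k. dense_seq k \<in> X"
proof -
  obtain D :: "(nat \<Rightarrow> real) set" where D: "countable D" "\<And>X. open X \<Longrightarrow> X \<noteq> {} \<Longrightarrow> \<exists>d\<in>D. d \<in> X"
    using countable_dense_exists by metis
  have "D \<noteq> {}" using D(2)[of UNIV] by auto
  have "\<exists>d :: nat \<Rightarrow> nat \<Rightarrow> real. \<forall>X. open X \<longrightarrow> X \<noteq> {} \<longrightarrow> (\<exists>k. d k \<in> X)"
    using D \<open>D \<noteq> {}\<close> by (metis from_nat_into_surj)
  then have "\<forall>X. open X \<longrightarrow> X \<noteq> {} \<longrightarrow> (\<exists>k. dense_seq k \<in> X)"
    unfolding dense_seq_def by (rule someI_ex)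
  then show "open X \<Longrightarrow> X \<noteq> {} \<Longrightarrow> \<exists>k. dense_seq k \<in> X" by blast
qed

definition residual :: "nat \<Rightarrow> (nat \<times> nat \<Rightarrow> real) \<Rightarrow> (nat \<Rightarrow> real) \<Rightarrow> real" where
  "residual n g y = (\<Sum>i<n. (mv n (sym_coeff g) y i - rayleigh_max n (goe_quad n g) * y i)\<^sup>2)"

text \<open>The tolerance 1/n is negligible against the gap, which is of order 1/\<surd>n. Both
  conditions are open and scale with the vector, so unnormalized members of the dense sequence can
  be tested.\<close>

definition top_index :: "nat \<Rightarrow> (nat \<times> nat \<Rightarrow> real) \<Rightarrow> nat" where
  "top_index n g = (LEAST k. 0 < ip n (dense_seq k) (dense_seq k) \<and>
     residual n g (dense_seq k) < (1 / n)\<^sup>2 * ip n (dense_seq k) (dense_seq k))"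

text \<open>
  Choosing the first approximate eigenvector in a countable dense set gives a measurable
  substitute for the top eigenvector.
\<close>

definition top_dir :: "nat \<Rightarrow> (nat \<times> nat \<Rightarrow> real) \<Rightarrow> nat \<Rightarrow> real" where
  "top_dir n g = (\<lambda>i. 1 / sqrt (ip n (dense_seq (top_index n g)) (dense_seq (top_index n g))) * dense_seq (top_index n g) i)"

definition proj :: "nat \<Rightarrow> (nat \<times> nat \<Rightarrow> real) \<Rightarrow> real" where
  "proj n g = ip n (\<lambda>i. sym_coeff g i n) (top_dir n g)"

lemma residual_scale: "residual n g (\<lambda>i. c * y i) = c\<^sup>2 * residual n g y"
proof -
  have "mv n (sym_coeff g) (\<lambda>i. c * y i) k - rayleigh_max n (goe_quad n g) * (c * y k) =
      c * (mv n (sym_coeff g) y k - rayleigh_max n (goe_quad n g) * y k)" for k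
    by (simp add: mv_def sum_distrib_left right_diff_distrib mult_ac)
  then show ?thesis by (simp add: residual_def power_mult_distrib sum_distrib_left)
qed

lemma top_dir:
  assumes n: "n \<ge> 1"
  shows "ip n (top_dir n g) (top_dir n g) = 1" "residual n g (top_dir n g) \<le> (1 / n)\<^sup>2"
proof -
  obtain v where v: "ip n v v = 1" "quad n (sym_coeff g) v = rayleigh_max n (goe_quad n g)"
    "\<And>y. goe_quad n g y \<le> rayleigh_max n (goe_quad n g) * ip n y y"
    using rayleigh_max_attained[OF n] by metis
  have "mv n (sym_coeff g) v i = rayleigh_max n (goe_quad n g) * v i" if "i < n" for i
    by (rule maximizer_eigenvector(2)) (use v that sym_coeff_commute in auto)
  then have res: "residual n g v = 0" by (simp add: residual_def)
  \<comment> \<open>An open set that contains the exact top eigenvector, hence also a member of the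
    dense sequence.\<close>
  let ?X = "{y. 0 < ip n y y} \<inter> {y. residual n g y < (1 / n)\<^sup>2 * ip n y y}"
  have c: "continuous_on UNIV (residual n g)"
    unfolding residual_def
    by (intro continuous_on_sum continuous_on_power continuous_on_diff continuous_on_mult_left continuous_on_mv continuous_on_product_coordinates)
  have "open ?X"
    by (intro open_Int open_Collect_less continuous_on_const continuous_on_mult_left continuous_on_ip_self c)
  moreover have "v \<in> ?X" using v(1) res n by simp
  ultimately obtain k where "dense_seq k \<in> ?X" using dense_seq[of ?X] by blast
  then have "0 < ip n (dense_seq k) (dense_seq k) \<and> residual n g (dense_seq k) < (1 / n)\<^sup>2 * ip n (dense_seq k) (dense_seq k)" by simp
  then have t: "0 < ip n (dense_seq (top_index n g)) (dense_seq (top_index n g))"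
     "residual n g (dense_seq (top_index n g)) < (1 / n)\<^sup>2 * ip n (dense_seq (top_index n g)) (dense_seq (top_index n g))"
    unfolding top_index_def by (rule LeastI2, blast)+
  show "ip n (top_dir n g) (top_dir n g) = 1"
    unfolding top_dir_def using t by (intro ip_normalized) simp
  have "residual n g (top_dir n g) = residual n g (dense_seq (top_index n g)) / ip n (dense_seq (top_index n g)) (dense_seq (top_index n g))"
    unfolding top_dir_def residual_scale using t(1) by (simp add: power_divide)
  also have "\<dots> \<le> (1 / n)\<^sup>2" using t by (simp add: pos_divide_le_eq)
  finally show "residual n g (top_dir n g) \<le> (1 / n)\<^sup>2" .
qed

lemma sym_coeff_eq_upper:
  assumes "\<And>p. p \<in> upper n \<Longrightarrow> g p = g' p" "i < n" "j < n"
  shows "sym_coeff g i j = sym_coeff g' i j"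
  using assms by (auto simp: sym_coeff_def upper_def)

text \<open>This locality is what makes the direction independent of the next column.\<close>

lemma top_dir_eq_upper:
  assumes "\<And>p. p \<in> upper n \<Longrightarrow> g p = g' p"
  shows "top_dir n g = top_dir n g'"
proof -
  have q: "goe_quad n g = goe_quad n g'" by (rule quad_cong_coeff) (rule sym_coeff_eq_upper[OF assms])
  have "residual n g y = residual n g' y" for y
    unfolding residual_def q mv_def
    using sym_coeff_eq_upper[OF assms] by (intro sum.cong refl) simp
  then have "top_index n g = top_index n g'" by (simp add: top_index_def)
  then show ?thesis by (simp add: top_dir_def)
qed

lemma measurable_residual:
  assumes "1 \<le> n" "n \<le> m"
  shows "(\<lambda>g. residual n g y) \<in> borel_measurable (gauss (upper m))"
proof -
  have "(\<lambda>g. rayleigh_max n (goe_quad n g)) \<in> borel_measurable (gauss (upper m))"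
    by (rule borel_measurable_rayleigh_max) (use assms in \<open>auto intro: measurable_sym_coeff\<close>)
  then show ?thesis
    unfolding residual_def mv_def
    by (intro borel_measurable_sum borel_measurable_power borel_measurable_diff borel_measurable_times borel_measurable_const measurable_sym_coeff)
       (use assms in auto)
qed

lemma measurable_proj:
  assumes n: "1 \<le> n" "n < m"
  shows "proj n \<in> borel_measurable (gauss (upper m))"
proof -
  have idx: "top_index n \<in> gauss (upper m) \<rightarrow>\<^sub>M count_space UNIV"
    unfolding top_index_def
  proof (rule measurable_Least)
    fix k
    have "{g \<in> space (gauss (upper m)). residual n g (dense_seq k) < (1 / n)\<^sup>2 * ip n (dense_seq k) (dense_seq k)} \<in> sets (gauss (upper m))"
      using n by (intro borel_measurable_less measurable_residual borel_measurable_const) auto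
    then have "Measurable.pred (gauss (upper m)) (\<lambda>g. residual n g (dense_seq k) < (1 / n)\<^sup>2 * ip n (dense_seq k) (dense_seq k))"
      by (simp add: pred_def)
    then show "Measurable.pred (gauss (upper m)) (\<lambda>g. 0 < ip n (dense_seq k) (dense_seq k) \<and>
        residual n g (dense_seq k) < (1 / n)\<^sup>2 * ip n (dense_seq k) (dense_seq k))"
      by (intro pred_intros_logic) auto
  qed
  define f where "f = (\<lambda>k g. ip n (\<lambda>i. sym_coeff g i n) (\<lambda>i. 1 / sqrt (ip n (dense_seq k) (dense_seq k)) * dense_seq k i))"
  have "f k \<in> borel_measurable (gauss (upper m))" for k
    unfolding f_def ip_def[of n "\<lambda>i. sym_coeff _ i n"]
    by (intro borel_measurable_sum borel_measurable_times borel_measurable_const measurable_sym_coeff) (use n in auto)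
  from measurable_compose_countable[OF this idx] show ?thesis
    by (simp add: f_def proj_def[abs_def] top_dir_def)
qed

lemma glue_upper: "p \<in> upper n \<Longrightarrow> glue n c B p = B p"
  using last_column_Int_upper[of n] by (auto simp: glue_def merge_def)

lemma proj_glue:
  shows "proj n (glue n c B) = ip n (\<lambda>i. c (i, n)) (top_dir n B)"
    and "m < n \<Longrightarrow> proj m (glue n c B) = proj m B"
proof -
  have "top_dir n (glue n c B) = top_dir n B" by (rule top_dir_eq_upper) (rule glue_upper)
  then show "proj n (glue n c B) = ip n (\<lambda>i. c (i, n)) (top_dir n B)"
    unfolding proj_def by (auto simp: sym_coeff_glue intro!: ip_cong)
  assume m: "m < n"
  have "top_dir m (glue n c B) = top_dir m B"
    by (rule top_dir_eq_upper, rule glue_upper) (use m in \<open>auto simp: upper_def\<close>)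
  then show "proj m (glue n c B) = proj m B"
    unfolding proj_def using m by (auto simp: sym_coeff_glue intro!: ip_cong)
qed

lemma emeasure_column_projection:
  assumes "ip n u u = 1" "A \<in> sets borel"
  shows "emeasure (gauss (last_column n)) {c \<in> space (gauss (last_column n)). ip n (\<lambda>i. c (i, n)) u \<in> A} = emeasure std_gauss A"
proof -
  let ?S = "(\<lambda>i. (i, n)) ` {..<n}"
  have S: "?S \<subseteq> last_column n" by auto
  have eq: "(\<Sum>p\<in>?S. u (fst p) * c p) = ip n (\<lambda>i. c (i, n)) u" for c
    by (simp add: ip_def sum.reindex inj_on_def mult.commute)
  have "distr (gauss (last_column n)) borel (\<lambda>c. \<Sum>p\<in>?S. u (fst p) * c p) = std_gauss"
    by (rule distr_gauss_linear[OF S]) (use assms(1) in \<open>simp_all add: sum.reindex inj_on_def ip_def power2_eq_square\<close>)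
  moreover have "(\<lambda>c. \<Sum>p\<in>?S. u (fst p) * c p) \<in> borel_measurable (gauss (last_column n))"
    using S by (intro borel_measurable_sum borel_measurable_times borel_measurable_const measurable_gauss_component) auto
  ultimately show ?thesis
    using emeasure_distr[of "\<lambda>c. \<Sum>p\<in>?S. u (fst p) * c p" "gauss (last_column n)" borel A] assms(2)
    by (simp add: eq vimage_def Int_def conj_commute)
qed

text \<open>The order of integration opposite to \<open>nn_integral_upper_Suc\<close>: here the
  corner, and with it the direction \<open>top_dir\<close>, is fixed while the column
  varies.\<close>

lemma nn_integral_upper_Suc':
  assumes f: "f \<in> borel_measurable (gauss (upper (Suc n)))"
  shows "(\<integral>\<^sup>+g. f g \<partial>gauss (upper (Suc n))) = (\<integral>\<^sup>+B. \<integral>\<^sup>+c. f (glue n c B) \<partial>gauss (last_column n) \<partial>gauss (upper n))"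
proof -
  interpret pair_sigma_finite "gauss (upper n)" "gauss (last_column n)" ..
  have "(\<lambda>(c, B). f (glue n c B)) \<in> borel_measurable (gauss (last_column n) \<Otimes>\<^sub>M gauss (upper n))"
    using measurable_compose[OF measurable_glue f] by (simp add: case_prod_unfold)
  then have "(\<lambda>(B, c). f (glue n c B)) \<in> borel_measurable (gauss (upper n) \<Otimes>\<^sub>M gauss (last_column n))"
    by (subst measurable_pair_swap_iff) (simp add: case_prod_unfold)
  then show ?thesis unfolding nn_integral_upper_Suc[OF f] by (rule Fubini')
qed

lemma sets_proj_box:
  fixes A :: "nat \<Rightarrow> real set"
  assumes A: "\<And>m. A m \<in> sets borel" and "n \<le> N"
  shows "{g \<in> space (gauss (upper N)). \<forall>m\<in>{1..<n}. proj m g \<in> A m} \<in> sets (gauss (upper N))"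
proof (rule sets.sets_Collect_finite_All)
  fix m assume "m \<in> {1..<n}"
  then have "proj m \<in> borel_measurable (gauss (upper N))" using assms by (intro measurable_proj) auto
  from measurable_sets[OF this A[of m]] show "{g \<in> space (gauss (upper N)). proj m g \<in> A m} \<in> sets (gauss (upper N))"
    by (simp add: vimage_def Int_def conj_commute)
qed simp

text \<open>Joint independence. Given the corner, the new column is projected on a fixed unit
  vector, so the conditional law is standard normal whatever the corner is, and each column
  contributes one factor. Indices start at 1 because the empty corner has no unit vector.\<close>

lemma emeasure_proj_box:
  fixes A :: "nat \<Rightarrow> real set"
  assumes A: "\<And>m. A m \<in> sets borel"
  shows "emeasure (gauss (upper n)) {g \<in> space (gauss (upper n)). \<forall>m\<in>{1..<n}. proj m g \<in> A m} =
    (\<Prod>m\<in>{1..<n}. emeasure std_gauss (A m))"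
proof (induction n)
  case 0
  show ?case by (simp add: gauss.emeasure_space_1)
next
  case (Suc n)
  show ?case
  proof (cases "n = 0")
    case True
    then show ?thesis by (simp add: gauss.emeasure_space_1)
  next
    case False
    let ?E = "\<lambda>n. {g \<in> space (gauss (upper n)). \<forall>m\<in>{1..<n}. proj m g \<in> A m}"
    have S: "{1..<Suc n} = insert n {1..<n}" using False by auto
    have "emeasure (gauss (upper (Suc n))) (?E (Suc n)) =
      (\<integral>\<^sup>+B. \<integral>\<^sup>+c. indicator (?E (Suc n)) (glue n c B) \<partial>gauss (last_column n) \<partial>gauss (upper n))"
      using nn_integral_upper_Suc'[of "indicator (?E (Suc n))" n] sets_proj_box[OF A, of "Suc n" "Suc n"] by simp
    also have "\<dots> = (\<integral>\<^sup>+B. emeasure std_gauss (A n) * indicator (?E n) B \<partial>gauss (upper n))"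
    proof (rule nn_integral_cong)
      fix B assume B: "B \<in> space (gauss (upper n))"
      let ?C = "{c \<in> space (gauss (last_column n)). ip n (\<lambda>i. c (i, n)) (top_dir n B) \<in> A n}"
      have sp: "glue n c B \<in> space (gauss (upper (Suc n)))" if "c \<in> space (gauss (last_column n))" for c
        using measurable_space[OF measurable_glue[of n], of "(c, B)"] that B by (simp add: space_pair_measure)
      have C: "?C \<in> sets (gauss (last_column n))"
      proof -
        have "(\<lambda>c. ip n (\<lambda>i. c (i, n)) (top_dir n B)) \<in> borel_measurable (gauss (last_column n))"
          unfolding ip_def by (intro borel_measurable_sum borel_measurable_times borel_measurable_const measurable_gauss_component) auto
        from measurable_sets[OF this A[of n]] show ?thesis by (simp add: vimage_def Int_def conj_commute)
      qed
      have "(\<integral>\<^sup>+c. indicator (?E (Suc n)) (glue n c B) \<partial>gauss (last_column n)) =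
        (\<integral>\<^sup>+c. indicator (?E n) B * indicator ?C c \<partial>gauss (last_column n))"
        using B sp unfolding S by (intro nn_integral_cong) (auto simp: indicator_def proj_glue)
      also have "\<dots> = indicator (?E n) B * emeasure (gauss (last_column n)) ?C"
        using C by (simp add: nn_integral_cmult_indicator)
      also have "emeasure (gauss (last_column n)) ?C = emeasure std_gauss (A n)"
        by (rule emeasure_column_projection) (use top_dir(1) False A in auto)
      finally show "(\<integral>\<^sup>+c. indicator (?E (Suc n)) (glue n c B) \<partial>gauss (last_column n)) = emeasure std_gauss (A n) * indicator (?E n) B"
        by (simp add: mult.commute)
    qed
    also have "\<dots> = emeasure std_gauss (A n) * emeasure (gauss (upper n)) (?E n)"
      using sets_proj_box[OF A, of n n] by (simp add: nn_integral_cmult_indicator)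
    finally show ?thesis unfolding Suc.IH S by simp
  qed
qed

lemma distr_proj:
  assumes "n \<ge> 1" "n < N"
  shows "distr (gauss (upper N)) borel (proj n) = std_gauss"
proof (rule measure_eqI)
  fix A assume "A \<in> sets (distr (gauss (upper N)) borel (proj n))"
  then have A: "A \<in> sets borel" by simp
  define A' where "A' = (\<lambda>m. if m = n then A else UNIV)"
  have A': "A' m \<in> sets borel" for m using A by (simp add: A'_def)
  have "emeasure (distr (gauss (upper N)) borel (proj n)) A = emeasure (gauss (upper N)) {g \<in> space (gauss (upper N)). \<forall>m\<in>{1..<N}. proj m g \<in> A' m}"
    using assms A by (subst emeasure_distr[OF measurable_proj]) (auto intro!: arg_cong[where f="emeasure _"] simp: A'_def split: if_splits)
  also have "\<dots> = (\<Prod>m\<in>{1..<N}. emeasure std_gauss (A' m))" by (rule emeasure_proj_box[OF A'])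
  also have "\<dots> = (\<Prod>m\<in>{n}. emeasure std_gauss (A' m))"
    using assms std_gauss.emeasure_space_1 by (intro prod.mono_neutral_right) (auto simp: A'_def)
  finally show "emeasure (distr (gauss (upper N)) borel (proj n)) A = emeasure std_gauss A" by (simp add: A'_def)
qed simp

section \<open>Convergence in probability of the gaps\<close>

definition gap :: "nat \<Rightarrow> (nat \<times> nat \<Rightarrow> real) \<Rightarrow> real" where
  "gap n g = rayleigh_max (Suc n) (goe_quad (Suc n) g) - rayleigh_max n (goe_quad n g)"

text \<open>A difference quotient of the top eigenvalue under subtraction of h e e^T. For a simple
  top eigenvalue with unit eigenvector v it tends to (e \<bullet> v)^2 as h tends to 0.\<close>

definition rank_one_drop :: "nat \<Rightarrow> real \<Rightarrow> ((nat \<Rightarrow> real) \<Rightarrow> real) \<Rightarrow> (nat \<Rightarrow> real) \<Rightarrow> real" where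
  "rank_one_drop n h q e = (rayleigh_max n q - rayleigh_max n (\<lambda>y. q y - h * (ip n e y)\<^sup>2)) / h"

definition unit_vec :: "nat \<Rightarrow> nat \<Rightarrow> real" where
  "unit_vec m = (\<lambda>k. if k = m then 1 else 0)"

lemma ip_unit_vec: "ip n (unit_vec m) y = (if m < n then y m else 0)"
  by (simp add: unit_vec_def ip_unit)

lemma rank_one_drop_quad:
  "rank_one_drop n h (quad n C) e =
     (rayleigh_max n (quad n C) - rayleigh_max n (quad n (\<lambda>i j. C i j - h * e i * e j))) / h"
proof -
  have "(\<lambda>y. quad n C y - h * (ip n e y)\<^sup>2) = quad n (\<lambda>i j. C i j - h * e i * e j)"
    by (rule ext) (simp add: quad_rank_one)
  then show ?thesis by (simp add: rank_one_drop_def)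
qed

lemma measurable_rank_one_drop:
  assumes "n \<ge> 1"
  shows "(\<lambda>g. rank_one_drop n h (goe_quad n g) e) \<in> borel_measurable (gauss (upper n))"
  unfolding rank_one_drop_quad
  by (intro borel_measurable_divide borel_measurable_diff borel_measurable_rayleigh_max borel_measurable_const
      measurable_sym_coeff assms) auto

lemma rank_one_drop_bounds:
  assumes n: "n \<ge> 1" and h: "h > 0" and m: "m < n"
    and v: "ip n v v = 1" "quad n C v = rayleigh_max n (quad n C)"
  shows "0 \<le> rank_one_drop n h (quad n C) (unit_vec m)" "rank_one_drop n h (quad n C) (unit_vec m) \<le> (v m)\<^sup>2"
proof -
  let ?C = "\<lambda>i j. C i j - h * unit_vec m i * unit_vec m j"
  have q: "quad n ?C y = quad n C y - h * (y m)\<^sup>2" for y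
    using m by (simp add: quad_rank_one ip_unit_vec)
  have "rayleigh_max n (quad n ?C) \<le> rayleigh_max n (quad n C)"
    unfolding rayleigh_max_le_iff[OF n]
  proof
    fix y
    have "0 \<le> h * (y m)\<^sup>2" using h by simp
    then show "quad n ?C y \<le> rayleigh_max n (quad n C) * ip n y y"
      using quad_le_rayleigh_max[OF n, of C y] by (simp add: q)
  qed
  then show "0 \<le> rank_one_drop n h (quad n C) (unit_vec m)"
    using h by (simp add: rank_one_drop_quad)
  have "rayleigh_max n (quad n C) - h * (v m)\<^sup>2 \<le> rayleigh_max n (quad n ?C)"
    using quad_le_rayleigh_max[OF n, of ?C v] v by (simp add: q)
  then show "rank_one_drop n h (quad n C) (unit_vec m) \<le> (v m)\<^sup>2"
    using h by (simp add: rank_one_drop_quad pos_divide_le_eq mult.commute)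
qed

lemma orthogonal_invariant_rank_one_drop: "orthogonal_invariant n (rank_one_drop n h)"
  unfolding orthogonal_invariant_def
proof (intro allI impI)
  fix q e e' and R :: "(nat \<Rightarrow> real) \<Rightarrow> nat \<Rightarrow> real"
  assume R: "bij R" "\<forall>y. ip n (R y) (R y) = ip n y y" "\<forall>y. ip n e' y = ip n e (R y)"
  have "R ` {y. ip n y y = 1} = {y. ip n y y = 1}"
  proof (intro equalityI subsetI)
    fix y assume y: "y \<in> {y. ip n y y = 1}"
    obtain x where "y = R x" using R(1) by (meson bij_pointE)
    then show "y \<in> R ` {y. ip n y y = 1}" using y R(2) by auto
  qed (use R(2) in auto)
  then have *: "rayleigh_max n (\<lambda>y. f (R y)) = rayleigh_max n f" for f
    unfolding rayleigh_max_def by (metis (mono_tags, lifting) image_cong image_image)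
  show "rank_one_drop n h (\<lambda>y. q (R y)) e' = rank_one_drop n h q e"
    unfolding rank_one_drop_def using *[of q] *[of "\<lambda>y. q y - h * (ip n e y)\<^sup>2"] R(3) by simp
qed

lemma integral_rank_one_drop_le:
  assumes n: "n \<ge> 1" and h: "h > 0"
  shows "integrable (gauss (upper n)) (\<lambda>g. rank_one_drop n h (goe_quad n g) (unit_vec (n - 1)))" (is ?int)
    and "n * (\<integral>g. rank_one_drop n h (goe_quad n g) (unit_vec (n - 1)) \<partial>gauss (upper n)) \<le> 1"
proof -
  let ?d = "\<lambda>m g. rank_one_drop n h (goe_quad n g) (unit_vec m)"
  have bounds: "0 \<le> ?d m g \<and> ?d m g \<le> 1" if "m < n" for m g
  proof -
    obtain v where v: "ip n v v = 1" "goe_quad n g v = rayleigh_max n (goe_quad n g)"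
      using rayleigh_max_attained[OF n] by metis
    show ?thesis using rank_one_drop_bounds[OF n h that v] coordinate_le_ip[OF that, of v] v(1) by simp
  qed
  have int: "integrable (gauss (upper n)) (?d m)" if "m < n" for m
    by (rule gauss.integrable_const_bound[where B=1]) (use bounds[OF that] in \<open>auto intro: measurable_rank_one_drop[OF n]\<close>)
  then show ?int using n by simp
  have sum: "(\<Sum>m<n. ?d m g) \<le> 1" for g
  proof -
    obtain v where v: "ip n v v = 1" "goe_quad n g v = rayleigh_max n (goe_quad n g)"
      using rayleigh_max_attained[OF n] by metis
    have "(\<Sum>m<n. ?d m g) \<le> (\<Sum>m<n. (v m)\<^sup>2)"
      by (intro sum_mono rank_one_drop_bounds[OF n h _ v]) simp
    then show ?thesis using v(1) by (simp add: ip_def power2_eq_square)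
  qed
  have "n * (\<integral>g. ?d (n - 1) g \<partial>gauss (upper n)) = (\<Sum>m<n. \<integral>g. ?d (n - 1) g \<partial>gauss (upper n))" by simp
  also have "\<dots> = (\<Sum>m<n. \<integral>g. ?d m g \<partial>gauss (upper n))"
  proof (rule sum.cong[OF refl])
    fix m assume "m \<in> {..<n}"
    then show "(\<integral>g. ?d (n - 1) g \<partial>gauss (upper n)) = (\<integral>g. ?d m g \<partial>gauss (upper n))"
      using integral_orthogonal_invariant[OF orthogonal_invariant_rank_one_drop measurable_rank_one_drop[OF n], of "n - 1" "unit_vec m" h] n
      by (simp add: unit_vec_def ip_unit)
  qed
  also have "\<dots> = (\<integral>g. (\<Sum>m<n. ?d m g) \<partial>gauss (upper n))"
    by (rule Bochner_Integration.integral_sum[symmetric]) (use int in auto)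
  also have "\<dots> \<le> (\<integral>g. 1 \<partial>gauss (upper n))"
    by (intro integral_mono Bochner_Integration.integrable_sum) (use int sum in auto)
  also have "\<dots> = 1" by (simp add: gauss.prob_space)
  finally show "n * (\<integral>g. ?d (n - 1) g \<partial>gauss (upper n)) \<le> 1" .
qed

text \<open>
  This finite difference replaces the squared last entry of the top eigenvector, which would need a
  measurable choice of that eigenvector. It dominates the squared last entry for the perturbed matrix,
  while the drops over all coordinates still sum to at most \<open>1\<close>.
\<close>

definition corner_drop :: "nat \<Rightarrow> (nat \<times> nat \<Rightarrow> real) \<Rightarrow> real" where
  "corner_drop n g = rank_one_drop (Suc n) (1 / n) (goe_quad (Suc n) g) (unit_vec n)"

lemma gap_nonneg: "n \<ge> 1 \<Longrightarrow> 0 \<le> gap n g"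
  unfolding gap_def using rayleigh_max_mono_size[of n "sym_coeff g"] by (simp add: sym_coeff_commute)

lemma corner_drop_bounds: "n \<ge> 1 \<Longrightarrow> 0 \<le> corner_drop n g \<and> corner_drop n g \<le> 1"
proof -
  assume n: "n \<ge> 1"
  obtain v where v: "ip (Suc n) v v = 1" "goe_quad (Suc n) g v = rayleigh_max (Suc n) (goe_quad (Suc n) g)"
    using rayleigh_max_attained[of "Suc n" "sym_coeff g"] by (metis le_add1 plus_1_eq_Suc)
  show ?thesis using rank_one_drop_bounds[of "Suc n" "1 / n" n v "sym_coeff g"] v n coordinate_le_ip[of n "Suc n" v]
    by (simp add: corner_drop_def)
qed

text \<open>\<open>column_projection_le\<close> with residual 1/n and margin 2\<kappa> \<surd>n. On
  the good event l - a - \<rho> \<surd>n is at most (2 + 2\<kappa> + \<kappa> - \<rho>) \<surd>n,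
  whence \<open>\<theta>\<close>. The first term carries the estimate (u \<bullet> b)^2 \<le>
  \<theta> \<surd>n x; the second is of lower order when x is of order 1/\<surd>n.\<close>

lemma proj_le_gap:
  assumes n: "n \<ge> 1" and \<kappa>: "0 < \<kappa>" "\<kappa> < 1" and good: "good_event n \<kappa> \<rho> g" and \<rho>: "\<rho> \<le> 1"
  defines "\<theta> \<equiv> 2 + 3 * \<kappa> - \<rho>" and "x \<equiv> gap n g + 1 / n"
  shows "\<bar>proj n g\<bar> \<le> sqrt (x * (\<theta> * sqrt n)) + x * sqrt (\<theta> / (2 * \<kappa>))"
proof -
  define s where "s = sqrt n"
  have s: "s > 0" using n by (simp add: s_def)
  define l where "l = rayleigh_max (Suc n) (goe_quad (Suc n) g)"
  define m where "m = rayleigh_max n (goe_quad n g)"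
  have l: "l \<le> (2 + 2 * \<kappa>) * s" and a: "\<bar>sym_coeff g n n\<bar> \<le> \<kappa> * s"
    using good by (auto simp: good_event_def l_def s_def)
  obtain y where y: "\<rho> * s < 2 * ip n (\<lambda>i. sym_coeff g i n) y - ((2 + 4 * \<kappa>) * s * ip n y y - goe_quad n g y)"
    using good by (auto simp: good_event_def s_def)
  have xm: "x = l - m + 1 / n" by (simp add: x_def gap_def l_def m_def)
  have x0: "x \<ge> 0" using gap_nonneg[OF n, of g] by (simp add: x_def)
  have \<theta>: "\<theta> \<ge> 0" using \<kappa> \<rho> by (simp add: \<theta>_def)
  have "\<bar>ip n (\<lambda>i. sym_coeff g i n) (top_dir n g)\<bar> \<le>
    sqrt ((l - m + 1 / n) * (l - sym_coeff g n n - \<rho> * s)) + (l - m + 1 / n) * sqrt ((l - sym_coeff g n n - \<rho> * s) / (2 * \<kappa> * s))"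
    unfolding l_def m_def
    by (rule column_projection_le[where y = y and Z = "(2 + 4 * \<kappa>) * s"])
       (use n s \<kappa> l y top_dir[OF n, of g] in \<open>auto simp: sym_coeff_commute residual_def l_def algebra_simps\<close>)
  also have "\<dots> \<le> sqrt (x * (\<theta> * s)) + x * sqrt (\<theta> / (2 * \<kappa>))"
  proof -
    have T: "l - sym_coeff g n n - \<rho> * s \<le> \<theta> * s"
      using l a by (simp add: \<theta>_def algebra_simps abs_le_iff)
    have "(l - sym_coeff g n n - \<rho> * s) / (2 * \<kappa> * s) \<le> \<theta> * s / (2 * \<kappa> * s)"
      using T \<kappa> s by (intro divide_right_mono) auto
    also have "\<dots> = \<theta> / (2 * \<kappa>)" using s by simp
    finally show ?thesis
      using T x0 unfolding xm[symmetric] by (intro add_mono mult_left_mono real_sqrt_le_mono) auto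
  qed
  finally show ?thesis by (simp add: proj_def s_def)
qed

text \<open>\<open>top_eigenvector_last_entry\<close> for the matrix whose corner entry is lowered
  by 1/n, where the squared last entry is at most the drop; lowering the entry is the source of the
  1/n in \<open>T\<close>. When the drop is of order 1/n, the bracket is close to 2\<kappa>
  \<surd>n, and the inequality reads, to leading order, gap \<le> \<theta> \<surd>n times the
  drop.\<close>

lemma gap_le_corner_drop:
  assumes n: "n \<ge> 1" and \<kappa>: "0 < \<kappa>" "\<kappa> < 1" and good: "good_event n \<kappa> \<rho> g" and \<rho>: "\<rho> \<le> 1"
  defines "\<theta> \<equiv> 2 + 3 * \<kappa> - \<rho>"
  defines "T \<equiv> \<theta> * sqrt n + 1 / n"
  assumes den: "0 \<le> 2 * \<kappa> * sqrt n * (1 - corner_drop n g) - corner_drop n g * T"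
  shows "(gap n g - 1 / n) * (2 * \<kappa> * sqrt n * (1 - corner_drop n g) - corner_drop n g * T) \<le> 2 * \<kappa> * sqrt n * T * corner_drop n g"
proof -
  define s where "s = sqrt n"
  have s: "s > 0" using n by (simp add: s_def)
  \<comment> \<open>Lowering the corner entry by \<open>h\<close> moves the top eigenvalue by at
    most 1/n, which remains negligible after multiplication by \<surd>n.\<close>
  define h where "h = 1 / real n"
  have h: "h > 0" using n by (simp add: h_def)
  define C where "C = (\<lambda>i j. sym_coeff g i j - h * unit_vec n i * unit_vec n j)"
  have Csym: "C i j = C j i" for i j by (simp add: C_def sym_coeff_commute)
  have Cn: "quad n C = goe_quad n g" by (rule quad_cong_coeff) (simp add: C_def unit_vec_def)
  have Cb: "ip n (\<lambda>i. C i n) y = ip n (\<lambda>i. sym_coeff g i n) y" for y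
    by (rule ip_cong) (auto simp: C_def unit_vec_def)
  have Cc: "C n n = sym_coeff g n n - h" by (simp add: C_def unit_vec_def)
  define l where "l = rayleigh_max (Suc n) (goe_quad (Suc n) g)"
  define l' where "l' = rayleigh_max (Suc n) (quad (Suc n) C)"
  define m where "m = rayleigh_max n (goe_quad n g)"
  have corner_drop: "corner_drop n g = (l - l') / h"
    by (simp add: corner_drop_def rank_one_drop_quad l_def l'_def C_def h_def)
  have d01: "0 \<le> corner_drop n g" "corner_drop n g \<le> 1" using corner_drop_bounds[OF n] by auto
  have ll': "l' \<le> l" "l \<le> l' + h" using corner_drop d01 h by (auto simp: field_simps)
  have l: "l \<le> (2 + 2 * \<kappa>) * s" and a: "\<bar>sym_coeff g n n\<bar> \<le> \<kappa> * s"
    using good by (auto simp: good_event_def l_def s_def)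
  obtain y where y: "\<rho> * s < 2 * ip n (\<lambda>i. sym_coeff g i n) y - ((2 + 4 * \<kappa>) * s * ip n y y - goe_quad n g y)"
    using good by (auto simp: good_event_def s_def)
  obtain v where v: "ip (Suc n) v v = 1" "quad (Suc n) C v = l'"
    using rayleigh_max_attained[of "Suc n" C] unfolding l'_def by auto
  have \<theta>: "\<theta> \<ge> 0" using \<kappa> \<rho> by (simp add: \<theta>_def)
  have T0: "T \<ge> 0" using \<theta> by (simp add: T_def)
  have ml': "m \<le> l'" unfolding m_def l'_def Cn[symmetric] by (rule rayleigh_max_mono_size[OF n Csym])
  have \<tau>: "(v n)\<^sup>2 \<le> corner_drop n g"
  proof -
    have "quad (Suc n) C v = goe_quad (Suc n) g v - h * (v n)\<^sup>2"
      unfolding C_def quad_rank_one by (simp add: ip_unit_vec)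
    then have "l' + h * (v n)\<^sup>2 \<le> l"
      using quad_le_rayleigh_max[of "Suc n" "sym_coeff g" v] v by (simp add: l_def)
    then show ?thesis unfolding corner_drop using h by (simp add: pos_le_divide_eq mult.commute)
  qed
  have main: "(1 - (v n)\<^sup>2) * ((l' - m) * (2 * \<kappa> * s)) \<le> (l' - m + 2 * \<kappa> * s) * ((v n)\<^sup>2 * (l' - C n n - \<rho> * s))"
    unfolding l'_def m_def Cn[symmetric]
    by (rule top_eigenvector_last_entry[where y = y and Z = "(2 + 4 * \<kappa>) * s"])
       (use n s \<kappa> l ll' y v Csym in \<open>auto simp: Cn Cb l'_def algebra_simps\<close>)
  define X where "X = l' - m"
  have X: "X \<ge> 0" using ml' by (simp add: X_def)
  have "(v n)\<^sup>2 * (l' - C n n - \<rho> * s) \<le> (v n)\<^sup>2 * T"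
    using l ll' a unfolding Cc T_def \<theta>_def s_def[symmetric] h_def[symmetric]
    by (intro mult_left_mono) (auto simp: algebra_simps abs_le_iff)
  also have "\<dots> \<le> corner_drop n g * T" using \<tau> T0 by (rule mult_right_mono)
  finally have "(X + 2 * \<kappa> * s) * ((v n)\<^sup>2 * (l' - C n n - \<rho> * s)) \<le> (X + 2 * \<kappa> * s) * (corner_drop n g * T)"
    using X \<kappa> s by (intro mult_left_mono) auto
  moreover have "(1 - corner_drop n g) * (X * (2 * \<kappa> * s)) \<le> (1 - (v n)\<^sup>2) * (X * (2 * \<kappa> * s))"
    using \<tau> X \<kappa> s by (intro mult_right_mono) auto
  ultimately have "(1 - corner_drop n g) * (X * (2 * \<kappa> * s)) \<le> (X + 2 * \<kappa> * s) * (corner_drop n g * T)"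
    using main unfolding X_def by linarith
  then have 1: "X * (2 * \<kappa> * s * (1 - corner_drop n g) - corner_drop n g * T) \<le> 2 * \<kappa> * s * T * corner_drop n g"
    by (simp add: algebra_simps)
  have "gap n g - 1 / n \<le> X" using ll' by (simp add: gap_def X_def l_def m_def h_def)
  then show ?thesis using mult_right_mono[OF _ den] 1 unfolding s_def by (meson order_trans)
qed


lemma measurable_gap: "n \<ge> 1 \<Longrightarrow> n < m \<Longrightarrow> gap n \<in> borel_measurable (gauss (upper m))"
  unfolding gap_def[abs_def]
  by (intro borel_measurable_diff borel_measurable_rayleigh_max measurable_sym_coeff) auto

lemma measurable_corner_drop: "corner_drop n \<in> borel_measurable (gauss (upper (Suc n)))"
  unfolding corner_drop_def[abs_def] by (rule measurable_rank_one_drop) simp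

lemma integral_corner_drop:
  assumes "n \<ge> 1"
  shows "integrable (gauss (upper (Suc n))) (corner_drop n)" "Suc n * (\<integral>g. corner_drop n g \<partial>gauss (upper (Suc n))) \<le> 1"
  using integral_rank_one_drop_le[of "Suc n" "1 / n"] assms by (simp_all add: corner_drop_def[abs_def])

lemma weighted_square_le:
  fixes p d \<epsilon> G :: real
  assumes "\<bar>G\<bar> \<le> p + d" "\<epsilon> > 0"
  shows "G\<^sup>2 \<le> (1 + \<epsilon>) * p\<^sup>2 + (1 + 1 / \<epsilon>) * d\<^sup>2"
proof -
  have "G\<^sup>2 \<le> (p + d)\<^sup>2" using assms(1) by (metis abs_ge_zero order_trans power2_abs power_mono)
  moreover have "(p + d)\<^sup>2 = p\<^sup>2 + 2 * p * d + d\<^sup>2" by (simp add: power2_eq_square algebra_simps)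
  moreover have "0 \<le> (\<epsilon> * p - d)\<^sup>2 / \<epsilon>" using assms(2) by simp
  moreover have "(\<epsilon> * p - d)\<^sup>2 / \<epsilon> = \<epsilon> * p\<^sup>2 - 2 * p * d + d\<^sup>2 / \<epsilon>"
    using assms(2) by (simp add: power2_eq_square field_simps)
  ultimately show ?thesis by (simp add: distrib_right)
qed

text \<open>Keeping \<kappa> and 1 - \<rho> below \<epsilon>/16 gives \<theta> < 1 + \<epsilon>/4.
  The cap \<open>K\<close> forces the drop to be of order 1/n, which keeps the bracket in
  \<open>gap_le_corner_drop\<close> positive and of order \<surd>n.\<close>

lemma eventually_good_imp:
  fixes \<epsilon> \<kappa> \<rho> K :: real
  assumes \<epsilon>: "0 < \<epsilon>" "\<epsilon> \<le> 1" and \<kappa>: "0 < \<kappa>" "\<kappa> < \<epsilon> / 16" and \<rho>: "1 - \<epsilon> / 16 < \<rho>" "\<rho> \<le> 1" and K: "K > 0"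
  shows "\<forall>\<^sub>F n in sequentially. \<forall>g. good_event n \<kappa> \<rho> g \<longrightarrow> Suc n * corner_drop n g \<le> K \<longrightarrow>
    (proj n g)\<^sup>2 \<le> (1 + \<epsilon>) * (sqrt n * gap n g) + \<epsilon> \<and> sqrt n * gap n g \<le> (1 + \<epsilon>) * (Suc n * corner_drop n g) + \<epsilon>"
proof -
  define \<theta> where "\<theta> = 2 + 3 * \<kappa> - \<rho>"
  have \<theta>: "1 < \<theta>" "\<theta> < 1 + \<epsilon> / 4" using \<kappa> \<rho> \<epsilon> by (auto simp: \<theta>_def)
  define T where "T = (\<lambda>n. \<theta> * sqrt (real n) + 1 / real n)"
  define d where "d = (\<lambda>n. 2 * \<kappa> * sqrt (real n) * (1 - K / real n) - K / real n * T n)"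
  \<comment> \<open>\<open>A\<close> is the factor between the rescaled gap and the rescaled drop,
    and it tends to \<theta>. Next, \<open>\<delta>\<close> bounds the second term of
    \<open>proj_le_gap\<close>, with 2 K + 3 an upper bound for \<surd>n x.\<close>
  define A where "A = (\<lambda>n. sqrt (real n) * (2 * \<kappa> * sqrt (real n) * T n) / ((real n + 1) * d n))"
  define \<delta> where "\<delta> = (\<lambda>n. (2 * K + 3) / sqrt (real n) * sqrt (\<theta> / (2 * \<kappa>)))"
  have "A \<longlonglongrightarrow> 2 * \<kappa> * \<theta> / (2 * \<kappa>)"
    unfolding A_def d_def T_def using \<kappa>(1) \<theta>(1) K by real_asymp
  then have "A \<longlonglongrightarrow> \<theta>" using \<kappa>(1) by simp
  then have A: "\<forall>\<^sub>F n in sequentially. A n < 1 + \<epsilon>" by (rule order_tendstoD) (use \<theta> \<epsilon> in simp)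
  have d: "\<forall>\<^sub>F n in sequentially. d n > 0"
    unfolding d_def T_def using \<kappa>(1) \<theta>(1) K by real_asymp
  have s: "\<forall>\<^sub>F n in sequentially. 1 / sqrt (real n) < \<epsilon>"
    by (rule order_tendstoD[of _ 0]) (real_asymp, use \<epsilon> in simp)
  have "(\<lambda>n. (1 + \<epsilon>) / sqrt (real n) + (1 + 16 / \<epsilon>) * (\<delta> n)\<^sup>2) \<longlonglongrightarrow> (1 + \<epsilon>) * 0 + (1 + 16 / \<epsilon>) * (0 * sqrt (\<theta> / (2 * \<kappa>)))\<^sup>2"
  proof -
    have "(\<lambda>n. (1 + \<epsilon>) * (1 / sqrt (real n)) + (1 + 16 / \<epsilon>) * (\<delta> n)\<^sup>2) \<longlonglongrightarrow> (1 + \<epsilon>) * 0 + (1 + 16 / \<epsilon>) * (0 * sqrt (\<theta> / (2 * \<kappa>)))\<^sup>2"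
      unfolding \<delta>_def by (intro tendsto_intros; real_asymp)
    then show ?thesis by simp
  qed
  then have e: "\<forall>\<^sub>F n in sequentially. (1 + \<epsilon>) / sqrt (real n) + (1 + 16 / \<epsilon>) * (\<delta> n)\<^sup>2 < \<epsilon>"
    by (rule order_tendstoD) (use \<epsilon> in simp)
  show ?thesis using A d s e eventually_ge_at_top[of 1]
  proof eventually_elim
    case (elim n)
    have n: "n \<ge> 1" by fact
    have sn: "sqrt (real n) > 0" using n by simp
    show ?case
    proof (intro allI impI)
      fix g assume good: "good_event n \<kappa> \<rho> g" and Y: "Suc n * corner_drop n g \<le> K"
      have d0: "corner_drop n g \<ge> 0" using corner_drop_bounds[OF n] by simp
      have T0: "T n \<ge> 0" using \<theta> by (simp add: T_def)
      have "n * corner_drop n g \<le> Suc n * corner_drop n g" using d0 by (intro mult_right_mono) auto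
      then have dK: "corner_drop n g \<le> K / n" using Y n by (simp add: pos_le_divide_eq mult.commute)
      define den where "den = 2 * \<kappa> * sqrt n * (1 - corner_drop n g) - corner_drop n g * T n"
      have dden: "d n \<le> den"
        unfolding d_def den_def using dK \<kappa>(1) T0
        by (intro diff_mono mult_left_mono mult_right_mono) auto
      have \<kappa>1: "\<kappa> < 1" using \<kappa> \<epsilon> by simp
      have "(gap n g - 1 / n) * den \<le> 2 * \<kappa> * sqrt n * T n * corner_drop n g"
        using gap_le_corner_drop[OF n \<kappa>(1) \<kappa>1 good \<rho>(2)] dden elim(2) unfolding T_def \<theta>_def den_def by simp
      then have "gap n g - 1 / n \<le> 2 * \<kappa> * sqrt n * T n * corner_drop n g / den"
        using dden elim(2) by (simp add: pos_le_divide_eq)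
      also have "\<dots> \<le> 2 * \<kappa> * sqrt n * T n * corner_drop n g / d n"
        using dden elim(2) \<kappa>(1) T0 d0 by (intro divide_left_mono) auto
      finally have "sqrt n * gap n g \<le> sqrt n * (2 * \<kappa> * sqrt n * T n * corner_drop n g / d n + 1 / n)"
        using sn by (intro mult_left_mono) auto
      also have "\<dots> = A n * (Suc n * corner_drop n g) + sqrt n / n"
      proof -
        have "a / (b * c) * (b * w) = a * w / c" if "b \<noteq> 0" for a b c w :: real using that by simp
        from this[of "real n + 1" "sqrt n * (2 * \<kappa> * sqrt n * T n)" "d n" "corner_drop n g"]
        have "A n * (Suc n * corner_drop n g) = sqrt n * (2 * \<kappa> * sqrt n * T n) * corner_drop n g / d n"
          by (simp add: A_def add.commute)
        then show ?thesis by (simp add: distrib_left mult.assoc)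
      qed
      also have "sqrt n / n = 1 / sqrt n" using n by (simp add: real_div_sqrt field_simps)
      finally have X: "sqrt n * gap n g \<le> A n * (Suc n * corner_drop n g) + 1 / sqrt n" .
      also have "\<dots> \<le> (1 + \<epsilon>) * (Suc n * corner_drop n g) + \<epsilon>"
        using elim(1,3) d0 by (intro add_mono mult_right_mono) auto
      finally have X1: "sqrt n * gap n g \<le> (1 + \<epsilon>) * (Suc n * corner_drop n g) + \<epsilon>" .
      define x where "x = gap n g + 1 / n"
      have x0: "x \<ge> 0" using gap_nonneg[OF n, of g] by (simp add: x_def)
      have sx: "sqrt n * x = sqrt n * gap n g + 1 / sqrt n"
        using n by (simp add: x_def distrib_left real_div_sqrt field_simps)
      have "sqrt n * x \<le> (1 + \<epsilon>) * K + \<epsilon> + \<epsilon>"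
      proof -
        have "(1 + \<epsilon>) * (Suc n * corner_drop n g) \<le> (1 + \<epsilon>) * K" using Y \<epsilon> by (intro mult_left_mono) auto
        then show ?thesis using X1 elim(3) unfolding sx by linarith
      qed
      also have "\<dots> \<le> 2 * K + 3" 
      proof -
        have "\<epsilon> * K \<le> 1 * K" using \<epsilon> K by (intro mult_right_mono) auto
        then show ?thesis using \<epsilon> unfolding distrib_right by linarith
      qed
      finally have xK: "sqrt n * x \<le> 2 * K + 3" .
      have "\<bar>proj n g\<bar> \<le> sqrt (x * (\<theta> * sqrt n)) + x * sqrt (\<theta> / (2 * \<kappa>))"
        unfolding x_def \<theta>_def by (rule proj_le_gap[OF n \<kappa>(1) \<kappa>1 good \<rho>(2)])
      also have "x * sqrt (\<theta> / (2 * \<kappa>)) \<le> \<delta> n"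
        unfolding \<delta>_def using xK sn \<theta> \<kappa>
        by (intro mult_right_mono) (auto simp: pos_le_divide_eq mult.commute)
      finally have "\<bar>proj n g\<bar> \<le> sqrt (x * (\<theta> * sqrt n)) + \<delta> n" by simp
      then have "(proj n g)\<^sup>2 \<le> (1 + \<epsilon> / 16) * (sqrt (x * (\<theta> * sqrt n)))\<^sup>2 + (1 + 1 / (\<epsilon> / 16)) * (\<delta> n)\<^sup>2"
        by (rule weighted_square_le) (use \<epsilon> in simp)
      also have "(sqrt (x * (\<theta> * sqrt n)))\<^sup>2 = \<theta> * (sqrt n * x)" using x0 \<theta> by simp
      also have "(1 + \<epsilon> / 16) * (\<theta> * (sqrt n * x)) \<le> (1 + \<epsilon>) * (sqrt n * x)"
      proof -
        have "(1 + \<epsilon> / 16) * \<theta> \<le> (1 + \<epsilon> / 16) * (1 + \<epsilon> / 4)" using \<theta> \<epsilon> by (intro mult_left_mono) auto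
        also have "\<dots> = 1 + \<epsilon> / 4 + \<epsilon> / 16 + \<epsilon> * \<epsilon> / 64" by (simp add: field_simps)
        also have "\<epsilon> * \<epsilon> \<le> 1 * \<epsilon>" using \<epsilon> by (intro mult_right_mono) auto
        also have "1 + \<epsilon> / 4 + \<epsilon> / 16 + 1 * \<epsilon> / 64 \<le> 1 + \<epsilon>" using \<epsilon> by simp
        finally show ?thesis using x0 mult_right_mono[of "(1 + \<epsilon> / 16) * \<theta>" "1 + \<epsilon>" "sqrt n * x"] by (simp add: mult.assoc)
      qed
      finally have "(proj n g)\<^sup>2 \<le> (1 + \<epsilon>) * (sqrt n * gap n g) + ((1 + \<epsilon>) / sqrt n + (1 + 16 / \<epsilon>) * (\<delta> n)\<^sup>2)"
        unfolding sx by (simp add: algebra_simps)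
      then have "(proj n g)\<^sup>2 \<le> (1 + \<epsilon>) * (sqrt n * gap n g) + \<epsilon>" using elim(4) by simp
      then show "(proj n g)\<^sup>2 \<le> (1 + \<epsilon>) * (sqrt n * gap n g) + \<epsilon> \<and> sqrt n * gap n g \<le> (1 + \<epsilon>) * (Suc n * corner_drop n g) + \<epsilon>"
        using X1 by simp
    qed
  qed
qed

lemma gap_sandwich_whp:
  fixes \<epsilon> :: real
  assumes \<epsilon>: "0 < \<epsilon>" "\<epsilon> \<le> 1"
  shows "(\<lambda>n. \<P>(g in gauss (upper (Suc n)).
    \<not> ((proj n g)\<^sup>2 \<le> (1 + \<epsilon>) * (sqrt n * gap n g) + \<epsilon> \<and> sqrt n * gap n g \<le> (1 + \<epsilon>) * (Suc n * corner_drop n g) + \<epsilon>))) \<longlonglongrightarrow> 0"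
    (is "(\<lambda>n. measure _ (?B n)) \<longlonglongrightarrow> 0")
proof -
  obtain \<kappa> \<rho> where \<kappa>: "0 < \<kappa>" "\<kappa> < \<epsilon> / 16" and \<rho>: "1 - \<epsilon> / 16 < \<rho>" "\<rho> \<le> 1"
    and lim: "(\<lambda>n. \<P>(g in gauss (upper (Suc n)). \<not> good_event n \<kappa> \<rho> g)) \<longlonglongrightarrow> 0"
    using good_event_whp[of "\<epsilon> / 16"] \<epsilon> by auto
  have "\<forall>\<^sub>F n in sequentially. measure (gauss (upper (Suc n))) (?B n) < \<eta>" if \<eta>: "\<eta> > 0" for \<eta>
  proof -
    \<comment> \<open>The rescaled drop has mean at most 1, so by Markov it reaches \<open>K\<close>
      with probability at most 1/K = \<eta>/2.\<close>
    define K where "K = 2 / \<eta>"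
    have K: "K > 0" using \<eta> by (simp add: K_def)
    have "\<forall>\<^sub>F n in sequentially. \<P>(g in gauss (upper (Suc n)). \<not> good_event n \<kappa> \<rho> g) < \<eta> / 2"
      using lim by (rule order_tendstoD) (use \<eta> in simp)
    then show ?thesis using eventually_good_imp[OF \<epsilon> \<kappa> \<rho> K] eventually_ge_at_top[of 1]
    proof eventually_elim
      case (elim n)
      let ?M = "gauss (upper (Suc n))"
      let ?G = "{g \<in> space ?M. \<not> good_event n \<kappa> \<rho> g}" and ?Y = "{g \<in> space ?M. K \<le> Suc n * corner_drop n g}"
      have G: "?G \<in> sets ?M" by (intro sets_Collect_not sets_good_event)
      have Y: "?Y \<in> sets ?M"
        by (intro borel_measurable_le borel_measurable_const borel_measurable_times measurable_corner_drop)
      have "measure ?M ?Y \<le> (\<integral>g. Suc n * corner_drop n g \<partial>?M) / K"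
        using integral_corner_drop(1)[OF elim(3)] corner_drop_bounds[OF elim(3)] K
        by (intro integral_Markov_inequality_measure[where A = "{}"]) auto
      also have "\<dots> \<le> 1 / K" using integral_corner_drop(2)[OF elim(3)] K by (intro divide_right_mono) auto
      also have "\<dots> = \<eta> / 2" by (simp add: K_def)
      finally have 1: "measure ?M ?Y \<le> \<eta> / 2" .
      have "?B n \<subseteq> ?G \<union> ?Y" using elim(2) by force
      then have "measure ?M (?B n) \<le> measure ?M (?G \<union> ?Y)"
        using G Y by (intro gauss.finite_measure_mono) auto
      also have "\<dots> \<le> measure ?M ?G + measure ?M ?Y" using G Y by (rule measure_Un_le)
      also have "\<dots> < \<eta>" using 1 elim(1) by simp
      finally show ?case .
    qed
  qed
  then show ?thesis by (intro order_tendstoI) (auto simp: eventually_sequentially intro: exI[of _ 0] less_le_trans[OF _ measure_nonneg])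
qed

text \<open>Approximately Z \<le> X \<le> Y, while the mean of Y is at most that of Z. The positive
  part of Z - Y is then small in mean, hence so is |Y - Z|, and X is caught in between. The second
  moment of Z prevents the exceptional event from carrying much of its mean.\<close>

lemma in_probability_squeeze:
  fixes M :: "nat \<Rightarrow> 'a measure" and X Y Z :: "nat \<Rightarrow> 'a \<Rightarrow> real"
  assumes prob: "\<And>n. n \<ge> 1 \<Longrightarrow> prob_space (M n)"
    and X: "\<And>n. n \<ge> 1 \<Longrightarrow> X n \<in> borel_measurable (M n)"
    and Y: "\<And>n. n \<ge> 1 \<Longrightarrow> integrable (M n) (Y n)" "\<And>n \<omega>. n \<ge> 1 \<Longrightarrow> 0 \<le> Y n \<omega>" "\<And>n. n \<ge> 1 \<Longrightarrow> (\<integral>\<omega>. Y n \<omega> \<partial>M n) \<le> 1"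
    and Z: "\<And>n. n \<ge> 1 \<Longrightarrow> integrable (M n) (Z n)" "\<And>n \<omega>. n \<ge> 1 \<Longrightarrow> 0 \<le> Z n \<omega>" "\<And>n. n \<ge> 1 \<Longrightarrow> (\<integral>\<omega>. Z n \<omega> \<partial>M n) = 1"
    and Z2: "\<And>n. n \<ge> 1 \<Longrightarrow> integrable (M n) (\<lambda>\<omega>. (Z n \<omega>)\<^sup>2)" "\<And>n. n \<ge> 1 \<Longrightarrow> (\<integral>\<omega>. (Z n \<omega>)\<^sup>2 \<partial>M n) \<le> 3"
    and whp: "\<And>e. 0 < e \<Longrightarrow> e \<le> 1 \<Longrightarrow> (\<lambda>n. measure (M n) {\<omega> \<in> space (M n).
      \<not> (Z n \<omega> \<le> (1 + e) * X n \<omega> + e \<and> X n \<omega> \<le> (1 + e) * Y n \<omega> + e)}) \<longlonglongrightarrow> 0"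
    and \<epsilon>: "\<epsilon> > 0"
  shows "(\<lambda>n. measure (M n) {\<omega> \<in> space (M n). \<epsilon> \<le> \<bar>X n \<omega> - Z n \<omega>\<bar>}) \<longlonglongrightarrow> 0"
proof -
  have "\<forall>\<^sub>F n in sequentially. measure (M n) {\<omega> \<in> space (M n). \<epsilon> \<le> \<bar>X n \<omega> - Z n \<omega>\<bar>} < \<eta>" if \<eta>: "\<eta> > 0" for \<eta>
  proof -
    \<comment> \<open>The final bound contains 22 e / \<epsilon>, which is thereby at most
      \<eta>/3.\<close>
    define e where "e = min 1 (\<eta> * \<epsilon> / 66)"
    have e: "0 < e" "e \<le> 1" "e \<le> \<eta> * \<epsilon> / 66" using \<eta> \<epsilon> by (auto simp: e_def)
    let ?B = "\<lambda>n. {\<omega> \<in> space (M n). \<not> (Z n \<omega> \<le> (1 + e) * X n \<omega> + e \<and> X n \<omega> \<le> (1 + e) * Y n \<omega> + e)}"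
    have lim: "(\<lambda>n. measure (M n) (?B n)) \<longlonglongrightarrow> 0" by (rule whp[OF e(1,2)])
    have "\<forall>\<^sub>F n in sequentially. measure (M n) (?B n) < min (\<eta> / 3) (\<eta> * \<epsilon> * e / 3)"
      using lim by (rule order_tendstoD) (use \<eta> \<epsilon> e in auto)
    then show ?thesis using eventually_ge_at_top[of 1]
    proof eventually_elim
      case (elim n)
      note n = elim(2)
      interpret prob_space "M n" by (rule prob[OF n])
      define p where "p = measure (M n) (?B n)"
      have p: "p < \<eta> / 3" "p < \<eta> * \<epsilon> * e / 3" "p \<ge> 0" using elim(1) by (auto simp: p_def)
      note X[OF n, measurable]
      have Ym [measurable]: "Y n \<in> borel_measurable (M n)" and Zm [measurable]: "Z n \<in> borel_measurable (M n)"
        using Y(1)[OF n] Z(1)[OF n] by auto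
      have B [measurable]: "?B n \<in> sets (M n)" by measurable
      have iB: "integrable (M n) (indicator (?B n) :: 'a \<Rightarrow> real)" by (intro integrable_real_indicator B) (simp add: emeasure_eq_measure)
      \<comment> \<open>A majorant of the positive part of Z - Y. On the good event chaining the two
        inequalities costs 3 e Y + 3 e; on \<open>?B n\<close> the bound Z \<le> e Z^2 + 1/(4e) is
        used.\<close>
      define V where "V = (\<lambda>\<omega>. 3 * e * Y n \<omega> + 3 * e + e * (Z n \<omega>)\<^sup>2 + 1 / (4 * e) * indicator (?B n) \<omega>)"
      have iV: "integrable (M n) V" unfolding V_def using Y(1)[OF n] Z2(1)[OF n] iB by (intro Bochner_Integration.integrable_add integrable_mult_right) auto
      have EV: "(\<integral>\<omega>. V \<omega> \<partial>M n) \<le> 9 * e + p / (4 * e)"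
      proof -
        have "(\<integral>\<omega>. V \<omega> \<partial>M n) = 3 * e * (\<integral>\<omega>. Y n \<omega> \<partial>M n) + 3 * e + e * (\<integral>\<omega>. (Z n \<omega>)\<^sup>2 \<partial>M n) + 1 / (4 * e) * p"
          unfolding V_def using Y(1)[OF n] Z2(1)[OF n] iB B by (simp add: p_def prob_space)
        also have "\<dots> \<le> 3 * e * 1 + 3 * e + e * 3 + 1 / (4 * e) * p"
          using Y(3)[OF n] Z2(2)[OF n] e by (intro add_mono mult_left_mono) auto
        finally show ?thesis by simp
      qed
      have ZV: "max 0 (Z n \<omega> - Y n \<omega>) \<le> V \<omega>" if \<omega>: "\<omega> \<in> space (M n)" for \<omega>
      proof -
        have y: "0 \<le> Y n \<omega>" and z: "0 \<le> Z n \<omega>" using Y(2)[OF n] Z(2)[OF n] by auto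
        have V0: "0 \<le> V \<omega>" unfolding V_def using y e by (intro add_nonneg_nonneg) auto
        have "Z n \<omega> - Y n \<omega> \<le> V \<omega>"
        proof (cases "\<omega> \<in> ?B n")
          case True
          have "0 \<le> (2 * e * Z n \<omega> - 1)\<^sup>2 / (4 * e)" using e by simp
          also have "\<dots> = e * (Z n \<omega>)\<^sup>2 + 1 / (4 * e) - Z n \<omega>" using e by (simp add: power2_eq_square field_simps)
          finally have "Z n \<omega> \<le> e * (Z n \<omega>)\<^sup>2 + 1 / (4 * e)" by simp
          moreover have "0 \<le> 3 * e * Y n \<omega> + 3 * e" using y e by simp
          moreover have "V \<omega> = 3 * e * Y n \<omega> + 3 * e + e * (Z n \<omega>)\<^sup>2 + 1 / (4 * e)" using True by (simp add: V_def)
          ultimately show ?thesis using y by linarith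
        next
          case False
          then have zx: "Z n \<omega> \<le> (1 + e) * X n \<omega> + e" and xy: "X n \<omega> \<le> (1 + e) * Y n \<omega> + e" using \<omega> by auto
          have "Z n \<omega> \<le> (1 + e) * ((1 + e) * Y n \<omega> + e) + e"
            using zx mult_left_mono[OF xy, of "1 + e"] e by linarith
          also have "\<dots> = Y n \<omega> + 2 * e * Y n \<omega> + e * e * Y n \<omega> + 2 * e + e * e" by (simp add: algebra_simps)
          also have "\<dots> \<le> Y n \<omega> + 2 * e * Y n \<omega> + e * Y n \<omega> + 2 * e + e"
          proof -
            have ee: "e * e \<le> e" using e mult_left_mono[OF e(2), of e] by simp
            then show ?thesis using mult_right_mono[OF ee y] by linarith
          qed
          also have "\<dots> = Y n \<omega> + (3 * e * Y n \<omega> + 3 * e)" by (simp add: algebra_simps)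
          finally have "Z n \<omega> - Y n \<omega> \<le> 3 * e * Y n \<omega> + 3 * e" by simp
          also have "\<dots> \<le> V \<omega>" unfolding V_def using e by simp
          finally show ?thesis .
        qed
        then show ?thesis using V0 by simp
      qed
      \<comment> \<open>Since |Y - Z| is Y - Z plus twice the positive part of Z - Y, this majorizes
        |Y - Z|. The last two terms are the error made in replacing |Y - Z| by |X - Z| on the good
        event.\<close>
      define W where "W = (\<lambda>\<omega>. Y n \<omega> - Z n \<omega> + 2 * V \<omega> + 2 * e * Y n \<omega> + 2 * e)"
      have iW: "integrable (M n) W"
        unfolding W_def using Y(1)[OF n] Z(1)[OF n] iV
        by (intro Bochner_Integration.integrable_add Bochner_Integration.integrable_diff integrable_mult_right) auto
      have EW: "(\<integral>\<omega>. W \<omega> \<partial>M n) \<le> 22 * e + p / (2 * e)"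
      proof -
        have "(\<integral>\<omega>. W \<omega> \<partial>M n) = (\<integral>\<omega>. Y n \<omega> \<partial>M n) - 1 + 2 * (\<integral>\<omega>. V \<omega> \<partial>M n) + 2 * e * (\<integral>\<omega>. Y n \<omega> \<partial>M n) + 2 * e"
          unfolding W_def using Y(1)[OF n] Z(1)[OF n] iV Z(3)[OF n] by (simp add: prob_space)
        also have "\<dots> \<le> 1 - 1 + 2 * (9 * e + p / (4 * e)) + 2 * e * 1 + 2 * e"
          using Y(3)[OF n] EV e by (intro add_mono diff_mono mult_left_mono) auto
        finally show ?thesis by (simp add: field_simps)
      qed
      have W: "\<bar>Y n \<omega> - Z n \<omega>\<bar> + 2 * e * Y n \<omega> + 2 * e \<le> W \<omega>" if "\<omega> \<in> space (M n)" for \<omega>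
        using ZV[OF that] unfolding W_def by (auto simp: abs_if max_def split: if_splits)
      have W0: "0 \<le> W \<omega>" if "\<omega> \<in> space (M n)" for \<omega>
      proof -
        have "0 \<le> 2 * e * Y n \<omega> + 2 * e" using Y(2)[OF n] e by simp
        then show ?thesis using W[OF that] by linarith
      qed
      have good: "\<bar>X n \<omega> - Z n \<omega>\<bar> \<le> W \<omega>" if \<omega>: "\<omega> \<in> space (M n)" "\<omega> \<notin> ?B n" for \<omega>
      proof -
        have zx: "Z n \<omega> \<le> (1 + e) * X n \<omega> + e" and xy: "X n \<omega> \<le> (1 + e) * Y n \<omega> + e" using \<omega> by auto
        have y: "0 \<le> Y n \<omega>" using Y(2)[OF n] by auto
        have ey: "0 \<le> e * Y n \<omega>" using e y by simp
        have "X n \<omega> - Z n \<omega> \<le> (Y n \<omega> - Z n \<omega>) + e * Y n \<omega> + e" using xy by (simp add: algebra_simps)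
        then have 1: "X n \<omega> - Z n \<omega> \<le> W \<omega>" using W[OF \<omega>(1)] ey e by linarith
        have "e * X n \<omega> \<le> e * ((1 + e) * Y n \<omega> + e)" using xy e by (intro mult_left_mono) auto
        also have "\<dots> = e * Y n \<omega> + e * (e * Y n \<omega>) + e * e" by (simp add: algebra_simps)
        also have "\<dots> \<le> e * Y n \<omega> + 1 * (e * Y n \<omega>) + 1 * e"
          using e ey y by (intro add_mono mult_right_mono) auto
        finally have "Z n \<omega> - X n \<omega> \<le> 2 * e * Y n \<omega> + 2 * e" using zx by (simp add: algebra_simps)
        then show ?thesis using 1 W[OF \<omega>(1)] by linarith
      qed
      let ?W = "{\<omega> \<in> space (M n). \<epsilon> \<le> W \<omega>}"
      have Wm: "W \<in> borel_measurable (M n)" using iW by auto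
      have Ws: "?W \<in> sets (M n)" using Wm by measurable
      have "measure (M n) {\<omega> \<in> space (M n). \<epsilon> \<le> \<bar>X n \<omega> - Z n \<omega>\<bar>} \<le> measure (M n) (?B n \<union> ?W)"
      proof (rule finite_measure_mono)
        show "{\<omega> \<in> space (M n). \<epsilon> \<le> \<bar>X n \<omega> - Z n \<omega>\<bar>} \<subseteq> ?B n \<union> ?W" using good by force
      qed (use B Ws in auto)
      also have "\<dots> \<le> p + measure (M n) ?W" unfolding p_def by (rule measure_Un_le[OF B Ws])
      also have "measure (M n) ?W \<le> (\<integral>\<omega>. W \<omega> \<partial>M n) / \<epsilon>"
        using iW W0 \<epsilon> by (intro integral_Markov_inequality_measure[where A = "{}"]) auto
      also have "\<dots> \<le> (22 * e + p / (2 * e)) / \<epsilon>" using EW \<epsilon> by (intro divide_right_mono) auto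
      also have "\<dots> \<le> \<eta> / 3 + \<eta> / 6"
      proof -
        have "22 * e / \<epsilon> \<le> \<eta> / 3" using e(3) \<epsilon> by (simp add: field_simps)
        moreover have "p / (2 * e) / \<epsilon> \<le> \<eta> / 6" using p(2) e(1) \<epsilon> by (simp add: field_simps)
        ultimately show ?thesis unfolding add_divide_distrib by linarith
      qed
      finally show ?case using p(1) \<eta> by simp
    qed
  qed
  then show ?thesis by (intro order_tendstoI) (auto simp: eventually_sequentially intro: exI[of _ 0] less_le_trans[OF _ measure_nonneg])
qed

lemma std_gauss_moments:
  "integrable std_gauss (\<lambda>x. x\<^sup>2)" "(\<integral>x. x\<^sup>2 \<partial>std_gauss) = 1"
  "integrable std_gauss (\<lambda>x. (x\<^sup>2)\<^sup>2)" "(\<integral>x. (x\<^sup>2)\<^sup>2 \<partial>std_gauss) = 3"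
proof -
  have m2: "has_bochner_integral lborel (\<lambda>x. std_normal_density x * x\<^sup>2) 1"
    using std_normal_moment_even[of 1] by simp
  have m4: "has_bochner_integral lborel (\<lambda>x. std_normal_density x * (x\<^sup>2)\<^sup>2) 3"
    using std_normal_moment_even[of 2] by (simp add: fact_numeral power_mult[symmetric])
  show "integrable std_gauss (\<lambda>x. x\<^sup>2)" "integrable std_gauss (\<lambda>x. (x\<^sup>2)\<^sup>2)"
    using m2 m4 by (auto simp: std_gauss_def integrable_density has_bochner_integral_iff)
  show "(\<integral>x. x\<^sup>2 \<partial>std_gauss) = 1" "(\<integral>x. (x\<^sup>2)\<^sup>2 \<partial>std_gauss) = 3"
    using m2 m4 by (auto simp: std_gauss_def integral_density has_bochner_integral_iff)
qed

theorem gap_minus_proj_square: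
  assumes "\<epsilon> > 0"
  shows "(\<lambda>n. \<P>(g in gauss (upper (Suc n)).
    \<epsilon> \<le> \<bar>sqrt n * gap n g - (proj n g)\<^sup>2\<bar>)) \<longlonglongrightarrow> 0"
proof (rule in_probability_squeeze[where Y = "\<lambda>n g. Suc n * corner_drop n g"])
  fix n :: nat assume n: "n \<ge> 1"
  have pm: "proj n \<in> borel_measurable (gauss (upper (Suc n)))" using n by (intro measurable_proj) auto
  have pd: "distr (gauss (upper (Suc n))) borel (proj n) = std_gauss" using n by (intro distr_proj) auto
  show "integrable (gauss (upper (Suc n))) (\<lambda>g. (proj n g)\<^sup>2)" "(\<integral>g. (proj n g)\<^sup>2 \<partial>gauss (upper (Suc n))) = 1"
    using std_gauss_moments(1,2) pm unfolding pd[symmetric] by (simp_all add: integrable_distr_eq integral_distr)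
  show "integrable (gauss (upper (Suc n))) (\<lambda>g. ((proj n g)\<^sup>2)\<^sup>2)" "(\<integral>g. ((proj n g)\<^sup>2)\<^sup>2 \<partial>gauss (upper (Suc n))) \<le> 3"
    using std_gauss_moments(3,4) pm unfolding pd[symmetric] by (simp_all add: integrable_distr_eq integral_distr)
  show "(\<lambda>g. sqrt n * gap n g) \<in> borel_measurable (gauss (upper (Suc n)))"
    using n by (intro borel_measurable_times borel_measurable_const measurable_gap) auto
  show "integrable (gauss (upper (Suc n))) (\<lambda>g. Suc n * corner_drop n g)" "(\<integral>g. Suc n * corner_drop n g \<partial>gauss (upper (Suc n))) \<le> 1"
    using integral_corner_drop[OF n] by auto
  show "0 \<le> Suc n * corner_drop n g" for g using corner_drop_bounds[OF n, of g] by simp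
qed (use assms gap_sandwich_whp prob_space_gauss in auto)

section \<open>Weak convergence\<close>

text \<open>Uniform continuity on a compact box. Points vanishing off \<open>I\<close> lie in a
  product of intervals and singletons, and the radius R + 1 leaves room for the perturbed
  point.\<close>

lemma bounded_continuous_perturbation:
  fixes F :: "(nat \<Rightarrow> real) \<Rightarrow> real"
  assumes F: "continuous_on UNIV F" and \<eta>: "\<eta> > 0" and I: "finite I"
  obtains \<delta> where "\<delta> > 0" "\<And>x z. (\<And>k. k \<notin> I \<Longrightarrow> x k = 0) \<Longrightarrow> (\<And>k. k \<notin> I \<Longrightarrow> z k = 0) \<Longrightarrow>
    (\<And>k. k \<in> I \<Longrightarrow> \<bar>z k\<bar> \<le> R) \<Longrightarrow> (\<And>k. k \<in> I \<Longrightarrow> \<bar>x k - z k\<bar> < \<delta>) \<Longrightarrow> \<bar>F x - F z\<bar> < \<eta>"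
proof -
  let ?C = "PiE UNIV (\<lambda>k. if k \<in> I then {- R - 1..R + 1} else {0}) :: (nat \<Rightarrow> real) set"
  have "compact ?C"
    unfolding compactin_euclidean_iff[symmetric] euclidean_product_topology[symmetric] compactin_PiE by auto
  then have "uniformly_continuous_on ?C F"
    using compact_uniformly_continuous continuous_on_subset[OF F] by blast
  then obtain d where d: "d > 0" "\<And>x z. x \<in> ?C \<Longrightarrow> z \<in> ?C \<Longrightarrow> dist x z < d \<Longrightarrow> dist (F x) (F z) < \<eta>"
    unfolding uniformly_continuous_on_def using \<eta> by metis
  \<comment> \<open>The 1 keeps \<open>x\<close> in the box. The distance on functions sums
    coordinate distances with weights of total 2, so d/4 per coordinate gives at most d/2.\<close>
  define \<delta> where "\<delta> = min 1 (d / 4)"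
  show ?thesis
  proof (rule that[of \<delta>])
    show "\<delta> > 0" using d by (simp add: \<delta>_def)
    fix x z :: "nat \<Rightarrow> real"
    assume x: "\<And>k. k \<notin> I \<Longrightarrow> x k = 0" and z: "\<And>k. k \<notin> I \<Longrightarrow> z k = 0"
      and zR: "\<And>k. k \<in> I \<Longrightarrow> \<bar>z k\<bar> \<le> R" and xz: "\<And>k. k \<in> I \<Longrightarrow> \<bar>x k - z k\<bar> < \<delta>"
    have zC: "z \<in> ?C" using zR z by (auto simp: abs_le_iff) (smt (verit) zR)+
    have xR: "- R - 1 \<le> x k \<and> x k \<le> R + 1" if "k \<in> I" for k
    proof -
      have "\<bar>z k\<bar> \<le> R" "\<bar>x k - z k\<bar> < 1" using zR[OF that] xz[OF that] by (auto simp: \<delta>_def)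
      then show ?thesis by linarith
    qed
    then have xC: "x \<in> ?C" using x by auto
    have le: "dist (x k) (z k) \<le> d / 4" for k
      using xz[of k] x[of k] z[of k] d(1) by (cases "k \<in> I") (auto simp: dist_real_def \<delta>_def)
    have "dist x z = (\<Sum>n. (1/2)^n * min (dist (x (from_nat n)) (z (from_nat n))) 1)"
      by (simp add: dist_fun_def)
    also have "\<dots> \<le> (\<Sum>n. (1/2)^n * (d / 4))"
    proof (rule suminf_le)
      show "(1/2)^n * min (dist (x (from_nat n)) (z (from_nat n))) 1 \<le> (1/2)^n * (d / 4)" for n
        using le[of "from_nat n"] by (intro mult_left_mono) auto
      show "summable (\<lambda>n. (1/2)^n * min (dist (x (from_nat n)) (z (from_nat n))) 1)"
        by (rule summable_comparison_test'[of "\<lambda>n. (1/2)^n"]) (auto simp: summable_geometric_iff)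
      show "summable (\<lambda>n. (1/2)^n * (d / 4))"
        by (intro summable_mult2) (auto simp: summable_geometric_iff)
    qed
    also have "\<dots> = 2 * (d / 4)"
      by (subst suminf_mult2[symmetric]) (auto simp: summable_geometric_iff suminf_geometric)
    also have "\<dots> < d" using d(1) by simp
    finally have "dist x z < d" .
    from d(2)[OF xC zC this] show "\<bar>F x - F z\<bar> < \<eta>" by (simp add: dist_real_def)
  qed
qed

text \<open>Points of the product space over \<open>I\<close> are \<open>undefined\<close>
  elsewhere; the value 0 there places them in a box of the full function space.\<close>

definition zero_extend :: "'i set \<Rightarrow> ('i \<Rightarrow> real) \<Rightarrow> 'i \<Rightarrow> real" where
  "zero_extend I z = (\<lambda>k. if k \<in> I then z k else 0)"

lemma continuous_map_imp_continuous_on_restrict: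
  fixes f :: "(nat \<Rightarrow> real) \<Rightarrow> real"
  assumes "continuous_map (product_topology (\<lambda>_. euclideanreal) I) euclideanreal f"
  shows "continuous_on UNIV (\<lambda>z. f (restrict z I))"
proof -
  have "continuous_map euclidean (product_topology (\<lambda>_. euclideanreal) I) (\<lambda>z :: nat \<Rightarrow> real. restrict z I)"
    unfolding continuous_map_componentwise
    by (auto simp: continuous_map_iff_continuous2)
  from continuous_map_compose[OF this assms] show ?thesis
    by (simp add: comp_def continuous_map_iff_continuous2)
qed

text \<open>Through \<open>zero_extend\<close> the function factors over the space of all functions
  on \<open>nat\<close>, whose product \<sigma>-algebra is the Borel one.\<close>

lemma borel_measurable_continuous_product:
  fixes f :: "(nat \<Rightarrow> real) \<Rightarrow> real"
  assumes f: "continuous_map (product_topology (\<lambda>_. euclideanreal) I) euclideanreal f"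
  shows "f \<in> borel_measurable (\<Pi>\<^sub>M k\<in>I. borel)"
proof -
  have "zero_extend I \<in> (\<Pi>\<^sub>M k\<in>I. borel) \<rightarrow>\<^sub>M (\<Pi>\<^sub>M k\<in>UNIV. borel :: real measure)"
    unfolding zero_extend_def
  proof (rule measurable_PiM_single')
    show "(\<lambda>z. if k \<in> I then z k else 0) \<in> (\<Pi>\<^sub>M k\<in>I. borel) \<rightarrow>\<^sub>M (borel :: real measure)" for k
      by (cases "k \<in> I") (auto intro: measurable_component_singleton)
  qed auto
  then have e: "zero_extend I \<in> (\<Pi>\<^sub>M k\<in>I. borel) \<rightarrow>\<^sub>M (borel :: (nat \<Rightarrow> real) measure)"
    by (simp add: measurable_cong_sets[OF refl sets_PiM_equal_borel])
  have "(\<lambda>z. f (restrict z I)) \<in> borel_measurable borel"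
    by (rule borel_measurable_continuous_onI[OF continuous_map_imp_continuous_on_restrict[OF f]])
  from measurable_compose[OF e this] have "(\<lambda>z. f (restrict (zero_extend I z) I)) \<in> borel_measurable (\<Pi>\<^sub>M k\<in>I. borel)" .
  moreover have "f (restrict (zero_extend I z) I) = f z" if "z \<in> space (\<Pi>\<^sub>M k\<in>I. borel)" for z
  proof -
    have "restrict (zero_extend I z) I = z"
      using that by (auto simp: space_PiM zero_extend_def fun_eq_iff PiE_def extensional_def)
    then show ?thesis by simp
  qed
  ultimately show ?thesis by (subst measurable_cong) auto
qed

text \<open>By \<open>law\<close> the integral of f at Z does not depend on n, so only its
  difference from the integral at X matters. Where all \<bar>Z\<bar> are at most R and X is close to
  Z, uniform continuity applies; the rest has small probability, by Markov for Z and by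
  \<open>conv\<close>.\<close>

lemma slutsky:
  fixes f :: "(nat \<Rightarrow> real) \<Rightarrow> real" and M :: "nat \<Rightarrow> 'a measure" and X Z :: "nat \<Rightarrow> nat \<Rightarrow> 'a \<Rightarrow> real"
  assumes f: "continuous_map (product_topology (\<lambda>_. euclideanreal) I) euclideanreal f"
    and bd: "bounded (f ` topspace (product_topology (\<lambda>_. euclideanreal) I))"
    and I: "finite I" and prob: "\<And>n. n \<ge> start \<Longrightarrow> prob_space (M n)"
    and X: "\<And>n k. n \<ge> start \<Longrightarrow> k \<in> I \<Longrightarrow> X k n \<in> borel_measurable (M n)"
    and Z: "\<And>n k. n \<ge> start \<Longrightarrow> k \<in> I \<Longrightarrow> integrable (M n) (Z k n)"
      "\<And>n k. n \<ge> start \<Longrightarrow> k \<in> I \<Longrightarrow> (\<integral>\<omega>. \<bar>Z k n \<omega>\<bar> \<partial>M n) \<le> 1"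
    and conv: "\<And>k \<epsilon>. k \<in> I \<Longrightarrow> \<epsilon> > 0 \<Longrightarrow> (\<lambda>n. measure (M n) {\<omega> \<in> space (M n). \<epsilon> \<le> \<bar>X k n \<omega> - Z k n \<omega>\<bar>}) \<longlonglongrightarrow> 0"
    and law: "\<And>n. n \<ge> start \<Longrightarrow> (\<integral>\<omega>. f (\<lambda>k\<in>I. Z k n \<omega>) \<partial>M n) = c"
  shows "(\<lambda>n. \<integral>\<omega>. f (\<lambda>k\<in>I. X k n \<omega>) \<partial>M n) \<longlonglongrightarrow> c"
proof (rule LIMSEQ_I)
  fix r :: real assume r: "r > 0"
  obtain B where B: "B > 0" "\<And>z. z \<in> PiE I (\<lambda>_. UNIV) \<Longrightarrow> \<bar>f z\<bar> \<le> B"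
    using bd unfolding bounded_pos by auto
  define \<eta> where "\<eta> = r / 2"
  define m where "m = real (card I) + 1"
  have m: "m > 0" by (simp add: m_def)
  \<comment> \<open>Chosen so that the exceptional contribution 2 B m (2/R) equals r/4. The 1 added
    in \<open>m\<close> keeps \<open>R\<close> positive for empty \<open>I\<close>.\<close>
  define R where "R = 16 * B * m / r"
  have R: "R > 0" using r B(1) m by (simp add: R_def)
  have \<eta>: "\<eta> > 0" using r by (simp add: \<eta>_def)
  obtain \<delta> where \<delta>: "\<delta> > 0" and unif: "\<And>x z. (\<And>k. k \<notin> I \<Longrightarrow> x k = 0) \<Longrightarrow> (\<And>k. k \<notin> I \<Longrightarrow> z k = 0) \<Longrightarrow>
    (\<And>k. k \<in> I \<Longrightarrow> \<bar>z k\<bar> \<le> R) \<Longrightarrow> (\<And>k. k \<in> I \<Longrightarrow> \<bar>x k - z k\<bar> < \<delta>) \<Longrightarrow> \<bar>f (restrict x I) - f (restrict z I)\<bar> < \<eta>"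
    using bounded_continuous_perturbation[OF continuous_map_imp_continuous_on_restrict[OF f] \<eta> I, of R] by metis
  have "\<forall>\<^sub>F n in sequentially. measure (M n) {\<omega> \<in> space (M n). \<delta> \<le> \<bar>X k n \<omega> - Z k n \<omega>\<bar>} < 1 / R" if "k \<in> I" for k
    using conv[OF that \<delta>] by (rule order_tendstoD) (use R in simp)
  then have "\<forall>\<^sub>F n in sequentially. \<forall>k\<in>I. measure (M n) {\<omega> \<in> space (M n). \<delta> \<le> \<bar>X k n \<omega> - Z k n \<omega>\<bar>} < 1 / R"
    using I by (simp add: eventually_ball_finite_distrib)
  then have "\<forall>\<^sub>F n in sequentially. norm ((\<integral>\<omega>. f (\<lambda>k\<in>I. X k n \<omega>) \<partial>M n) - c) < r"
    using eventually_ge_at_top[of start]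
  proof eventually_elim
    case (elim n)
    note n = elim(2)
    interpret prob_space "M n" by (rule prob[OF n])
    define U where "U = (\<lambda>k. {\<omega> \<in> space (M n). \<delta> \<le> \<bar>X k n \<omega> - Z k n \<omega>\<bar>})"
    define V where "V = (\<lambda>k. {\<omega> \<in> space (M n). R \<le> \<bar>Z k n \<omega>\<bar>})"
    have Zm: "Z k n \<in> borel_measurable (M n)" if "k \<in> I" for k using Z(1)[OF n that] by auto
    have Us: "U k \<in> sets (M n)" if "k \<in> I" for k
      unfolding U_def using X[OF n that] Zm[OF that] by measurable
    have Vs: "V k \<in> sets (M n)" if "k \<in> I" for k
      unfolding V_def using Zm[OF that] by measurable
    have Vle: "measure (M n) (V k) \<le> 1 / R" if "k \<in> I" for k
    proof -
      have "measure (M n) (V k) \<le> (\<integral>\<omega>. \<bar>Z k n \<omega>\<bar> \<partial>M n) / R"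
        unfolding V_def using Z(1)[OF n that] R by (intro integral_Markov_inequality_measure[where A = "{}"]) auto
      also have "\<dots> \<le> 1 / R" using Z(2)[OF n that] R by (intro divide_right_mono) auto
      finally show ?thesis .
    qed
    define b where "b = (\<lambda>\<omega>. \<Sum>k\<in>I. indicator (U k) \<omega> + indicator (V k) \<omega> :: real)"
    have fm: "(\<lambda>\<omega>. f (\<lambda>k\<in>I. Y k \<omega>)) \<in> borel_measurable (M n)" if "\<And>k. k \<in> I \<Longrightarrow> Y k \<in> borel_measurable (M n)" for Y
      by (rule measurable_compose[OF measurable_restrict borel_measurable_continuous_product[OF f]]) (rule that)
    have fi: "integrable (M n) (\<lambda>\<omega>. f (\<lambda>k\<in>I. Y k \<omega>))" if "\<And>k. k \<in> I \<Longrightarrow> Y k \<in> borel_measurable (M n)" for Y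
      by (rule integrable_const_bound[where B=B]) (use B(2) fm[OF that] in auto)
    have ib: "integrable (M n) b" unfolding b_def
      using Us Vs by (intro Bochner_Integration.integrable_sum Bochner_Integration.integrable_add integrable_real_indicator) (auto simp: emeasure_eq_measure)
    have Eb: "(\<integral>\<omega>. b \<omega> \<partial>M n) \<le> m * (2 / R)"
    proof -
      have "(\<integral>\<omega>. b \<omega> \<partial>M n) = (\<Sum>k\<in>I. measure (M n) (U k) + measure (M n) (V k))"
        unfolding b_def using Us Vs
        by (subst Bochner_Integration.integral_sum) (auto intro!: sum.cong Bochner_Integration.integrable_add integrable_real_indicator simp: emeasure_eq_measure)
      also have "\<dots> \<le> (\<Sum>k\<in>I. 1 / R + 1 / R)"
        using elim(1) Vle by (intro sum_mono add_mono) (auto simp: U_def less_imp_le)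
      also have "\<dots> \<le> m * (2 / R)" using R by (simp add: m_def distrib_right divide_right_mono)
      finally show ?thesis .
    qed
    have pt: "\<bar>f (\<lambda>k\<in>I. X k n \<omega>) - f (\<lambda>k\<in>I. Z k n \<omega>)\<bar> \<le> \<eta> + 2 * B * b \<omega>" if \<omega>: "\<omega> \<in> space (M n)" for \<omega>
    proof (cases "\<exists>k\<in>I. \<omega> \<in> U k \<or> \<omega> \<in> V k")
      case True
      then obtain k where k: "k \<in> I" "\<omega> \<in> U k \<or> \<omega> \<in> V k" by auto
      have "1 \<le> (indicator (U k) \<omega> + indicator (V k) \<omega> :: real)" using k(2) by (auto simp: indicator_def)
      also have "\<dots> \<le> b \<omega>" unfolding b_def using I k(1) by (intro member_le_sum) auto
      finally have "2 * B * 1 \<le> 2 * B * b \<omega>" using B(1) by (intro mult_left_mono) auto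
      moreover have "\<bar>f (\<lambda>k\<in>I. X k n \<omega>)\<bar> \<le> B" "\<bar>f (\<lambda>k\<in>I. Z k n \<omega>)\<bar> \<le> B" using B(2) by auto
      ultimately show ?thesis using \<eta> by linarith
    next
      case False
      have "\<bar>f (restrict (zero_extend I (\<lambda>k. X k n \<omega>)) I) - f (restrict (zero_extend I (\<lambda>k. Z k n \<omega>)) I)\<bar> < \<eta>"
        using False \<omega> by (intro unif) (auto simp: zero_extend_def U_def V_def not_le less_imp_le)
      moreover have "restrict (zero_extend I z) I = restrict z I" for z
        by (auto simp: zero_extend_def fun_eq_iff)
      moreover have "0 \<le> b \<omega>" unfolding b_def by (intro sum_nonneg) auto
      ultimately show ?thesis using B(1) by (smt (verit) mult_nonneg_nonneg)
    qed
    have "\<bar>(\<integral>\<omega>. f (\<lambda>k\<in>I. X k n \<omega>) \<partial>M n) - c\<bar> = \<bar>\<integral>\<omega>. f (\<lambda>k\<in>I. X k n \<omega>) - f (\<lambda>k\<in>I. Z k n \<omega>) \<partial>M n\<bar>"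
      unfolding law[OF n, symmetric]
      by (subst Bochner_Integration.integral_diff) (auto intro!: fi X[OF n] Zm)
    also have "\<dots> \<le> (\<integral>\<omega>. \<bar>f (\<lambda>k\<in>I. X k n \<omega>) - f (\<lambda>k\<in>I. Z k n \<omega>)\<bar> \<partial>M n)"
      by (rule integral_abs_bound)
    also have "\<dots> \<le> (\<integral>\<omega>. \<eta> + 2 * B * b \<omega> \<partial>M n)"
      using ib pt by (intro integral_mono Bochner_Integration.integrable_abs Bochner_Integration.integrable_diff fi X[OF n] Zm) auto
    also have "\<dots> = \<eta> + 2 * B * (\<integral>\<omega>. b \<omega> \<partial>M n)" using ib by (simp add: prob_space)
    also have "\<dots> \<le> \<eta> + 2 * B * (m * (2 / R))" using Eb B(1) by (intro add_left_mono mult_left_mono) auto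
    also have "\<dots> = r / 2 + r / 4" using B(1) m r by (simp add: \<eta>_def R_def)
    also have "\<dots> < r" using r by simp
    finally show ?case by simp
  qed
  then show "\<exists>no. \<forall>n\<ge>no. norm ((\<integral>\<omega>. f (\<lambda>k\<in>I. X k n \<omega>) \<partial>M n) - c) < r"
    by (simp add: eventually_sequentially)
qed


section \<open>From eigenvalues of matrices to Gaussian coordinates\<close>

lemma max_eigenvalue_eq:
  assumes A: "A \<in> carrier_mat n n" "transpose_mat A = A" and n: "n \<ge> 1"
  shows "max_eigenvalue A = rayleigh_max n (quad n (\<lambda>i j. A $$ (i, j)))"
proof -
  define C where "C = (\<lambda>i j. A $$ (i, j))"
  have sym: "C i j = C j i" if "i < n" "j < n" for i j
    using A that index_transpose_mat(1)[of i A j] by (auto simp: C_def)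
  have mult: "(A *\<^sub>v v) $ i = mv n C (\<lambda>j. v $ j) i" if "v \<in> carrier_vec n" "i < n" for v i
    using A that by (auto simp: mv_def C_def scalar_prod_def row_def lessThan_atLeast0)
  obtain v where v: "ip n v v = 1" "quad n C v = rayleigh_max n (quad n C)"
    "\<And>y. quad n C y \<le> rayleigh_max n (quad n C) * ip n y y"
    using rayleigh_max_attained[OF n] by metis
  have "eigenvector A (vec n v) (rayleigh_max n (quad n C))"
    unfolding eigenvector_def
  proof (intro conjI)
    show "vec n v \<in> carrier_vec (dim_row A)" using A by auto
    show "vec n v \<noteq> 0\<^sub>v (dim_row A)"
    proof
      assume eq: "vec n v = 0\<^sub>v (dim_row A)"
      have "v i = 0" if "i < n" for i using arg_cong[OF eq, of "\<lambda>w. w $ i"] that A by auto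
      then have "ip n v v = 0" by (simp add: ip_self_eq_0_iff)
      then show False using v(1) by simp
    qed
    show "A *\<^sub>v vec n v = rayleigh_max n (quad n C) \<cdot>\<^sub>v vec n v"
    proof (rule eq_vecI)
      fix i assume "i < dim_vec (rayleigh_max n (quad n C) \<cdot>\<^sub>v vec n v)"
      then have i: "i < n" by simp
      have "(A *\<^sub>v vec n v) $ i = mv n C v i" using mult[of "vec n v" i] i by (simp add: mv_def)
      also have "\<dots> = rayleigh_max n (quad n C) * v i"
        by (rule maximizer_eigenvector(2)[OF sym v(3) _ i]) (use v in auto)
      finally show "(A *\<^sub>v vec n v) $ i = (rayleigh_max n (quad n C) \<cdot>\<^sub>v vec n v) $ i" using i by simp
    qed (use A in auto)
  qed
  then have 1: "eigenvalue A (rayleigh_max n (quad n C))" by (auto simp: eigenvalue_def)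
  have 2: "k \<le> rayleigh_max n (quad n C)" if k: "eigenvalue A k" for k
  proof -
    obtain w where w: "w \<in> carrier_vec n" "w \<noteq> 0\<^sub>v n" "A *\<^sub>v w = k \<cdot>\<^sub>v w"
      using k A by (auto simp: eigenvalue_def eigenvector_def)
    let ?w = "\<lambda>j. w $ j"
    have "quad n C ?w = ip n ?w (\<lambda>i. k * w $ i)"
      unfolding quad_def bil_eq_ip_mv using w mult[OF w(1)] by (intro ip_cong) auto
    then have "k * ip n ?w ?w \<le> rayleigh_max n (quad n C) * ip n ?w ?w"
      using v(3)[of ?w] by (simp add: ip_linear)
    moreover have "ip n ?w ?w > 0"
    proof -
      have "ip n ?w ?w \<noteq> 0"
        using w(1,2) by (auto simp: ip_self_eq_0_iff intro!: eq_vecI)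
      then show ?thesis using ip_nonneg[of n ?w] by linarith
    qed
    ultimately show ?thesis by simp
  qed
  \<comment> \<open>\<open>Max\<close> is meaningful only for a finite spectrum.\<close>
  have "char_poly A \<noteq> 0" using degree_monic_char_poly[OF A(1)] by auto
  then have "finite {k. eigenvalue A k}"
    unfolding eigenvalue_root_char_poly[OF A(1)] by (rule poly_roots_finite)
  then show ?thesis
    unfolding max_eigenvalue_def C_def[symmetric] by (intro Max_eqI) (use 1 2 in auto)
qed

lemma top_left_properties:
  assumes A: "A \<in> carrier_mat N N" and m: "m \<le> N"
  shows "top_left m A \<in> carrier_mat m m" "i < m \<Longrightarrow> j < m \<Longrightarrow> top_left m A $$ (i, j) = A $$ (i, j)"
proof -
  have "{i. i < N \<and> i \<in> {..<m}} = {..<m}" using m by auto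
  then show "top_left m A \<in> carrier_mat m m"
    using A dim_submatrix[of A "{..<m}" "{..<m}"] by (auto simp: top_left_def)
  have c: "card {a \<in> {..<m}. a < i} = i" if "i < m" for i
  proof -
    have "{a \<in> {..<m}. a < i} = {..<i}" using that by auto
    then show ?thesis by simp
  qed
  show "top_left m A $$ (i, j) = A $$ (i, j)" if "i < m" "j < m"
    using submatrix_index_card[of i A j "{..<m}" "{..<m}"] that A m c by (auto simp: top_left_def)
qed

lemma minor_eigenvalue_eq:
  assumes A: "A \<in> carrier_mat N N" "transpose_mat A = A" and k: "1 \<le> k" "k \<le> N"
  shows "minor_eigenvalue N k A = rayleigh_max (N + 1 - k) (quad (N + 1 - k) (\<lambda>i j. A $$ (i, j)))"
proof -
  define m where "m = N + 1 - k"
  have m: "m \<le> N" "m \<ge> 1" using k by (auto simp: m_def)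
  have sym: "A $$ (i, j) = A $$ (j, i)" if "i < N" "j < N" for i j
    using A that index_transpose_mat(1)[of i A j] by auto
  note T = top_left_properties[OF A(1) m(1)]
  have "transpose_mat (top_left m A) = top_left m A"
    using T sym m by (intro eq_matI) auto
  then have "max_eigenvalue (top_left m A) = rayleigh_max m (quad m (\<lambda>i j. top_left m A $$ (i, j)))"
    by (rule max_eigenvalue_eq[OF T(1) _ m(2)])
  also have "quad m (\<lambda>i j. top_left m A $$ (i, j)) = quad m (\<lambda>i j. A $$ (i, j))"
    by (rule quad_cong_coeff) (rule T(2))
  finally show ?thesis by (simp add: minor_eigenvalue_def m_def)
qed

definition normalized_entries :: "nat \<Rightarrow> real mat \<Rightarrow> nat \<times> nat \<Rightarrow> real" where
  "normalized_entries N A = (\<lambda>p\<in>upper N. A $$ p / (if fst p = snd p then sqrt (2 * N) else sqrt N))"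

lemma distributed_divide_normal:
  assumes "prob_space P" "distributed P lborel X (normal_density 0 \<sigma>)" "\<sigma> > 0"
  shows "distr P borel (\<lambda>\<omega>. X \<omega> / \<sigma>) = std_gauss"
proof -
  have "distributed P lborel (\<lambda>\<omega>. 0 + 1 / \<sigma> * X \<omega>) (normal_density (0 + 1 / \<sigma> * 0) (\<bar>1 / \<sigma>\<bar> * \<sigma>))"
    by (rule prob_space.normal_density_affine[OF assms(1,2)]) (use assms in auto)
  then have "distr P lborel (\<lambda>\<omega>. X \<omega> / \<sigma>) = std_gauss"
    using assms(3) by (simp add: distributed_def std_gauss_def)
  then show ?thesis by (simp cong: distr_cong)
qed

lemma distr_normalized_entries:
  assumes G: "goe P N (2 * real N) A" and N: "N \<ge> 1"
  shows "(\<lambda>\<omega>. normalized_entries N (A \<omega>)) \<in> P \<rightarrow>\<^sub>M gauss (upper N)"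
    and "distr P (gauss (upper N)) (\<lambda>\<omega>. normalized_entries N (A \<omega>)) = gauss (upper N)"
proof -
  interpret prob_space P using G by (simp add: goe_def)
  define \<sigma> where "\<sigma> = (\<lambda>p :: nat \<times> nat. if fst p = snd p then sqrt (2 * N) else sqrt N)"
  define X where "X = (\<lambda>p \<omega>. A \<omega> $$ p / \<sigma> p)"
  have ind: "indep_vars (\<lambda>_. borel) (\<lambda>p \<omega>. A \<omega> $$ p) (upper N)"
  proof -
    have "indep_vars (\<lambda>_. borel) (\<lambda>(i, j) \<omega>. A \<omega> $$ (i, j)) {(i, j). i \<le> j \<and> j < N}"
      using G by (simp add: goe_def)
    moreover have "(\<lambda>(i, j) \<omega>. A \<omega> $$ (i, j)) = (\<lambda>p \<omega>. A \<omega> $$ p)" by auto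
    ultimately show ?thesis by (simp add: upper_def)
  qed
  have indX: "indep_vars (\<lambda>_. borel) X (upper N)"
    unfolding X_def by (rule indep_vars_compose2[OF ind]) simp
  have d: "distr P borel (X p) = std_gauss" if p: "p \<in> upper N" for p
  proof -
    obtain i j where ij: "p = (i, j)" "i \<le> j" "j < N" using p by (auto simp: upper_def)
    have "distributed P lborel (\<lambda>\<omega>. A \<omega> $$ p) (normal_density 0 (\<sigma> p))"
    proof (cases "i = j")
      case True
      then show ?thesis using G ij by (simp add: goe_def \<sigma>_def)
    next
      case False
      then have "distributed P lborel (\<lambda>\<omega>. A \<omega> $$ (i, j)) (normal_density 0 (sqrt (2 * real N / 2)))"
        using G ij by (simp add: goe_def)
      then show ?thesis using False ij by (simp add: \<sigma>_def)
    qed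
    then show ?thesis unfolding X_def
      by (rule distributed_divide_normal[OF prob_space_axioms]) (use N in \<open>simp add: \<sigma>_def\<close>)
  qed
  have rv: "X p \<in> borel_measurable P" if "p \<in> upper N" for p
    using indX that by (auto simp: indep_vars_def)
  have ne: "upper N \<noteq> {}" using N by (auto simp: upper_def intro!: exI[of _ 0])
  have eq: "(\<lambda>\<omega>. normalized_entries N (A \<omega>)) = (\<lambda>\<omega>. \<lambda>p\<in>upper N. X p \<omega>)"
    by (simp add: normalized_entries_def X_def \<sigma>_def)
  show "(\<lambda>\<omega>. normalized_entries N (A \<omega>)) \<in> P \<rightarrow>\<^sub>M gauss (upper N)"
    unfolding eq measurable_cong_sets[OF refl sets_gauss] by (rule measurable_restrict) (rule rv)
  have "distr P (\<Pi>\<^sub>M p\<in>upper N. borel) (\<lambda>\<omega>. \<lambda>p\<in>upper N. X p \<omega>) = (\<Pi>\<^sub>M p\<in>upper N. distr P borel (X p))"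
    using indep_vars_iff_distr_eq_PiM'[OF ne, of X "\<lambda>_. borel"] rv indX by simp
  also have "\<dots> = gauss (upper N)" unfolding gauss_def using d by (intro PiM_cong) auto
  finally show "distr P (gauss (upper N)) (\<lambda>\<omega>. normalized_entries N (A \<omega>)) = gauss (upper N)"
    unfolding eq by (simp cong: distr_cong add: sets_gauss)
qed

lemma entries_eq_sym_coeff:
  assumes A: "A \<in> carrier_mat N N" "transpose_mat A = A" and ij: "i < N" "j < N"
  shows "A $$ (i, j) = sqrt N * sym_coeff (normalized_entries N A) i j"
proof -
  have N: "real N > 0" using ij by simp
  have sym: "A $$ (i, j) = A $$ (j, i)"
    using A ij index_transpose_mat(1)[of i A j] by auto
  consider "i = j" | "i < j" | "j < i" by linarith
  then show ?thesis
    by cases (use N ij sym in \<open>simp_all add: sym_coeff_def normalized_entries_def upper_def real_sqrt_mult\<close>)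
qed

lemma minor_eigenvalue_diff:
  assumes G: "goe P N (2 * real N) A" and \<omega>: "\<omega> \<in> space P" and k: "1 \<le> k" "k < N"
  shows "minor_eigenvalue N k (A \<omega>) - minor_eigenvalue N (k + 1) (A \<omega>) = sqrt N * gap (N - k) (normalized_entries N (A \<omega>))"
proof -
  have A: "A \<omega> \<in> carrier_mat N N" "transpose_mat (A \<omega>) = A \<omega>" using G \<omega> by (auto simp: goe_def)
  have eq: "rayleigh_max m (quad m (\<lambda>i j. A \<omega> $$ (i, j))) = sqrt N * rayleigh_max m (goe_quad m (normalized_entries N (A \<omega>)))"
    if m: "1 \<le> m" "m \<le> N" for m
  proof -
    have "quad m (\<lambda>i j. A \<omega> $$ (i, j)) = quad m (\<lambda>i j. sqrt N * sym_coeff (normalized_entries N (A \<omega>)) i j)"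
      by (rule quad_cong_coeff) (use entries_eq_sym_coeff[OF A] m in auto)
    then show ?thesis using rayleigh_max_scale[of m "sqrt N"] m by simp
  qed
  have n: "N + 1 - k = Suc (N - k)" "N + 1 - (k + 1) = N - k" using k by auto
  show ?thesis
    using minor_eigenvalue_eq[OF A, of k] minor_eigenvalue_eq[OF A, of "k + 1"] eq[of "Suc (N - k)"] eq[of "N - k"] k
    unfolding n gap_def by (simp add: right_diff_distrib)
qed

section \<open>Squares of standard normal variables and the Gamma law\<close>

lemma gamma_half_density_eq: "x > 0 \<Longrightarrow> gamma_density (1 / 2) (1 / 2) (x\<^sup>2) * (2 * x) = 2 * std_normal_density x"
proof -
  assume x: "x > 0"
  have 1: "(x\<^sup>2) powr (1 / 2 - 1) = 1 / x"
    using x by (simp add: powr_minus powr_half_sqrt inverse_eq_divide)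
  have 2: "(1 / 2 :: real) powr (1 / 2) = 1 / sqrt 2" by (simp add: powr_half_sqrt real_sqrt_divide)
  show ?thesis
    using x unfolding gamma_density_def Gamma_one_half_real 1 2 std_normal_density_def
    by (simp add: real_sqrt_mult field_simps)
qed

text \<open>The two square roots contribute equally, which gives the factor 2. The null set {0} is
  removed so that the two half-intervals are exchanged by x \<mapsto> -x and the result has the form
  obtained on the Gamma side.\<close>

lemma emeasure_std_gauss_square_le:
  assumes "a > 0"
  shows "emeasure std_gauss {x. x\<^sup>2 \<le> a} = (\<integral>\<^sup>+x. ennreal (2 * std_normal_density x) * indicator {0<..sqrt a} x \<partial>lborel)"
proof -
  have 0: "emeasure std_gauss {x. x\<^sup>2 \<le> a} = (\<integral>\<^sup>+x. ennreal (std_normal_density x) * indicator {x. x\<^sup>2 \<le> a} x \<partial>lborel)"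
    unfolding std_gauss_def by (rule emeasure_density) auto
  have iff: "x\<^sup>2 \<le> a \<longleftrightarrow> \<bar>x\<bar> \<le> sqrt a" for x :: real
    using assms by (metis abs_le_square_iff abs_of_nonneg less_imp_le real_sqrt_ge_zero real_sqrt_pow2)
  have "(\<integral>\<^sup>+x. ennreal (std_normal_density x) * indicator {x. x\<^sup>2 \<le> a} x \<partial>lborel) =
    (\<integral>\<^sup>+x. ennreal (std_normal_density x) * indicator {0<..sqrt a} x + ennreal (std_normal_density x) * indicator {- sqrt a..<0} x \<partial>lborel)"
  proof (rule nn_integral_cong_AE)
    show "AE x in lborel. ennreal (std_normal_density x) * indicator {x. x\<^sup>2 \<le> a} x =
      ennreal (std_normal_density x) * indicator {0<..sqrt a} x + ennreal (std_normal_density x) * indicator {- sqrt a..<0} x"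
      using AE_lborel_singleton[of 0]
    proof eventually_elim
      case (elim x)
      then show ?case by (auto simp: indicator_def iff abs_le_iff)
    qed
  qed
  also have "\<dots> = (\<integral>\<^sup>+x. ennreal (std_normal_density x) * indicator {0<..sqrt a} x \<partial>lborel) +
    (\<integral>\<^sup>+x. ennreal (std_normal_density x) * indicator {- sqrt a..<0} x \<partial>lborel)"
    by (rule nn_integral_add) auto
  also have "(\<integral>\<^sup>+x. ennreal (std_normal_density x) * indicator {- sqrt a..<0} x \<partial>lborel) =
    (\<integral>\<^sup>+x. ennreal (std_normal_density (- x)) * indicator {- sqrt a..<0} (- x) \<partial>lborel)"
    using nn_integral_real_affine[of "\<lambda>x. ennreal (std_normal_density x) * indicator {- sqrt a..<0} x" "-1" 0] by simp
  also have "\<dots> = (\<integral>\<^sup>+x. ennreal (std_normal_density x) * indicator {0<..sqrt a} x \<partial>lborel)"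
    by (rule nn_integral_cong) (auto simp: indicator_def std_normal_density_def)
  finally show ?thesis
    unfolding 0 by (simp add: nn_integral_add[symmetric] ennreal_mult distrib_right[symmetric] mult_2[symmetric] mult.assoc nn_integral_cmult)
qed

text \<open>Substitution of x^2, whose Jacobian 2 x cancels the singularity of the Gamma density; at
  0 that density has the default value 0.\<close>

lemma emeasure_gamma_half_le:
  assumes "a > 0"
  shows "emeasure (density lborel (gamma_density (1 / 2) (1 / 2))) {..a} =
    (\<integral>\<^sup>+x. ennreal (2 * std_normal_density x) * indicator {0<..sqrt a} x \<partial>lborel)"
proof -
  have m: "(\<lambda>x. ennreal (gamma_density (1 / 2) (1 / 2) x)) \<in> borel_measurable borel"
    unfolding gamma_density_def by measurable
  have nn: "gamma_density (1 / 2) (1 / 2) x \<ge> 0" for x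
    by (simp add: gamma_density_def Gamma_one_half_real)
  have "emeasure (density lborel (gamma_density (1 / 2) (1 / 2))) {..a} =
    (\<integral>\<^sup>+x. ennreal (gamma_density (1 / 2) (1 / 2) x) * indicator {..a} x \<partial>lborel)"
    by (rule emeasure_density) (use m in auto)
  also have "\<dots> = (\<integral>\<^sup>+x. ennreal (gamma_density (1 / 2) (1 / 2) x) * indicator {0\<^sup>2..(sqrt a)\<^sup>2} x \<partial>lborel)"
    using assms by (intro nn_integral_cong) (auto simp: indicator_def gamma_density_def)
  also have "\<dots> = (\<integral>\<^sup>+x. ennreal (gamma_density (1 / 2) (1 / 2) (x\<^sup>2)) * ennreal (2 * x) * indicator {0..sqrt a} x \<partial>lborel)"
    by (rule nn_integral_substitution_aux[OF m])
       (use assms in \<open>auto intro!: derivative_eq_intros continuous_intros\<close>)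
  also have "\<dots> = (\<integral>\<^sup>+x. ennreal (2 * std_normal_density x) * indicator {0<..sqrt a} x \<partial>lborel)"
  proof (rule nn_integral_cong)
    fix x :: real
    show "ennreal (gamma_density (1 / 2) (1 / 2) (x\<^sup>2)) * ennreal (2 * x) * indicator {0..sqrt a} x =
      ennreal (2 * std_normal_density x) * indicator {0<..sqrt a} x"
    proof (cases "x > 0")
      case True
      then show ?thesis using gamma_half_density_eq[OF True] nn
        by (simp add: ennreal_mult[symmetric] indicator_def)
    next
      case False
      then show ?thesis by (auto simp: indicator_def)
    qed
  qed
  finally show ?thesis .
qed

lemma distr_std_gauss_square: "distr std_gauss borel (\<lambda>x. x\<^sup>2) = density lborel (gamma_density (1 / 2) (1 / 2))"
proof (rule measure_eqI_generator_eq[where \<Omega> = UNIV and E = "range (\<lambda>a. {..a})" and A = "\<lambda>n. {..real n}"])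
  have m: "(\<lambda>x::real. x\<^sup>2) \<in> borel_measurable std_gauss" unfolding measurable_cong_sets[OF sets_std_gauss refl] by measurable
  fix X :: "real set" assume "X \<in> range (\<lambda>a. {..a})"
  then obtain a where X: "X = {..a}" by auto
  have 1: "emeasure (distr std_gauss borel (\<lambda>x. x\<^sup>2)) X = emeasure std_gauss {x. x\<^sup>2 \<le> a}"
    unfolding X by (subst emeasure_distr[OF m]) (auto simp: vimage_def)
  show "emeasure (distr std_gauss borel (\<lambda>x. x\<^sup>2)) X = emeasure (density lborel (gamma_density (1 / 2) (1 / 2))) X"
  proof (cases "a > 0")
    case True
    then show ?thesis unfolding 1 unfolding X by (simp add: emeasure_std_gauss_square_le emeasure_gamma_half_le)
  next
    case False
    have mm: "(\<lambda>x. ennreal (gamma_density (1 / 2) (1 / 2) x)) \<in> borel_measurable borel"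
      unfolding gamma_density_def by measurable
    have "emeasure (density lborel (gamma_density (1 / 2) (1 / 2))) X = (\<integral>\<^sup>+x. ennreal (gamma_density (1 / 2) (1 / 2) x) * indicator {..a} x \<partial>lborel)"
      unfolding X by (rule emeasure_density) (use mm in auto)
    also have "\<dots> = (\<integral>\<^sup>+x. 0 \<partial>(lborel :: real measure))"
      using False by (intro nn_integral_cong) (auto simp: indicator_def gamma_density_def)
    finally have 2: "emeasure (density lborel (gamma_density (1 / 2) (1 / 2))) X = 0" by simp
    have "{x :: real. x\<^sup>2 \<le> a} \<subseteq> {0}" using False by (auto simp: not_less) (metis order_trans power2_less_eq_zero_iff)
    then have "emeasure std_gauss {x. x\<^sup>2 \<le> a} \<le> emeasure std_gauss {0}" by (rule emeasure_mono) simp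
    also have "\<dots> = (\<integral>\<^sup>+x. ennreal (std_normal_density x) * indicator {0} x \<partial>lborel)"
      unfolding std_gauss_def by (rule emeasure_density) auto
    also have "\<dots> = 0" by (subst nn_integral_0_iff_AE) (use AE_lborel_singleton[of "0::real"] in \<open>auto elim!: eventually_mono simp: indicator_def\<close>)
    finally show ?thesis unfolding 1 2 by simp
  qed
next
  show "Int_stable (range (\<lambda>a :: real. {..a}))" by (auto simp: Int_stable_def)
  show "(\<Union>i. {..real i}) = UNIV" using real_arch_simple by auto
  interpret prob_space "distr std_gauss borel (\<lambda>x. x\<^sup>2)"
    by (rule std_gauss.prob_space_distr) (simp add: measurable_cong_sets[OF sets_std_gauss refl])
  show "emeasure (distr std_gauss borel (\<lambda>x. x\<^sup>2)) {..real i} \<noteq> \<infinity>" for i by simp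
qed (auto simp: borel_eq_atMost)

abbreviation gamma_half :: "real measure" where
  "gamma_half \<equiv> density lborel (gamma_density (1 / 2) (1 / 2))"

lemma measurable_square_std_gauss: "(\<lambda>x. x\<^sup>2) \<in> borel_measurable std_gauss"
  unfolding measurable_cong_sets[OF sets_std_gauss refl] by measurable

lemma prob_space_gamma_half: "prob_space gamma_half"
  unfolding distr_std_gauss_square[symmetric]
  by (rule std_gauss.prob_space_distr[OF measurable_square_std_gauss])

text \<open>\<open>emeasure_proj_box\<close> under the reflection k \<mapsto> N - k. The projections
  of index below N - K are unconstrained and contribute factors 1.\<close>

lemma distr_proj_squares:
  assumes K: "K < N"
  shows "(\<lambda>g. \<lambda>k\<in>{1..K}. (proj (N - k) g)\<^sup>2) \<in> gauss (upper N) \<rightarrow>\<^sub>M (\<Pi>\<^sub>M k\<in>{1..K}. borel)" (is "?S \<in> _")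
    and "distr (gauss (upper N)) (\<Pi>\<^sub>M k\<in>{1..K}. borel) (\<lambda>g. \<lambda>k\<in>{1..K}. (proj (N - k) g)\<^sup>2) = (\<Pi>\<^sub>M k\<in>{1..K}. gamma_half)"
proof -
  show m: "?S \<in> gauss (upper N) \<rightarrow>\<^sub>M (\<Pi>\<^sub>M k\<in>{1..K}. borel)"
    using K by (intro measurable_restrict borel_measurable_power measurable_proj) auto
  interpret prob_space gamma_half by (rule prob_space_gamma_half)
  interpret product_prob_space "\<lambda>_. gamma_half" "{1..K}" by standard
  show "distr (gauss (upper N)) (\<Pi>\<^sub>M k\<in>{1..K}. borel) ?S = (\<Pi>\<^sub>M k\<in>{1..K}. gamma_half)"
  proof (rule PiM_eqI)
    show "sets (distr (gauss (upper N)) (\<Pi>\<^sub>M k\<in>{1..K}. borel) ?S) = sets (\<Pi>\<^sub>M k\<in>{1..K}. gamma_half)"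
      by (simp cong: sets_PiM_cong)
    fix A :: "nat \<Rightarrow> real set" assume "\<And>k. k \<in> {1..K} \<Longrightarrow> A k \<in> sets gamma_half"
    then have A: "A k \<in> sets borel" if "k \<in> {1..K}" for k using that by simp
    define A' where "A' = (\<lambda>m. if m \<in> {N - K..<N} then {x. x\<^sup>2 \<in> A (N - m)} else UNIV)"
    have sq: "{x. x\<^sup>2 \<in> A k} \<in> sets borel" if "k \<in> {1..K}" for k
      using measurable_sets[OF measurable_square_std_gauss A[OF that]] by (simp add: vimage_def)
    have "m \<in> {N - K..<N} \<Longrightarrow> N - m \<in> {1..K}" for m using K by auto
    then have A': "A' m \<in> sets borel" for m
      unfolding A'_def using sq[of "N - m"] by (auto simp del: atLeastAtMost_iff)
    have "emeasure (distr (gauss (upper N)) (\<Pi>\<^sub>M k\<in>{1..K}. borel) ?S) (PiE {1..K} A) =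
      emeasure (gauss (upper N)) {g \<in> space (gauss (upper N)). \<forall>m\<in>{1..<N}. proj m g \<in> A' m}"
    proof (subst emeasure_distr[OF m])
      show "PiE {1..K} A \<in> sets (\<Pi>\<^sub>M k\<in>{1..K}. borel)" using A by (intro sets_PiM_I_finite) auto
      have "(\<forall>k\<in>{1..K}. (proj (N - k) g)\<^sup>2 \<in> A k) \<longleftrightarrow> (\<forall>m\<in>{1..<N}. proj m g \<in> A' m)" for g
      proof
        assume L: "\<forall>k\<in>{1..K}. (proj (N - k) g)\<^sup>2 \<in> A k"
        show "\<forall>m\<in>{1..<N}. proj m g \<in> A' m"
        proof
          fix m assume m: "m \<in> {1..<N}"
          show "proj m g \<in> A' m"
          proof (cases "N - K \<le> m")
            case True
            then have "N - m \<in> {1..K}" "N - (N - m) = m" using m by auto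
            then show ?thesis using L[rule_format, of "N - m"] by (simp add: A'_def)
          qed (simp add: A'_def)
        qed
      next
        assume R: "\<forall>m\<in>{1..<N}. proj m g \<in> A' m"
        show "\<forall>k\<in>{1..K}. (proj (N - k) g)\<^sup>2 \<in> A k"
        proof
          fix k assume "k \<in> {1..K}"
          then have "N - k \<in> {1..<N}" "N - k \<in> {N - K..<N}" "N - (N - k) = k" using K by auto
          then show "(proj (N - k) g)\<^sup>2 \<in> A k" using R[rule_format, of "N - k"] by (simp add: A'_def)
        qed
      qed
      then show "emeasure (gauss (upper N)) (?S -` PiE {1..K} A \<inter> space (gauss (upper N))) =
        emeasure (gauss (upper N)) {g \<in> space (gauss (upper N)). \<forall>m\<in>{1..<N}. proj m g \<in> A' m}"
        by (intro arg_cong[where f="emeasure _"]) (auto simp: PiE_iff)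
    qed
    also have "\<dots> = (\<Prod>m\<in>{1..<N}. emeasure std_gauss (A' m))" by (rule emeasure_proj_box[OF A'])
    also have "\<dots> = (\<Prod>m\<in>{N - K..<N}. emeasure std_gauss (A' m))"
      using K std_gauss.emeasure_space_1 by (intro prod.mono_neutral_right) (auto simp: A'_def)
    also have "\<dots> = (\<Prod>k\<in>{1..K}. emeasure gamma_half (A k))"
    proof (rule prod.reindex_bij_witness[of _ "\<lambda>k. N - k" "\<lambda>m. N - m"])
      fix m assume "m \<in> {N - K..<N}"
      then have m: "N - m \<in> {1..K}" "A' m = {x. x\<^sup>2 \<in> A (N - m)}" using K by (auto simp: A'_def)
      show "emeasure gamma_half (A (N - m)) = emeasure std_gauss (A' m)"
        unfolding m(2) distr_std_gauss_square[symmetric]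
        using A[OF m(1)] by (subst emeasure_distr[OF measurable_square_std_gauss]) (auto simp: vimage_def)
    qed (use K in auto)
    finally show "emeasure (distr (gauss (upper N)) (\<Pi>\<^sub>M k\<in>{1..K}. borel) ?S) (PiE {1..K} A) = (\<Prod>k\<in>{1..K}. emeasure gamma_half (A k))" .
  qed simp
qed

section \<open>Transfer from corners to the matrix of size N\<close>

lemma measure_gauss_restrict:
  assumes "m \<le> N" "A \<in> sets (gauss (upper m))"
  shows "\<P>(g in gauss (upper N). restrict g (upper m) \<in> A) = measure (gauss (upper m)) A"
proof -
  have U: "upper m \<subseteq> upper N" using assms(1) by (auto simp: upper_def)
  have mr: "(\<lambda>g. restrict g (upper m)) \<in> gauss (upper N) \<rightarrow>\<^sub>M gauss (upper m)"
    unfolding gauss_def using U by (intro measurable_restrict_subset)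
  have "measure (gauss (upper m)) A = measure (distr (gauss (upper N)) (gauss (upper m)) (\<lambda>g. restrict g (upper m))) A"
    by (simp add: distr_gauss_restrict[OF U])
  also have "\<dots> = \<P>(g in gauss (upper N). restrict g (upper m) \<in> A)"
    by (subst measure_distr[OF mr assms(2)]) (simp add: vimage_def Int_def conj_commute)
  finally show ?thesis by simp
qed

lemma gap_restrict: "gap n (restrict g (upper (Suc n))) = gap n g"
proof -
  have s: "sym_coeff (restrict g (upper (Suc n))) i j = sym_coeff g i j" if "i < Suc n" "j < Suc n" for i j
    by (rule sym_coeff_eq_upper[OF _ that]) simp
  have "goe_quad (Suc n) (restrict g (upper (Suc n))) = goe_quad (Suc n) g"
    by (rule quad_cong_coeff) (use s in auto)
  moreover have "goe_quad n (restrict g (upper (Suc n))) = goe_quad n g"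
    by (rule quad_cong_coeff) (use s in auto)
  ultimately show ?thesis by (simp add: gap_def)
qed

lemma proj_restrict: "proj n (restrict g (upper (Suc n))) = proj n g"
proof -
  have "top_dir n (restrict g (upper (Suc n))) = top_dir n g"
    by (rule top_dir_eq_upper) (auto simp: upper_def)
  moreover have "sym_coeff (restrict g (upper (Suc n))) i n = sym_coeff g i n" if "i < n" for i
    by (rule sym_coeff_eq_upper[of "Suc n"]) (use that in auto)
  ultimately show ?thesis unfolding proj_def by (auto intro!: ip_cong)
qed

lemma integral_proj_square:
  assumes "n \<ge> 1" "n < N"
  shows "integrable (gauss (upper N)) (\<lambda>g. (proj n g)\<^sup>2)" "(\<integral>g. (proj n g)\<^sup>2 \<partial>gauss (upper N)) = 1"
  using std_gauss_moments(1,2) measurable_proj[OF assms] unfolding distr_proj[OF assms, symmetric]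
  by (simp_all add: integrable_distr_eq integral_distr)

text \<open>For the corner of size n = N - k the natural scale is \<surd>n, whereas the
  normalization of the whole matrix produces \<surd>N. The ratio \<open>c n\<close> tends to 1, and
  the extra term (c n - 1) (u \<bullet> b)^2 is small by Markov because the square has mean
  1.\<close>

lemma scaled_gap_minus_proj_square:
  fixes \<epsilon> :: real
  assumes \<epsilon>: "\<epsilon> > 0" and k: "k \<ge> 1"
  shows "(\<lambda>N. \<P>(g in gauss (upper N). \<epsilon> \<le> \<bar>sqrt N * gap (N - k) g - (proj (N - k) g)\<^sup>2\<bar>)) \<longlonglongrightarrow> 0"
proof (rule LIMSEQ_offset[where k = k])
  define c where "c = (\<lambda>n. sqrt ((real n + real k) / real n))"
  \<comment> \<open>As \<open>c n\<close> < 2 eventually, the deviation \<epsilon>/4 contributes at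
    most \<epsilon>/2 after rescaling; the other \<epsilon>/2 goes to the extra term, controlled by
    \<open>?W\<close>.\<close>
  let ?V = "\<lambda>n. {g \<in> space (gauss (upper (Suc n))). \<epsilon> / 4 \<le> \<bar>sqrt n * gap n g - (proj n g)\<^sup>2\<bar>}"
  have lim: "(\<lambda>n. measure (gauss (upper (Suc n))) (?V n) + (c n - 1) * (2 / \<epsilon>)) \<longlonglongrightarrow> 0 + 0 * (2 / \<epsilon>)"
  proof (intro tendsto_intros gap_minus_proj_square)
    show "(\<lambda>n. c n - 1) \<longlonglongrightarrow> 0" unfolding c_def by real_asymp
  qed (use \<epsilon> in simp)
  have c2: "\<forall>\<^sub>F n in sequentially. c n < 2"
  proof (rule order_tendstoD)
    show "c \<longlonglongrightarrow> 1" unfolding c_def by real_asymp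
  qed simp
  have le: "\<forall>\<^sub>F n in sequentially. \<P>(g in gauss (upper (n + k)).
      \<epsilon> \<le> \<bar>sqrt (n + k) * gap (n + k - k) g - (proj (n + k - k) g)\<^sup>2\<bar>) \<le>
    measure (gauss (upper (Suc n))) (?V n) + (c n - 1) * (2 / \<epsilon>)"
    using c2 eventually_ge_at_top[of 1]
  proof eventually_elim
    case (elim n)
    note n = elim(2)
    let ?M = "gauss (upper (Suc n))"
    have gm: "gap n \<in> borel_measurable ?M" and pm: "proj n \<in> borel_measurable ?M"
      using n by (auto intro: measurable_gap measurable_proj)
    let ?U = "{g \<in> space ?M. \<epsilon> \<le> \<bar>sqrt (n + k) * gap n g - (proj n g)\<^sup>2\<bar>}"
    have Us: "?U \<in> sets ?M" using gm pm by measurable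
    have Vs: "?V n \<in> sets ?M" using gm pm by measurable
    have c1: "c n > 1" using n k by (simp add: c_def)
    let ?W = "{g \<in> space ?M. \<epsilon> / (2 * (c n - 1)) \<le> (proj n g)\<^sup>2}"
    have Ws: "?W \<in> sets ?M" using pm by measurable
    have "{g \<in> space (gauss (upper (n + k))). \<epsilon> \<le> \<bar>sqrt (n + k) * gap (n + k - k) g - (proj (n + k - k) g)\<^sup>2\<bar>}
      = {g \<in> space (gauss (upper (n + k))). restrict g (upper (Suc n)) \<in> ?U}"
    proof -
      have "restrict g (upper (Suc n)) \<in> space ?M" for g by (auto simp: space_gauss)
      then show ?thesis by (auto simp: gap_restrict proj_restrict)
    qed
    then have "\<P>(g in gauss (upper (n + k)).
        \<epsilon> \<le> \<bar>sqrt (n + k) * gap (n + k - k) g - (proj (n + k - k) g)\<^sup>2\<bar>) = measure ?M ?U"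
      using measure_gauss_restrict[OF _ Us, of "n + k"] k by simp
    also have "\<dots> \<le> measure ?M (?V n \<union> ?W)"
    proof (rule gauss.finite_measure_mono)
      show "?U \<subseteq> ?V n \<union> ?W"
      proof
        fix g assume g: "g \<in> ?U"
        show "g \<in> ?V n \<union> ?W"
        proof (rule ccontr)
          assume "g \<notin> ?V n \<union> ?W"
          then have v: "\<bar>sqrt n * gap n g - (proj n g)\<^sup>2\<bar> < \<epsilon> / 4" and w: "(proj n g)\<^sup>2 < \<epsilon> / (2 * (c n - 1))"
            using g by auto
          have cs: "sqrt (n + k) = c n * sqrt n" using n by (simp add: c_def real_sqrt_divide)
          have "sqrt (n + k) * gap n g - (proj n g)\<^sup>2 = c n * (sqrt n * gap n g - (proj n g)\<^sup>2) + (c n - 1) * (proj n g)\<^sup>2"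
            unfolding cs by (simp add: algebra_simps)
          then have "\<bar>sqrt (n + k) * gap n g - (proj n g)\<^sup>2\<bar> \<le> c n * \<bar>sqrt n * gap n g - (proj n g)\<^sup>2\<bar> + (c n - 1) * (proj n g)\<^sup>2"
            using c1 abs_triangle_ineq[of "c n * (sqrt n * gap n g - (proj n g)\<^sup>2)" "(c n - 1) * (proj n g)\<^sup>2"]
            by (simp add: abs_mult)
          also have "\<dots> < 2 * (\<epsilon> / 4) + \<epsilon> / 2"
          proof (rule add_le_less_mono)
            show "c n * \<bar>sqrt n * gap n g - (proj n g)\<^sup>2\<bar> \<le> 2 * (\<epsilon> / 4)"
              using v c1 elim(1) \<epsilon> by (intro mult_mono) auto
            show "(c n - 1) * (proj n g)\<^sup>2 < \<epsilon> / 2"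
              using w c1 by (simp add: pos_less_divide_eq algebra_simps)
          qed
          finally show False using g by simp
        qed
      qed
    qed (use Vs Ws in auto)
    also have "\<dots> \<le> measure ?M (?V n) + measure ?M ?W" by (rule measure_Un_le[OF Vs Ws])
    also have "measure ?M ?W \<le> (\<integral>g. (proj n g)\<^sup>2 \<partial>?M) / (\<epsilon> / (2 * (c n - 1)))"
      using integral_proj_square(1)[of n "Suc n"] n c1 \<epsilon> by (intro integral_Markov_inequality_measure[where A = "{}"]) auto
    also have "\<dots> = (c n - 1) * (2 / \<epsilon>)"
      using integral_proj_square(2)[of n "Suc n"] n by simp
    finally show ?case by simp
  qed
  have "\<forall>\<^sub>F n in sequentially. 0 \<le> \<P>(g in gauss (upper (n + k)).
      \<epsilon> \<le> \<bar>sqrt (n + k) * gap (n + k - k) g - (proj (n + k - k) g)\<^sup>2\<bar>)"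
    by (intro always_eventually allI measure_nonneg)
  then show "(\<lambda>n. \<P>(g in gauss (upper (n + k)).
      \<epsilon> \<le> \<bar>sqrt (n + k) * gap (n + k - k) g - (proj (n + k - k) g)\<^sup>2\<bar>)) \<longlonglongrightarrow> 0"
    by (rule tendsto_sandwich[OF _ le tendsto_const lim[unfolded mult_zero_left add_0_left]])
qed

theorem corollary1p3:
  fixes P :: "nat \<Rightarrow> 'a measure" and H :: "nat \<Rightarrow> 'a \<Rightarrow> real mat" and K :: nat
  assumes "\<And>N. N \<ge> 1 \<Longrightarrow> goe (P N) N (2 * real N) (H N)"
  shows "weakly_converges (product_topology (\<lambda>_. euclideanreal) {1..K})
           (\<lambda>N. distr (P N) (\<Pi>\<^sub>M k\<in>{1..K}. borel)
              (\<lambda>\<omega>. \<lambda>k\<in>{1..K}. minor_eigenvalue N k (H N \<omega>) - minor_eigenvalue N (k + 1) (H N \<omega>)))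
           (\<Pi>\<^sub>M k\<in>{1..K}. density lborel (gamma_density (1/2) (1/2)))"
  unfolding weakly_converges_def
proof (intro allI impI, elim conjE)
  fix f :: "(nat \<Rightarrow> real) \<Rightarrow> real"
  assume f: "continuous_map (product_topology (\<lambda>_. euclideanreal) {1..K}) euclideanreal f"
    and bd: "bounded (f ` topspace (product_topology (\<lambda>_. euclideanreal) {1..K}))"
  let ?Q = "\<Pi>\<^sub>M k\<in>{1..K}. borel :: real measure"
  note fm = borel_measurable_continuous_product[OF f]
  have lim: "(\<lambda>N. \<integral>g. f (\<lambda>k\<in>{1..K}. sqrt N * gap (N - k) g) \<partial>gauss (upper N)) \<longlonglongrightarrow> (\<integral>x. f x \<partial>(\<Pi>\<^sub>M k\<in>{1..K}. gamma_half))"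
  \<comment> \<open>From N = K + 1 on every corner size N - k with k \<le> K is at least 1, which
    \<open>proj\<close> and \<open>gap\<close> require.\<close>
  proof (rule slutsky[where start = "Suc K" and M = "\<lambda>N. gauss (upper N)" and X = "\<lambda>k N g. sqrt N * gap (N - k) g" and Z = "\<lambda>k N g. (proj (N - k) g)\<^sup>2", OF f bd])
    fix N assume N: "Suc K \<le> N"
    show "(\<integral>g. f (\<lambda>k\<in>{1..K}. (proj (N - k) g)\<^sup>2) \<partial>gauss (upper N)) = (\<integral>x. f x \<partial>(\<Pi>\<^sub>M k\<in>{1..K}. gamma_half))"
      using N integral_distr[OF distr_proj_squares(1)[of K N] fm] distr_proj_squares(2)[of K N] by simp
    fix k assume k: "k \<in> {1..K}"
    show "(\<lambda>g. sqrt N * gap (N - k) g) \<in> borel_measurable (gauss (upper N))"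
      using N k by (intro borel_measurable_times borel_measurable_const measurable_gap) auto
    show "integrable (gauss (upper N)) (\<lambda>g. (proj (N - k) g)\<^sup>2)" "(\<integral>g. \<bar>(proj (N - k) g)\<^sup>2\<bar> \<partial>gauss (upper N)) \<le> 1"
      using N k integral_proj_square[of "N - k" N] by auto
  next
    fix k :: nat and \<epsilon> :: real assume "k \<in> {1..K}" "\<epsilon> > 0"
    then show "(\<lambda>N. \<P>(g in gauss (upper N).
        \<epsilon> \<le> \<bar>sqrt N * gap (N - k) g - (proj (N - k) g)\<^sup>2\<bar>)) \<longlonglongrightarrow> 0"
      by (intro scaled_gap_minus_proj_square) auto
  qed (simp_all add: prob_space_gauss)
  \<comment> \<open>For N \<le> K some of the K + 1 corners are empty or do not exist; these
    finitely many N do not affect the limit.\<close>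
  have eq: "(\<integral>x. f x \<partial>distr (P N) ?Q (\<lambda>\<omega>. \<lambda>k\<in>{1..K}. minor_eigenvalue N k (H N \<omega>) - minor_eigenvalue N (k + 1) (H N \<omega>))) =
    (\<integral>g. f (\<lambda>k\<in>{1..K}. sqrt N * gap (N - k) g) \<partial>gauss (upper N))" if N: "K < N" for N
  proof -
    let ?h = "\<lambda>g. \<lambda>k\<in>{1..K}. sqrt N * gap (N - k) g"
    have G: "goe (P N) N (2 * real N) (H N)" using assms N by simp
    note E = distr_normalized_entries[OF G]
    have hm: "?h \<in> gauss (upper N) \<rightarrow>\<^sub>M ?Q"
      using N by (intro measurable_restrict borel_measurable_times borel_measurable_const measurable_gap) auto
    have "distr (P N) ?Q (\<lambda>\<omega>. \<lambda>k\<in>{1..K}. minor_eigenvalue N k (H N \<omega>) - minor_eigenvalue N (k + 1) (H N \<omega>)) =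
      distr (P N) ?Q (\<lambda>\<omega>. ?h (normalized_entries N (H N \<omega>)))"
      using N by (intro distr_cong refl restrict_ext minor_eigenvalue_diff[OF G]) auto
    also have "\<dots> = distr (gauss (upper N)) ?Q ?h"
      using distr_distr[OF hm E(1)] E(2) N by (simp add: comp_def)
    finally show ?thesis using integral_distr[OF hm fm] by simp
  qed
  have "\<forall>\<^sub>F N in sequentially. (\<integral>g. f (\<lambda>k\<in>{1..K}. sqrt N * gap (N - k) g) \<partial>gauss (upper N)) =
    (\<integral>x. f x \<partial>distr (P N) ?Q (\<lambda>\<omega>. \<lambda>k\<in>{1..K}. minor_eigenvalue N k (H N \<omega>) - minor_eigenvalue N (k + 1) (H N \<omega>)))"
    using eventually_gt_at_top[of K] by eventually_elim (rule eq[symmetric])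
  from Lim_transform_eventually[OF lim this]
  show "(\<lambda>N. \<integral>x. f x \<partial>distr (P N) ?Q (\<lambda>\<omega>. \<lambda>k\<in>{1..K}. minor_eigenvalue N k (H N \<omega>) - minor_eigenvalue N (k + 1) (H N \<omega>)))
    \<longlonglongrightarrow> (\<integral>x. f x \<partial>(\<Pi>\<^sub>M k\<in>{1..K}. gamma_half))" .
qed

end
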